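(* Let $\mathcal{P}=\{P_A:A\in\mathcal{B}\}$ be a generative Poisson point process defined on a standard probability space $(\Omega,\mathcal{F},\mathbb{P})$ with base space a standard measure space $(X,\mathcal{B},\mu)$, and let $G$ be a Polish group. Then: (1) For every measure preserving action $\mathbf{T}:G\curvearrowright(X,\mathcal{B},\mu)$ there exists a Poissonian action $\mathbf{S}:G\curvearrowright(\Omega,\mathcal{F},\mathbb{P})$ with respect to $\mathcal{P}$ for which $\mathbf{T}$ is a base action. Moreover, $\mathbf{S}$ is essentially unique, in the sense that Poissonian actions of $G$ (with respect to possibly different generative Poisson point processes) whose base actions are isomorphic are themselves isomorphic. (2) Every Poissonian action $\mathbf{S}:G\curvearrowright(\Omega,\mathcal{F},\mathbb{P})$ with respect to $\mathcal{P}$ admits a base action $\mathbf{T}:G\curvearrowright(X,\mathcal{B},\mu)$, and it is essentially unique: if $\mathbf{T}'$ is another base action of $\mathbf{S}$ on $(X,\mathcal{B},\mu)$, then for every $g\in G$, $T_g=T'_g$ on a $\mu$-conull set.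
   Context: A standard measure space $(X,\mathcal{B},\mu)$ is a standard Borel space with a non-atomic Borel measure that is either a probability measure (then it is called a standard probability space) or an infinite $\sigma$-finite measure. $\mathcal{B}_\mu=\{A\in\mathcal{B}:\mu(A)<\infty\}$. $\mathrm{Aut}(X,\mathcal{B},\mu)$ is the group of bi-measurable bijections between $\mu$-conull sets that preserve $\mu$, modulo equality on conull sets, with the Polish weak topology, in which $S_n\to\mathrm{Id}$ iff $\mu(S_nA\triangle A)\to0$ for every $A\in\mathcal{B}_\mu$. A (measure preserving, Boolean) action $\mathbf{T}:G\curvearrowright(X,\mathcal{B},\mu)$ of a Polish group $G$ is a continuous homomorphism $G\to\mathrm{Aut}(X,\mathcal{B},\mu)$, $g\mapsto T_g$. Two actions $\mathbf{T}$ on $(X,\mathcal{B},\mu)$ and $\mathbf{T}'$ on $(X',\mathcal{B}',\mu')$ are isomorphic if there is a bi-measurable bijection $\varphi$ between conull subsets of $X$ and $X'$ with $\mu\circ\varphi^{-1}=\mu'$ and, for each $g\in G$, $T'_g\circ\varphi=\varphi\circ T_g$ on a $\mu$-conull set. For $0\le\alpha\le\infty$, $\mathrm{Poiss}(\alpha)$ is the Poisson distribution with mean $\alpha$; for $\alpha\in\{0,\infty\}$ it is the distribution of the constant $\alpha$. A Poisson point process with base space $(X,\mathcal{B},\mu)$ is a collection $\mathcal{P}=\{P_A:A\in\mathcal{B}\}$ of random variables on a standard probability space $(\Omega,\mathcal{F},\mathbb{P})$ such that $P_A$ has distribution $\mathrm{Poiss}(\mu(A))$ for every $A\in\mathcal{B}$,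 and $P_{A\cup B}=P_A+P_B$ $\mathbb{P}$-a.s. whenever $A,B\in\mathcal{B}$ are disjoint. It is generative if its members generate $\mathcal{F}$ modulo $\mathbb{P}$. Put $H(\mathcal{P})=\overline{\mathrm{span}}\{P_A:A\in\mathcal{B}_\mu\}\subset L^2_{\mathbb{R}}(\Omega,\mathcal{F},\mathbb{P})$. For $\mathcal{P}$ generative, a probability preserving action $\mathbf{S}:G\curvearrowright(\Omega,\mathcal{F},\mathbb{P})$ is a Poissonian action with respect to $\mathcal{P}$ if its Koopman representation $U_g f=f\circ S_g^{-1}$ preserves $H(\mathcal{P})$. An action $\mathbf{T}:G\curvearrowright(X,\mathcal{B},\mu)$ is a base action for $\mathbf{S}$ if $P_A\circ S_g=P_{T_g^{-1}(A)}$ $\mathbb{P}$-a.e. for every $g\in G$ and $A\in\mathcal{B}$. *)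

theory Defs
  imports "HOL-Probability.Probability"
begin

section \<open>Standard measure spaces\<close>

definition standard_borel :: "'a measure \<Rightarrow> bool" where
  "standard_borel M \<longleftrightarrow>
     (\<exists>\<tau>. completely_metrizable_space \<tau> \<and> second_countable \<tau> \<and> topspace \<tau> = space M \<and>
          sets M = sigma_sets (space M) {U. openin \<tau> U})"

definition nonatomic :: "'a measure \<Rightarrow> bool" where
  "nonatomic M \<longleftrightarrow>
     (\<forall>A\<in>sets M. 0 < emeasure M A \<longrightarrow>
        (\<exists>B\<in>sets M. B \<subseteq> A \<and> 0 < emeasure M B \<and> emeasure M B < emeasure M A))"

definition standard_probability_space :: "'a measure \<Rightarrow> bool" where
  "standard_probability_space M \<longleftrightarrow> standard_borel M \<and> nonatomic M \<and> prob_space M"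

definition standard_measure_space :: "'a measure \<Rightarrow> bool" where
  "standard_measure_space M \<longleftrightarrow>
     standard_borel M \<and> nonatomic M \<and>
     (prob_space M \<or> sigma_finite_measure M \<and> emeasure M (space M) = \<infinity>)"


section \<open>Automorphisms and actions\<close>

text \<open>
  Measure preserving bi-measurable bijections between conull sets are represented by functions
  that are measurable on the whole space; off the conull domain their values are irrelevant.
  Every bijection between conull sets extends to such a function (by a constant), and
  all notions below are invariant under almost everywhere equality, so that passing to
  classes modulo conull sets is left implicit.
\<close>

definition mp_iso :: "'a measure \<Rightarrow> 'b measure \<Rightarrow> ('a \<Rightarrow> 'b) set" where
  "mp_iso M N =
     {f \<in> measurable M N.
        (\<exists>X\<in>sets M. \<exists>Y\<in>sets N.
           space M - X \<in> null_sets M \<and> space N - Y \<in> null_sets N \<and> bij_betw f X Y \<and>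
           the_inv_into X f \<in> measurable (restrict_space N Y) (restrict_space M X)) \<and>
        distr M N f = N}"

definition Aut :: "'a measure \<Rightarrow> ('a \<Rightarrow> 'a) set" where
  "Aut M = mp_iso M M"

text \<open>
  The weak topology, on representatives. Writing \<open>V A \<epsilon> = {R. \<mu> (R A \<triangle> A) < \<epsilon>}\<close> for the
  subbasic neighbourhoods of the identity, the generating sets below are the left translates
  \<open>S\<^sub>0 V (S\<^sub>0\<inverse> A) \<epsilon>\<close>: if \<open>S = S\<^sub>0 R\<close> and \<open>B = S\<^sub>0\<inverse> A\<close>, then
  \<open>\<mu> (S\<inverse> A \<triangle> S\<^sub>0\<inverse> A) = \<mu> (R\<inverse> B \<triangle> B) = \<mu> (R B \<triangle> B)\<close>.
  Preimages are used because they are measurable for every representative.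
\<close>

definition weak_topology :: "'a measure \<Rightarrow> ('a \<Rightarrow> 'a) topology" where
  "weak_topology M = topology_generated_by
     {{S \<in> Aut M. emeasure M (sym_diff (S -` A \<inter> space M) (S\<^sub>0 -` A \<inter> space M)) < ennreal \<epsilon>}
        | S\<^sub>0 A \<epsilon>. S\<^sub>0 \<in> Aut M \<and> A \<in> sets M \<and> emeasure M A < \<infinity> \<and> 0 < \<epsilon>}"

text \<open>
  Groups are written additively, as in the class \<^class>\<open>topological_group_add\<close>; they are not
  assumed to be commutative. A Polish group is a type of sort
  \<open>{topological_group_add, polish_space}\<close>; the metric of \<^class>\<open>polish_space\<close> is not required
  to be invariant.
\<close>

definition mp_action :: "'a measure \<Rightarrow> ('g::{topological_group_add, polish_space} \<Rightarrow> 'a \<Rightarrow> 'a) \<Rightarrow> bool"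
  where
  "mp_action M T \<longleftrightarrow>
     (\<forall>g. T g \<in> Aut M) \<and>
     (\<forall>g h. AE x in M. T (g + h) x = T g (T h x)) \<and>
     continuous_map euclidean (weak_topology M) T"

definition isomorphic_actions ::
  "'a measure \<Rightarrow> ('g \<Rightarrow> 'a \<Rightarrow> 'a) \<Rightarrow> 'b measure \<Rightarrow> ('g \<Rightarrow> 'b \<Rightarrow> 'b) \<Rightarrow> bool" where
  "isomorphic_actions M T M' T' \<longleftrightarrow>
     (\<exists>\<phi>\<in>mp_iso M M'. \<forall>g. AE x in M. T' g (\<phi> x) = \<phi> (T g x))"


section \<open>Poisson point processes\<close>

text \<open>The constant \<^const>\<open>poisson_pmf\<close> is only specified for a positive rate.\<close>

definition Poiss :: "ennreal \<Rightarrow> ennreal measure" where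
  "Poiss \<alpha> =
     (if \<alpha> = 0 \<or> \<alpha> = \<infinity> then return borel \<alpha>
      else distr (measure_pmf (poisson_pmf (enn2real \<alpha>))) borel of_nat)"

definition poisson_point_process ::
  "'a measure \<Rightarrow> 'w measure \<Rightarrow> ('a set \<Rightarrow> 'w \<Rightarrow> ennreal) \<Rightarrow> bool" where
  "poisson_point_process M \<Omega> P \<longleftrightarrow>
     standard_measure_space M \<and> standard_probability_space \<Omega> \<and>
     (\<forall>A\<in>sets M. P A \<in> borel_measurable \<Omega> \<and> distr \<Omega> borel (P A) = Poiss (emeasure M A)) \<and>
     (\<forall>A\<in>sets M. \<forall>B\<in>sets M. A \<inter> B = {} \<longrightarrow>
        (AE \<omega> in \<Omega>. P (A \<union> B) \<omega> = P A \<omega> + P B \<omega>))"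

definition generative ::
  "'a measure \<Rightarrow> 'w measure \<Rightarrow> ('a set \<Rightarrow> 'w \<Rightarrow> ennreal) \<Rightarrow> bool" where
  "generative M \<Omega> P \<longleftrightarrow>
     (\<forall>F\<in>sets \<Omega>.
        \<exists>F'\<in>sigma_sets (space \<Omega>) {P A -` E \<inter> space \<Omega> | A E. A \<in> sets M \<and> E \<in> sets borel}.
          sym_diff F F' \<in> null_sets \<Omega>)"

definition generative_ppp ::
  "'a measure \<Rightarrow> 'w measure \<Rightarrow> ('a set \<Rightarrow> 'w \<Rightarrow> ennreal) \<Rightarrow> bool" where
  "generative_ppp M \<Omega> P \<longleftrightarrow> poisson_point_process M \<Omega> P \<and> generative M \<Omega> P"


section \<open>Poissonian actions\<close>

text \<open>
  Elements of the real space \<open>L\<^sup>2\<close> are represented by square integrable functions; the closed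
  span below contains with a function all measurable functions almost everywhere equal to it.
\<close>

definition L2_functions :: "'w measure \<Rightarrow> ('w \<Rightarrow> real) set" where
  "L2_functions \<Omega> = {f \<in> borel_measurable \<Omega>. integrable \<Omega> (\<lambda>\<omega>. (f \<omega>)\<^sup>2)}"

definition L2_norm :: "'w measure \<Rightarrow> ('w \<Rightarrow> real) \<Rightarrow> real" where
  "L2_norm \<Omega> f = sqrt (\<integral>\<omega>. (f \<omega>)\<^sup>2 \<partial>\<Omega>)"

text \<open>Closed linear span of a set \<open>F\<close> of square integrable functions.\<close>

definition L2_closed_span :: "'w measure \<Rightarrow> ('w \<Rightarrow> real) set \<Rightarrow> ('w \<Rightarrow> real) set" where
  "L2_closed_span \<Omega> F =
     {f \<in> L2_functions \<Omega>. \<forall>\<epsilon>>0. \<exists>I c. finite I \<and> I \<subseteq> F \<and>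
        L2_norm \<Omega> (\<lambda>\<omega>. f \<omega> - (\<Sum>h\<in>I. c h * h \<omega>)) < \<epsilon>}"

text \<open>If \<open>A\<close> has finite measure, then \<open>P A\<close> is almost surely finite, so \<^const>\<open>enn2real\<close> only
  changes it on a null set.\<close>

definition poisson_H ::
  "'a measure \<Rightarrow> 'w measure \<Rightarrow> ('a set \<Rightarrow> 'w \<Rightarrow> ennreal) \<Rightarrow> ('w \<Rightarrow> real) set" where
  "poisson_H M \<Omega> P =
     L2_closed_span \<Omega> {(\<lambda>\<omega>. enn2real (P A \<omega>)) | A. A \<in> sets M \<and> emeasure M A < \<infinity>}"

text \<open>For an action \<open>S\<close>, the automorphism \<open>S (- g)\<close> is the inverse of \<open>S g\<close> modulo null sets.\<close>

definition koopman :: "('g::group_add \<Rightarrow> 'w \<Rightarrow> 'w) \<Rightarrow> 'g \<Rightarrow> ('w \<Rightarrow> real) \<Rightarrow> 'w \<Rightarrow> real" where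
  "koopman S g f = f \<circ> S (- g)"

definition poissonian_action ::
  "'a measure \<Rightarrow> 'w measure \<Rightarrow> ('a set \<Rightarrow> 'w \<Rightarrow> ennreal) \<Rightarrow>
   ('g::{topological_group_add, polish_space} \<Rightarrow> 'w \<Rightarrow> 'w) \<Rightarrow> bool" where
  "poissonian_action M \<Omega> P S \<longleftrightarrow>
     mp_action \<Omega> S \<and> (\<forall>g. \<forall>f\<in>poisson_H M \<Omega> P. koopman S g f \<in> poisson_H M \<Omega> P)"

definition base_action ::
  "'a measure \<Rightarrow> 'w measure \<Rightarrow> ('a set \<Rightarrow> 'w \<Rightarrow> ennreal) \<Rightarrow>
   ('g::{topological_group_add, polish_space} \<Rightarrow> 'w \<Rightarrow> 'w) \<Rightarrow> ('g \<Rightarrow> 'a \<Rightarrow> 'a) \<Rightarrow> bool" where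
  "base_action M \<Omega> P S T \<longleftrightarrow>
     mp_action M T \<and>
     (\<forall>g. \<forall>A\<in>sets M. AE \<omega> in \<Omega>. P A (S g \<omega>) = P (T g -` A \<inter> space M) \<omega>)"

end

theory Submission
  imports Defs
begin

text \<open>The whole process is a function, modulo null sets, of its void events \<open>P A = 0\<close>: cut a set of
  finite measure into pieces of measure at most \<open>2\<^sup>-\<^sup>n\<close> and count the occupied ones; by
  Borel--Cantelli the count is eventually equal to \<open>P A\<close>. Finite intersections of void events are
  void events again and have probability \<open>exp (- \<mu> (A\<^sub>1 \<union> ... \<union> A\<^sub>n))\<close>, so their joint law only depends on
  the base measure. Hence a measure preserving map between bases induces a homomorphism of the
  measure algebras of two generative processes, which is realized by a point map since the
  spaces are standard Borel. This gives the Poissonian action over a base action and the invariance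
  under isomorphism. Continuity transfers in both directions because the measure of the symmetric difference of
  two void events is a function of that of the underlying sets when these have equal measure.

  Conversely, let \<open>S\<close> preserve the first chaos. Then \<open>P A \<circ> S\<close> is a limit of linear statistics
  \<open>\<Sum>i. c\<^sub>i * P A\<^sub>i\<close> and has a Poisson law. By independence, the modulus of the characteristic function
  of a linear statistic at \<open>t\<close> is \<open>exp (- \<integral>(1 - cos (t * F)) \<partial>\<mu>)\<close> with \<open>F = \<Sum>i. c\<^sub>i * indicator A\<^sub>i\<close>, and its variance
  is \<open>\<integral>F\<^sup>2 \<partial>\<mu>\<close>. At \<open>t = 2\<pi>\<close> this shows that \<open>F\<close> is nearly integer-valued, and comparing \<open>t = \<pi>\<close> with the
  variance shows that \<open>F\<close> nearly has values in \<open>{-1, 0, 1}\<close>. In the limit \<open>P A \<circ> S = P B - P C + c\<close>, where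
  \<open>C\<close> is null because the left-hand side is nonnegative, and \<open>c = 0\<close>. Since
  \<open>\<mu> (A \<inter> A')\<close> is the covariance of \<open>P A\<close> and \<open>P A'\<close>, the assignment of \<open>B\<close> to \<open>A\<close> is a homomorphism of the measure
  algebra of the base, which is realized by a point map.\<close>

section \<open>Standard Borel spaces\<close>

text \<open>Additivity of the process holds only almost surely, with an exceptional set that depends
  on the two sets, and independence over disjoint sets is not part of the definition. So there is no
  random counting measure to argue with: countably many sets have to be handled at a time, and
  independence has to be derived. It comes from the void probabilities, as in Renyi's
  characterization: \<open>P A = 0\<close> and \<open>P B = 0\<close> together mean
  \<open>P (A \<union> B) = 0\<close>, and \<open>exp (- \<mu> (A \<union> B))\<close> factorizes
  for disjoint sets. In the converse direction, the variance and the logarithm of the modulus of the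
  characteristic function of a linear statistic are both integrals over the base of a function of
  the single value \<open>F x\<close>. The study of the law thereby reduces to one pointwise
  inequality in a real variable, \<open>clamp1_bound\<close>. The price is that a variance does not
  see additive constants, which is why a constant \<open>c\<close> survives the limit and is removed
  only at the end.\<close>

lemma standard_borel_metric:
  assumes "standard_borel M" "space M \<noteq> {}"
  obtains d and x :: "nat \<Rightarrow> 'a" where "Metric_space (space M) d" "Metric_space.mcomplete (space M) d"
    "sets M = sigma_sets (space M) {U. openin (Metric_space.mtopology (space M) d) U}"
    "\<And>n. x n \<in> space M" "\<And>y r. y \<in> space M \<Longrightarrow> 0 < r \<Longrightarrow> \<exists>n. d (x n) y < r"
proof -
  obtain \<tau> where \<tau>: "completely_metrizable_space \<tau>" "second_countable \<tau>" "topspace \<tau> = space M"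
    "sets M = sigma_sets (space M) {U. openin \<tau> U}"
    using assms unfolding standard_borel_def by auto
  obtain X d where d: "Metric_space X d" "Metric_space.mcomplete X d" "\<tau> = Metric_space.mtopology X d"
    using \<tau>(1) unfolding completely_metrizable_space_def by auto
  interpret Metric_space X d by fact
  have X: "X = space M" using \<tau>(3) d(3) by simp
  obtain C where C: "countable C" "C \<subseteq> X" "mtopology closure_of C = X"
    using second_countable_imp_separable_space[OF \<tau>(2)] d(3) unfolding separable_space_def by auto
  have "C \<noteq> {}" using C(3) assms(2) X by auto
  define x where "x = from_nat_into C"
  have x: "range x = C" unfolding x_def using C(1) \<open>C \<noteq> {}\<close> by (rule range_from_nat_into[rotated])
  show ?thesis
  proof
    show "x n \<in> space M" for n using x C(2) X by auto
    show "\<exists>n. d (x n) y < r" if yr: "y \<in> space M" "0 < r" for y r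
    proof -
      have "y \<in> mtopology closure_of C" using yr C(3) X by simp
      then obtain c where "c \<in> C" "c \<in> mball y r"
        using yr(2) unfolding metric_closure_of by auto
      moreover then obtain n where "x n = c" using x by auto
      ultimately show ?thesis by (intro exI[of _ n]) (auto simp: commute)
    qed
  qed (use d \<tau> X in auto)
qed

lemma standard_borel_separating:
  assumes "standard_borel M"
  obtains U :: "nat \<Rightarrow> 'a set" where "\<And>n. U n \<in> sets M"
    "\<And>x y. x \<in> space M \<Longrightarrow> y \<in> space M \<Longrightarrow> (\<And>n. x \<in> U n \<longleftrightarrow> y \<in> U n) \<Longrightarrow> x = y"
proof (cases "space M = {}")
  case True
  then show ?thesis by (intro that[of "\<lambda>_. {}"]) auto
next
  case False
  then obtain d and x :: "nat \<Rightarrow> 'a" where d: "Metric_space (space M) d"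
    "sets M = sigma_sets (space M) {U. openin (Metric_space.mtopology (space M) d) U}"
    "\<And>n. x n \<in> space M" "\<And>y r. y \<in> space M \<Longrightarrow> 0 < r \<Longrightarrow> \<exists>n. d (x n) y < r"
    using standard_borel_metric[OF assms False] by metis
  interpret Metric_space "space M" d by fact
  define U where "U = (\<lambda>k. case prod_decode k of (i, n) \<Rightarrow> mball (x i) (1 / Suc n))"
  show ?thesis
  proof (rule that[of U])
    show "U n \<in> sets M" for n
      unfolding d(2) U_def by (auto intro!: sigma_sets.Basic split: prod.split)
    fix y z assume y: "y \<in> space M" and z: "z \<in> space M" and eq: "\<And>n. y \<in> U n \<longleftrightarrow> z \<in> U n"
    show "y = z"
    proof (rule ccontr)
      assume "y \<noteq> z"
      then have "0 < d y z / 2" using y z by simp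
      then obtain n where n: "1 / real (Suc n) < d y z / 2" using nat_approx_posE by metis
      obtain i where i: "d (x i) y < 1 / real (Suc n)" using d(4)[OF y, of "1 / real (Suc n)"] by auto
      have "y \<in> U (prod_encode (i, n))" using i y d(3) by (simp add: U_def)
      then have "z \<in> U (prod_encode (i, n))" using eq by blast
      then have "d (x i) z < 1 / real (Suc n)" by (simp add: U_def)
      then have "d y z < d y z" using triangle[OF y d(3)[of i] z] i n commute[of y "x i"] by linarith
      then show False by simp
    qed
  qed
qed

text \<open>The null set in the hypothesis may depend on \<open>A\<close>; a countable separating
  family merges the relevant ones into a single null set.\<close>

lemma AE_eq_if_AE_mem_iff:
  assumes M: "standard_borel M" and "f \<in> measurable N M" "g \<in> measurable N M"
    and *: "\<And>A. A \<in> sets M \<Longrightarrow> AE x in N. f x \<in> A \<longleftrightarrow> g x \<in> A"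
  shows "AE x in N. f x = g x"
proof -
  obtain U :: "nat \<Rightarrow> 'a set" where U: "\<And>n. U n \<in> sets M"
    "\<And>x y. x \<in> space M \<Longrightarrow> y \<in> space M \<Longrightarrow> (\<And>n. x \<in> U n \<longleftrightarrow> y \<in> U n) \<Longrightarrow> x = y"
    using standard_borel_separating[OF M] by metis
  have "AE x in N. \<forall>n. f x \<in> U n \<longleftrightarrow> g x \<in> U n"
    unfolding AE_all_countable using * U(1) by blast
  then show ?thesis using AE_space
  proof eventually_elim
    case (elim x)
    then show ?case using U(2)[of "f x" "g x"] measurable_space[OF assms(2)] measurable_space[OF assms(3)] by blast
  qed
qed

text \<open>A point map is recovered from its action on balls of radius \<open>2\<^sup>-\<^sup>n\<close> around a dense sequence:
  almost every point lies in the images of balls that pairwise meet, so their centres form a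
  Cauchy sequence.\<close>

lemma point_realization:
  fixes M :: "'a measure" and N :: "'b measure"
  assumes M: "standard_borel M" "space M \<noteq> {}"
    and \<Phi>[measurable]: "\<And>A. A \<in> sets M \<Longrightarrow> \<Phi> A \<in> sets N"
    and compl: "\<And>A. A \<in> sets M \<Longrightarrow> AE w in N. w \<in> \<Phi> (space M - A) \<longleftrightarrow> w \<notin> \<Phi> A"
    and union: "\<And>A :: nat \<Rightarrow> 'a set. range A \<subseteq> sets M \<Longrightarrow> AE w in N. w \<in> \<Phi> (\<Union>n. A n) \<longleftrightarrow> (\<exists>n. w \<in> \<Phi> (A n))"
  obtains f where "f \<in> measurable N M" "\<And>A. A \<in> sets M \<Longrightarrow> AE w in N. f w \<in> A \<longleftrightarrow> w \<in> \<Phi> A"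
proof -
  obtain d and x :: "nat \<Rightarrow> 'a" where d: "Metric_space (space M) d" "Metric_space.mcomplete (space M) d"
    and sM: "sets M = sigma_sets (space M) {U. openin (Metric_space.mtopology (space M) d) U}"
    and xM: "\<And>n. x n \<in> space M" and xd: "\<And>y r. y \<in> space M \<Longrightarrow> 0 < r \<Longrightarrow> \<exists>n. d (x n) y < r"
    using standard_borel_metric[OF M] by metis
  interpret Metric_space "space M" d by fact
  have op: "U \<in> sets M" if "openin mtopology U" for U unfolding sM using that by auto
  have cl: "C \<in> sets M" if "closedin mtopology C" for C
    using op[of "space M - C"] that sets.compl_sets[of "space M - C" M] closedin_subset[OF that]
    by (auto simp: closedin_def double_diff)
  have mono: "AE w in N. w \<in> \<Phi> A \<longrightarrow> w \<in> \<Phi> B" if "A \<in> sets M" "B \<in> sets M" "A \<subseteq> B" for A B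
  proof -
    have "(\<Union>n::nat. (if n = 0 then A else B)) = B"
      using that(3) by (auto split: if_splits intro: exI[of _ "1::nat"])
    moreover have "AE w in N. w \<in> \<Phi> (\<Union>n::nat. (if n = 0 then A else B)) \<longleftrightarrow> (\<exists>n::nat. w \<in> \<Phi> (if n = 0 then A else B))"
      using that by (intro union) auto
    ultimately show ?thesis by (auto elim!: eventually_mono split: if_splits)
  qed
  have disj: "AE w in N. \<not> (w \<in> \<Phi> A \<and> w \<in> \<Phi> B)" if "A \<in> sets M" "B \<in> sets M" "A \<inter> B = {}" for A B
  proof -
    have "B \<subseteq> space M - A" using that sets.sets_into_space by blast
    from mono[OF that(2) _ this] compl[OF that(1)] that(1) show ?thesis by auto
  qed
  have empty: "AE w in N. w \<notin> \<Phi> {}" using disj[of "{}" "{}"] by simp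
  have full: "AE w in N. w \<in> \<Phi> (space M)" using compl[of "{}"] empty by (auto elim: eventually_elim2)
  define b where "b n k = mball (x k) ((1/2)^n)" for n k :: nat
  have b[measurable]: "b n k \<in> sets M" for n k unfolding b_def by (intro op openin_mball)
  define G where "G = {w \<in> space N. (\<forall>n. \<exists>k. w \<in> \<Phi> (b n k)) \<and>
     (\<forall>n k m j. b n k \<inter> b m j = {} \<longrightarrow> \<not> (w \<in> \<Phi> (b n k) \<and> w \<in> \<Phi> (b m j)))}"
  have G[measurable]: "G \<in> sets N" unfolding G_def by measurable
  have "AE w in N. \<exists>k. w \<in> \<Phi> (b n k)" for n
  proof -
    have "(\<Union>k. b n k) = space M"
      using xd[of _ "(1/2)^n"] xM by (fastforce simp: b_def)
    moreover have "range (b n) \<subseteq> sets M" using b by auto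
    ultimately show ?thesis using union[of "b n"] full by (auto elim: eventually_elim2)
  qed
  moreover have "AE w in N. b n k \<inter> b m j = {} \<longrightarrow> \<not> (w \<in> \<Phi> (b n k) \<and> w \<in> \<Phi> (b m j))" for n k m j
    using disj[of "b n k" "b m j"] by (cases "b n k \<inter> b m j = {}") auto
  ultimately have AEG: "AE w in N. w \<in> G"
    unfolding G_def mem_Collect_eq using AE_space by (simp add: AE_all_countable AE_conj_iff)
  define k where "k n w = (LEAST k. w \<in> \<Phi> (b n k))" for n w
  have kG: "w \<in> \<Phi> (b n (k n w))" if "w \<in> G" for n w
    unfolding k_def by (rule LeastI_ex) (use that in \<open>auto simp: G_def\<close>)
  have kmeas[measurable]: "k n \<in> measurable N (count_space UNIV)" for n unfolding k_def by measurable
  have close: "d (x (k n w)) (x (k m w)) < (1/2)^n + (1/2)^m" if "w \<in> G" for n m w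
  proof -
    have "b n (k n w) \<inter> b m (k m w) \<noteq> {}" using that kG[OF that] unfolding G_def by blast
    then obtain z where "z \<in> space M" "d (x (k n w)) z < (1/2)^n" "d (x (k m w)) z < (1/2)^m"
      unfolding b_def by auto
    then show ?thesis using triangle[of "x (k n w)" z "x (k m w)"] xM commute[of z "x (k m w)"] by simp
  qed
  have half: "(\<lambda>n. (1/2)^n :: real) \<longlonglongrightarrow> 0" by (simp add: LIMSEQ_power_zero)
  have "\<exists>l. limitin mtopology (\<lambda>n. x (k n w)) l sequentially" if w: "w \<in> G" for w
  proof -
    have "MCauchy (\<lambda>n. x (k n w))" unfolding MCauchy_def
    proof (intro conjI allI impI)
      show "range (\<lambda>n. x (k n w)) \<subseteq> space M" using xM by auto
      fix e :: real assume "e > 0"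
      then have "eventually (\<lambda>n. (1/2)^n < e/2) sequentially"
        using half by (intro order_tendstoD) auto
      then obtain N where N: "\<And>n. n \<ge> N \<Longrightarrow> (1/2::real)^n < e/2" by (auto simp: eventually_sequentially)
      show "\<exists>N. \<forall>n n'. N \<le> n \<longrightarrow> N \<le> n' \<longrightarrow> d (x (k n w)) (x (k n' w)) < e"
      proof (intro exI allI impI)
        fix n n' assume "N \<le> n" "N \<le> n'"
        then show "d (x (k n w)) (x (k n' w)) < e" using close[OF w, of n n'] N[of n] N[of n'] by linarith
      qed
    qed
    then show ?thesis using d(2) unfolding mcomplete_def by auto
  qed
  then obtain l where l: "\<And>w. w \<in> G \<Longrightarrow> limitin mtopology (\<lambda>n. x (k n w)) (l w) sequentially" by metis
  define f where "f w = (if w \<in> G then l w else x 0)" for w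
  have fM: "f w \<in> space M" for w
    using l[of w] xM unfolding f_def by (auto simp: limitin_metric)
  have fd: "d (x (k n w)) (f w) \<le> (1/2)^n" if w: "w \<in> G" for n w
  proof -
    have dl: "(\<lambda>m. d (x (k m w)) (f w)) \<longlonglongrightarrow> 0" using l[OF w] w by (simp add: f_def limitin_metric_dist_null)
    have "(\<lambda>m. (1/2)^n + (1/2)^m + d (x (k m w)) (f w)) \<longlonglongrightarrow> (1/2)^n + 0 + 0" by (intro tendsto_intros half dl)
    moreover have "d (x (k n w)) (f w) \<le> (1/2)^n + (1/2)^m + d (x (k m w)) (f w)" for m
      using triangle[of "x (k n w)" "x (k m w)" "f w"] xM fM close[OF w, of n m] by simp
    ultimately show ?thesis by (intro tendsto_lowerbound[of _ "(1/2)^n"]) auto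
  qed
  \<comment> \<open>Membership of the limit in a closed set is read off from the centres
    \<open>x (k n w)\<close> alone, hence is a countable condition on the measurable indices
    \<open>k n w\<close>. This yields the measurability of \<open>f\<close> in
    \<open>fclosed\<close> and the link with \<open>\<Phi>\<close> in
    \<open>closed_imp\<close>.\<close>
  have approx: "f w \<in> C \<longleftrightarrow> (\<forall>n. C \<inter> mcball (x (k n w)) (2 * (1/2)^n) \<noteq> {})"
    if C: "closedin mtopology C" and w: "w \<in> G" for C w
  proof
    assume fC: "f w \<in> C"
    have "d (x (k n w)) (f w) \<le> 2 * (1/2)^n" for n
      using fd[OF w, of n] zero_le_power[of "1/2::real" n] by linarith
    then have "f w \<in> C \<inter> mcball (x (k n w)) (2 * (1/2)^n)" for n
      using fC fM xM by simp
    then show "\<forall>n. C \<inter> mcball (x (k n w)) (2 * (1/2)^n) \<noteq> {}" by blast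
  next
    assume "\<forall>n. C \<inter> mcball (x (k n w)) (2 * (1/2)^n) \<noteq> {}"
    then have "\<forall>n. \<exists>c. c \<in> C \<and> d (x (k n w)) c \<le> 2 * (1/2)^n"
      by (meson disjoint_iff in_mcball)
    then obtain c where c: "\<And>n. c n \<in> C" "\<And>n. d (x (k n w)) (c n) \<le> 2 * (1/2)^n" by metis
    have cM: "c n \<in> space M" for n using c(1) closedin_subset[OF C] by auto
    have "d (c n) (f w) \<le> 3 * (1/2)^n" for n
      using triangle[of "c n" "x (k n w)" "f w"] cM xM fM c(2)[of n] fd[OF w, of n] commute[of "c n" "x (k n w)"] by simp
    moreover have "(\<lambda>n. 3 * (1/2)^n :: real) \<longlonglongrightarrow> 0" using tendsto_mult_left[OF half, of 3] by simp
    ultimately have "(\<lambda>n. d (c n) (f w)) \<longlonglongrightarrow> 0"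
      by (intro tendsto_sandwich[of "\<lambda>_. 0" "\<lambda>n. d (c n) (f w)" sequentially "\<lambda>n. 3 * (1/2)^n"]) auto
    then have "limitin mtopology c (f w) sequentially" using fM cM by (simp add: limitin_metric_dist_null)
    then show "f w \<in> C" using C c(1) unfolding metric_closedin_iff_sequentially_closed by blast
  qed
  have fclosed: "f -` C \<inter> space N \<in> sets N" if C: "closedin mtopology C" for C
  proof -
    have "f -` C \<inter> space N = {w \<in> space N. if w \<in> G then \<forall>n. C \<inter> mcball (x (k n w)) (2 * (1/2)^n) \<noteq> {} else x 0 \<in> C}"
      using approx[OF C] by (auto simp: f_def split: if_splits)
    also have "\<dots> \<in> sets N" by measurable
    finally show ?thesis .
  qed
  have f: "f \<in> measurable N M"
  proof (rule measurable_sigma_sets[OF sM])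
    show "{U. openin mtopology U} \<subseteq> Pow (space M)" using openin_subset by fastforce
    show "f \<in> space N \<rightarrow> space M" using fM by auto
    fix U assume "U \<in> {U. openin mtopology U}"
    then have "closedin mtopology (space M - U)" "U \<subseteq> space M" using openin_subset by (fastforce simp: closedin_def double_diff)+
    then have "space N - (f -` (space M - U) \<inter> space N) \<in> sets N" using fclosed by auto
    moreover have "space N - (f -` (space M - U) \<inter> space N) = f -` U \<inter> space N" using fM by auto
    ultimately show "f -` U \<inter> space N \<in> sets N" by simp
  qed
  have closed_imp: "AE w in N. w \<in> \<Phi> C \<longrightarrow> f w \<in> C" if C: "closedin mtopology C" for C
  proof -
    have "AE w in N. \<forall>n j. C \<inter> b n j = {} \<longrightarrow> \<not> (w \<in> \<Phi> C \<and> w \<in> \<Phi> (b n j))"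
      unfolding AE_all_countable
    proof (intro allI)
      fix n j show "AE w in N. C \<inter> b n j = {} \<longrightarrow> \<not> (w \<in> \<Phi> C \<and> w \<in> \<Phi> (b n j))"
        using disj[OF cl[OF C] b[of n j]] by (cases "C \<inter> b n j = {}") auto
    qed
    then show ?thesis using AEG
    proof eventually_elim
      case (elim w)
      show ?case
      proof
        assume "w \<in> \<Phi> C"
        then have "C \<inter> b n (k n w) \<noteq> {}" for n using elim kG[of w n] by blast
        moreover have "b n (k n w) \<subseteq> mcball (x (k n w)) (2 * (1/2)^n)" for n
        proof -
          have "(1/2::real)^n \<le> 2 * (1/2)^n" by simp
          then show ?thesis unfolding b_def
            using mball_subset_mcball[of "x (k n w)"] mcball_subset_concentric by blast
        qed
        ultimately have "C \<inter> mcball (x (k n w)) (2 * (1/2)^n) \<noteq> {}" for n by blast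
        then show "f w \<in> C" using approx[OF C] elim by blast
      qed
    qed
  qed
  \<comment> \<open>An open set is a countable union of closed ones, so countable additivity of
    \<open>\<Phi>\<close> carries the inclusion over from closed sets. Applied to an open set and to
    its closed complement, the two inclusions give the equivalence on generators.\<close>
  have open_imp: "AE w in N. w \<in> \<Phi> U \<longrightarrow> f w \<in> U" if U: "openin mtopology U" for U
  proof -
    obtain C :: "nat \<Rightarrow> 'a set" where C: "\<And>n. closedin mtopology (C n)" "(\<Union>n. C n) = U"
      using open_imp_fsigma_in[OF metrizable_space_mtopology U] unfolding fsigma_in_ascending by auto
    have "AE w in N. \<forall>n. w \<in> \<Phi> (C n) \<longrightarrow> f w \<in> C n"
      unfolding AE_all_countable using closed_imp C(1) by blast
    moreover have "AE w in N. w \<in> \<Phi> (\<Union>n. C n) \<longleftrightarrow> (\<exists>n. w \<in> \<Phi> (C n))"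
      using C(1) cl by (intro union) auto
    ultimately show ?thesis unfolding C(2)[symmetric] by eventually_elim blast
  qed
  show ?thesis
  proof
    show "f \<in> measurable N M" by (rule f)
    fix A assume "A \<in> sets M"
    then have "A \<in> sigma_sets (space M) {U. openin mtopology U}" unfolding sM .
    then show "AE w in N. f w \<in> A \<longleftrightarrow> w \<in> \<Phi> A"
    proof induction
      case (Basic U)
      then have U: "openin mtopology U" by simp
      then have "closedin mtopology (space M - U)"
        using openin_subset[OF U] by (auto simp: closedin_def double_diff)
      from open_imp[OF U] closed_imp[OF this] compl[OF op[OF U]] show ?case by eventually_elim auto
    next
      case Empty
      then show ?case using empty by simp
    next
      case (Compl A)
      then have "A \<in> sets M" unfolding sM by simp
      from compl[OF this] Compl.IH show ?case by eventually_elim (use fM in auto)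
    next
      case (Union A)
      then have "range A \<subseteq> sets M" unfolding sM by auto
      moreover have "AE w in N. \<forall>n. f w \<in> A n \<longleftrightarrow> w \<in> \<Phi> (A n)" unfolding AE_all_countable using Union by blast
      ultimately show ?case using union[of A] by (auto elim: eventually_elim2)
    qed
  qed
qed

section \<open>Isomorphisms of measure spaces\<close>

text \<open>The conull sets are the points fixed by \<open>g \<circ> f\<close> and by
  \<open>f \<circ> g\<close>, between which \<open>f\<close> is exactly a bijection. Their
  measurability is where the standard Borel structure enters: by a countable separating family,
  \<open>h x = x\<close> is a countable conjunction of measurable conditions.\<close>

lemma mp_isoI:
  assumes M: "standard_borel M" and N: "standard_borel N"
    and f[measurable]: "f \<in> measurable M N" and g[measurable]: "g \<in> measurable N M"
    and fM: "distr M N f = N"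
    and gf: "AE x in M. g (f x) = x" and fg: "AE y in N. f (g y) = y"
  shows "f \<in> mp_iso M N"
proof -
  have fix_meas: "{x \<in> space L. h x = x} \<in> sets L"
    if L: "standard_borel L" and [measurable]: "h \<in> measurable L L" for L :: "'c measure" and h
  proof -
    obtain U :: "nat \<Rightarrow> 'c set" where U[measurable]: "\<And>n. U n \<in> sets L" and
      sep: "\<And>x y. x \<in> space L \<Longrightarrow> y \<in> space L \<Longrightarrow> (\<And>n. x \<in> U n \<longleftrightarrow> y \<in> U n) \<Longrightarrow> x = y"
      using standard_borel_separating[OF L] by metis
    have "{x \<in> space L. h x = x} = {x \<in> space L. \<forall>n. h x \<in> U n \<longleftrightarrow> x \<in> U n}"
      by (auto intro!: sep measurable_space[OF that(2)])
    also have "\<dots> \<in> sets L" by measurable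
    finally show ?thesis .
  qed
  define X where "X = {x \<in> space M. g (f x) = x}"
  define Y where "Y = {y \<in> space N. f (g y) = y}"
  have X: "X \<in> sets M" unfolding X_def by (intro fix_meas M) measurable
  have Y: "Y \<in> sets N" unfolding Y_def by (intro fix_meas N) measurable
  have fX: "f x \<in> Y" if "x \<in> X" for x using that measurable_space[OF f] by (simp add: X_def Y_def)
  have gY: "g y \<in> X" if "y \<in> Y" for y using that measurable_space[OF g] by (simp add: X_def Y_def)
  have bij: "bij_betw f X Y"
    by (rule bij_betw_byWitness[where f'=g]) (use fX gY in \<open>auto simp: X_def Y_def\<close>)
  have inv: "the_inv_into X f y = g y" if "y \<in> Y" for y
    using that gY bij unfolding Y_def by (intro the_inv_into_f_eq) (auto simp: bij_betw_def)
  have "the_inv_into X f \<in> measurable (restrict_space N Y) (restrict_space M X)"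
  proof (rule measurable_restrict_space2)
    show "the_inv_into X f \<in> space (restrict_space N Y) \<rightarrow> X"
      using inv gY by (auto simp: space_restrict_space)
    have "g \<in> measurable (restrict_space N Y) M" by (intro measurable_restrict_space1 g)
    then show "the_inv_into X f \<in> measurable (restrict_space N Y) M"
      by (rule measurable_cong[THEN iffD1, rotated]) (auto simp: space_restrict_space inv)
  qed
  moreover have "space M - X \<in> null_sets M"
    using gf X by (subst AE_iff_null_sets) (auto simp: X_def elim: eventually_mono)
  moreover have "space N - Y \<in> null_sets N"
    using fg Y by (subst AE_iff_null_sets) (auto simp: Y_def elim: eventually_mono)
  ultimately show ?thesis
    unfolding mp_iso_def mem_Collect_eq using X Y f fM bij by (intro conjI bexI[of _ X] bexI[of _ Y])
qed

lemma mp_isoD: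
  assumes "f \<in> mp_iso M N"
  shows "f \<in> measurable M N" "distr M N f = N"
  using assms unfolding mp_iso_def by auto

lemma mp_iso_inverse:
  assumes f: "f \<in> mp_iso M N" and ne: "space M \<noteq> {}"
  obtains g where "g \<in> measurable N M" "distr N M g = M" "AE x in M. g (f x) = x" "AE y in N. f (g y) = y"
proof -
  obtain X Y where X: "X \<in> sets M" and Y: "Y \<in> sets N" and nX: "space M - X \<in> null_sets M" and nY: "space N - Y \<in> null_sets N"
    and bij: "bij_betw f X Y"
    and inv: "the_inv_into X f \<in> measurable (restrict_space N Y) (restrict_space M X)"
    and fm[measurable]: "f \<in> measurable M N" and fd: "distr M N f = N"
    using f unfolding mp_iso_def by auto
  obtain x0 where x0: "x0 \<in> space M" using ne by auto
  \<comment> \<open>Off \<open>Y\<close> a fixed default point keeps the inverse measurable on the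
    whole of \<open>N\<close>.\<close>
  define g where "g y = (if y \<in> Y then the_inv_into X f y else x0)" for y
  have inv': "the_inv_into X f \<in> measurable (restrict_space N Y) M"
    using inv by (auto simp: measurable_restrict_space2_iff)
  have g[measurable]: "g \<in> measurable N M"
    unfolding g_def
  proof (subst measurable_If_restrict_space_iff)
    show "{x \<in> space N. x \<in> Y} \<in> sets N" using Y by simp
    have e: "{x. x \<in> Y} = Y" by auto
    show "the_inv_into X f \<in> restrict_space N {x. x \<in> Y} \<rightarrow>\<^sub>M M \<and>
          (\<lambda>x. x0) \<in> restrict_space N {x. x \<notin> Y} \<rightarrow>\<^sub>M M" using inv' x0 by (simp add: e)
  qed
  have AX: "AE x in M. x \<in> X" by (rule AE_I'[OF nX]) auto
  have AY: "AE y in N. y \<in> Y" by (rule AE_I'[OF nY]) auto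
  have gf: "AE x in M. g (f x) = x"
    using AX by eventually_elim (use bij in \<open>auto simp: g_def bij_betw_def the_inv_into_f_f\<close>)
  have fg: "AE y in N. f (g y) = y"
    using AY by eventually_elim (use bij in \<open>auto simp: g_def bij_betw_def f_the_inv_into_f\<close>)
  have "distr N M g = distr (distr M N f) M g" by (simp add: fd)
  also have "\<dots> = distr M M (g \<circ> f)" by (rule distr_distr) measurable
  also have "\<dots> = distr M M (\<lambda>x. x)" by (intro distr_cong_AE) (use gf in \<open>simp_all add: o_def\<close>)
  also have "\<dots> = M" by (rule distr_id2) simp
  finally show ?thesis using that g gf fg by blast
qed

lemma distr_AE_iff:
  assumes "f \<in> measurable M N" "distr M N f = N" "AE y in N. P y"
  shows "AE x in M. P (f x)"
  using AE_distrD[OF assms(1), of P] assms(3) unfolding assms(2) .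

lemma emeasure_vimage_mp:
  assumes "f \<in> measurable M N" "distr M N f = N" "A \<in> sets N"
  shows "emeasure M (f -` A \<inter> space M) = emeasure N A"
  using emeasure_distr[OF assms(1,3)] assms(2) by simp

section \<open>Poisson point processes\<close>

lemma ennreal_of_nat_eq_iff [simp]: "(of_nat m :: ennreal) = of_nat n \<longleftrightarrow> m = n"
  by (metis enn2real_of_nat of_nat_eq_iff)

lemma Poiss_0: "Poiss 0 = return borel 0" and Poiss_infinity: "Poiss \<infinity> = return borel \<infinity>"
  by (simp_all add: Poiss_def)

text \<open>Rate 0 is covered by the same formula because \<open>0 ^ 0 = 1\<close>; this avoids a
  separate treatment of null sets later on.\<close>

lemma Poiss_singleton:
  assumes "0 \<le> l"
  shows "emeasure (Poiss (ennreal l)) {of_nat k} = ennreal (l ^ k / fact k * exp (- l))"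
proof (cases "l = 0")
  case True
  then show ?thesis by (cases k) (auto simp: Poiss_def indicator_def)
next
  case False
  then have l: "0 < l" using assms by simp
  have "emeasure (Poiss (ennreal l)) {of_nat k}
      = emeasure (measure_pmf (poisson_pmf l)) ((of_nat :: nat \<Rightarrow> ennreal) -` {of_nat k})"
    using l unfolding Poiss_def by (simp, subst emeasure_distr) simp_all
  also have "(of_nat :: nat \<Rightarrow> ennreal) -` {of_nat k} = {k}" by auto
  finally show ?thesis using l by (simp add: emeasure_pmf_single)
qed

lemma AE_Poiss_nat:
  assumes "0 \<le> l"
  shows "AE x in Poiss (ennreal l). x \<in> range of_nat"
proof -
  have [measurable]: "range of_nat \<in> sets (borel :: ennreal measure)"
    by (rule sets.countable) simp_all
  show ?thesis
  proof (cases "l = 0")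
    case True
    have "0 \<in> range (of_nat :: nat \<Rightarrow> ennreal)" by (rule range_eqI[of _ _ 0]) simp
    then show ?thesis unfolding True ennreal_0 Poiss_0 by (subst AE_return) simp_all
  next
    case False
    then have "Poiss (ennreal l) = distr (measure_pmf (poisson_pmf l)) borel of_nat"
      using assms by (simp add: Poiss_def)
    then show ?thesis by (simp only:) (subst AE_distr_iff, simp_all)
  qed
qed

section \<open>Almost sure additivity and void probabilities\<close>

locale ppp =
  fixes M :: "'a measure" and \<Omega> :: "'w measure" and P :: "'a set \<Rightarrow> 'w \<Rightarrow> ennreal"
  assumes ppp: "poisson_point_process M \<Omega> P"
begin

lemma standard_borel_base: "standard_borel M"
  and nonatomic_base: "nonatomic M"
  and standard_borel_prob: "standard_borel \<Omega>"
  and sigma_finite_base: "sigma_finite_measure M"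
  and space_base_nonempty: "space M \<noteq> {}"
  and prob_space_Omega: "prob_space \<Omega>"
proof -
  have s: "standard_measure_space M" and o: "standard_probability_space \<Omega>"
    using ppp by (auto simp: poisson_point_process_def)
  show "standard_borel M" "nonatomic M" "standard_borel \<Omega>" "prob_space \<Omega>"
    using s o by (auto simp: standard_measure_space_def standard_probability_space_def)
  show "sigma_finite_measure M"
    using s by (auto simp: standard_measure_space_def prob_space_def finite_measure_def)
  show "space M \<noteq> {}"
    using s prob_space.not_empty by (auto simp: standard_measure_space_def)
qed

sublocale prob_space \<Omega> by (rule prob_space_Omega)

sublocale base: sigma_finite_measure M by (rule sigma_finite_base)

definition fin :: "'a set set" where "fin = {A \<in> sets M. emeasure M A < \<infinity>}"

lemma finD: "A \<in> fin \<Longrightarrow> A \<in> sets M" "A \<in> fin \<Longrightarrow> emeasure M A < \<infinity>"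
  by (auto simp: fin_def)

lemma finI: "A \<in> sets M \<Longrightarrow> emeasure M A < \<infinity> \<Longrightarrow> A \<in> fin" by (simp add: fin_def)

lemma fin_subset: "A \<in> fin \<Longrightarrow> B \<in> sets M \<Longrightarrow> B \<subseteq> A \<Longrightarrow> B \<in> fin"
  unfolding fin_def using emeasure_mono[of B A M] by (auto intro: le_less_trans)

lemma fin_empty [simp]: "{} \<in> fin" by (simp add: fin_def)

lemma emeasure_fin: "A \<in> fin \<Longrightarrow> emeasure M A = ennreal (measure M A)"
  by (intro emeasure_eq_ennreal_measure) (auto simp: fin_def)

lemma fmeasurable_fin: "A \<in> fin \<Longrightarrow> A \<in> fmeasurable M"
  by (simp add: fin_def fmeasurable_def)

lemma fin_Un [simp]: "A \<in> fin \<Longrightarrow> B \<in> fin \<Longrightarrow> A \<union> B \<in> fin"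
  unfolding fin_def using emeasure_subadditive[of A M B]
  by (auto intro!: le_less_trans[of "emeasure M (A \<union> B)" "emeasure M A + emeasure M B"] ennreal_add_less_top)

lemma emeasure_fin_less_top [simp]: "A \<in> fin \<Longrightarrow> emeasure M A < \<top>"
  by (simp add: fin_def)

declare finD(1) [simp]

lemma fin_Int [simp]: "A \<in> fin \<Longrightarrow> B \<in> sets M \<Longrightarrow> A \<inter> B \<in> fin"
  by (rule fin_subset) auto

lemma fin_Diff [simp]: "A \<in> fin \<Longrightarrow> B \<in> sets M \<Longrightarrow> A - B \<in> fin"
  by (rule fin_subset) auto

lemma fin_UN: "finite I \<Longrightarrow> (\<And>i. i \<in> I \<Longrightarrow> A i \<in> fin) \<Longrightarrow> (\<Union>i\<in>I. A i) \<in> fin"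
  by (induction I rule: finite_induct) auto

lemma P_measurable [measurable (raw), simp]: "A \<in> sets M \<Longrightarrow> P A \<in> borel_measurable \<Omega>"
  and P_distr: "A \<in> sets M \<Longrightarrow> distr \<Omega> borel (P A) = Poiss (emeasure M A)"
  and P_add: "A \<in> sets M \<Longrightarrow> B \<in> sets M \<Longrightarrow> A \<inter> B = {} \<Longrightarrow> AE w in \<Omega>. P (A \<union> B) w = P A w + P B w"
  using ppp by (auto simp: poisson_point_process_def)

lemma P_fin_measurable [measurable]: "A \<in> fin \<Longrightarrow> P A \<in> borel_measurable \<Omega>"
  by simp

lemma prob_P_eq:
  assumes A: "A \<in> fin"
  shows "prob {w \<in> space \<Omega>. P A w = of_nat k} = measure M A ^ k / fact k * exp (- measure M A)"
proof -
  have "emeasure \<Omega> {w \<in> space \<Omega>. P A w = of_nat k} = emeasure (distr \<Omega> borel (P A)) {of_nat k}"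
    using A by (subst emeasure_distr) (auto intro!: arg_cong[where f="emeasure \<Omega>"])
  also have "\<dots> = ennreal (measure M A ^ k / fact k * exp (- measure M A))"
    unfolding P_distr[OF finD(1)[OF A]] emeasure_fin[OF A] by (rule Poiss_singleton) simp
  finally show ?thesis by (simp add: measure_def)
qed

lemma prob_void: "A \<in> fin \<Longrightarrow> prob {w \<in> space \<Omega>. P A w = 0} = exp (- measure M A)"
  using prob_P_eq[of A 0] by simp

lemma AE_P_nat: assumes A: "A \<in> fin" shows "AE w in \<Omega>. P A w \<in> range of_nat"
proof -
  have "AE x in distr \<Omega> borel (P A). x \<in> range of_nat"
    unfolding P_distr[OF finD(1)[OF A]] emeasure_fin[OF A] by (rule AE_Poiss_nat) simp
  then show ?thesis by (rule AE_distrD[rotated]) (use A in simp)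
qed

lemma AE_P_infinite: assumes "A \<in> sets M" "emeasure M A = \<infinity>" shows "AE w in \<Omega>. P A w = \<infinity>"
proof -
  have "AE x in distr \<Omega> borel (P A). x = \<infinity>"
    unfolding P_distr[OF assms(1)] assms(2) Poiss_infinity by (subst AE_return) simp_all
  then show ?thesis by (rule AE_distrD[rotated]) (use assms in simp)
qed

lemma AE_P_null: assumes "A \<in> null_sets M" shows "AE w in \<Omega>. P A w = 0"
proof -
  have "AE x in distr \<Omega> borel (P A). x = 0"
    unfolding P_distr[OF null_setsD2[OF assms]] null_setsD1[OF assms] Poiss_0 by (subst AE_return) simp_all
  then show ?thesis by (rule AE_distrD[rotated]) (use assms in auto)
qed

lemma AE_P_eq_of_AE:
  assumes A: "A \<in> sets M" and B: "B \<in> sets M" and "AE x in M. x \<in> A \<longleftrightarrow> x \<in> B"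
  shows "AE w in \<Omega>. P A w = P B w"
proof -
  have "A - B \<in> null_sets M" "B - A \<in> null_sets M"
    using assms by (auto simp: AE_iff_null_sets elim!: eventually_mono)
  note n = this[THEN AE_P_null]
  have "AE w in \<Omega>. P ((A \<inter> B) \<union> (A - B)) w = P (A \<inter> B) w + P (A - B) w"
    "AE w in \<Omega>. P ((A \<inter> B) \<union> (B - A)) w = P (A \<inter> B) w + P (B - A) w"
    using A B by (intro P_add; auto)+
  moreover have "(A \<inter> B) \<union> (A - B) = A" "(A \<inter> B) \<union> (B - A) = B" by auto
  ultimately show ?thesis using n by (auto elim!: eventually_elim2)
qed

lemma AE_P_UN:
  assumes "finite I" "\<And>i. i \<in> I \<Longrightarrow> A i \<in> sets M" "disjoint_family_on A I"
  shows "AE w in \<Omega>. P (\<Union>i\<in>I. A i) w = (\<Sum>i\<in>I. P (A i) w)"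
  using assms
proof (induction I rule: finite_induct)
  case empty
  then show ?case using AE_P_null[of "{}"] by simp
next
  case (insert j I)
  have "A j \<inter> (\<Union>i\<in>I. A i) = {}" using insert.prems insert.hyps by (fastforce simp: disjoint_family_on_def)
  then have "AE w in \<Omega>. P (A j \<union> (\<Union>i\<in>I. A i)) w = P (A j) w + P (\<Union>i\<in>I. A i) w"
    using insert.prems insert.hyps by (intro P_add) auto
  moreover have "AE w in \<Omega>. P (\<Union>i\<in>I. A i) w = (\<Sum>i\<in>I. P (A i) w)"
    using insert by (auto simp: disjoint_family_on_def)
  ultimately show ?case by eventually_elim (use insert.hyps in simp)
qed

text \<open>Additivity is available for disjoint sets only, so the sets are cut along
  \<open>A \<inter> B\<close>; in \<open>ennreal\<close> a sum vanishes only if both terms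
  do.\<close>

lemma AE_void_Un_iff:
  assumes "A \<in> sets M" "B \<in> sets M"
  shows "AE w in \<Omega>. P (A \<union> B) w = 0 \<longleftrightarrow> P A w = 0 \<and> P B w = 0"
proof -
  have "AE w in \<Omega>. P (A \<union> (B - A)) w = P A w + P (B - A) w"
    "AE w in \<Omega>. P ((B \<inter> A) \<union> (B - A)) w = P (B \<inter> A) w + P (B - A) w"
    "AE w in \<Omega>. P ((B \<inter> A) \<union> (A - B)) w = P (B \<inter> A) w + P (A - B) w"
    using assms by (intro P_add; auto)+
  moreover have "A \<union> (B - A) = A \<union> B" "(B \<inter> A) \<union> (B - A) = B" "(B \<inter> A) \<union> (A - B) = A" by auto
  ultimately show ?thesis by (auto elim!: eventually_rev_mp)
qed

lemma AE_void_UN_iff: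
  assumes "finite J" "J \<subseteq> sets M"
  shows "AE w in \<Omega>. P (\<Union>J) w = 0 \<longleftrightarrow> (\<forall>A\<in>J. P A w = 0)"
  using assms
proof (induction J rule: finite_induct)
  case empty
  then show ?case using AE_P_null[of "{}"] by simp
next
  case (insert A J)
  have "AE w in \<Omega>. P (A \<union> \<Union>J) w = 0 \<longleftrightarrow> P A w = 0 \<and> P (\<Union>J) w = 0"
    using insert by (intro AE_void_Un_iff) (auto intro: sets.finite_Union)
  moreover have "AE w in \<Omega>. P (\<Union>J) w = 0 \<longleftrightarrow> (\<forall>A\<in>J. P A w = 0)" using insert by auto
  ultimately show ?case by eventually_elim simp
qed

text \<open>Vanishing on all members of \<open>J\<close> is vanishing on their union, so the
  one-dimensional Poisson law already determines these joint probabilities. Everything that concerns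
  joint laws, including the independence in \<open>indep_p\<close>, rests on this formula.\<close>

lemma prob_all_void:
  assumes J: "finite J" "J \<subseteq> fin"
  shows "prob {w \<in> space \<Omega>. \<forall>A\<in>J. P A w = 0} = exp (- measure M (\<Union>J))"
proof -
  have F: "\<Union>J \<in> fin" using fin_UN[of J "\<lambda>A. A"] J by auto
  have [measurable]: "P A \<in> borel_measurable \<Omega>" if "A \<in> J" for A using that J by auto
  have "prob {w \<in> space \<Omega>. \<forall>A\<in>J. P A w = 0} = prob {w \<in> space \<Omega>. P (\<Union>J) w = 0}"
  proof (rule measure_eq_AE)
    have "AE w in \<Omega>. P (\<Union>J) w = 0 \<longleftrightarrow> (\<forall>A\<in>J. P A w = 0)"
      by (rule AE_void_UN_iff) (use J in \<open>auto dest: finD\<close>)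
    then show "AE x in \<Omega>. x \<in> {w \<in> space \<Omega>. \<forall>A\<in>J. P A w = 0} \<longleftrightarrow> x \<in> {w \<in> space \<Omega>. P (\<Union>J) w = 0}"
      by (auto elim!: eventually_mono)
    show "{w \<in> space \<Omega>. \<forall>A\<in>J. P A w = 0} \<in> events"
      using J(1) by measurable
    show "{w \<in> space \<Omega>. P (\<Union>J) w = 0} \<in> events" using F by measurable
  qed
  then show ?thesis using prob_void[OF F] by simp
qed

end

section \<open>Moments and characteristic functions\<close>

text \<open>The recursion \<open>q (k + 1) * (k + 1) = l * q k\<close> turns each moment series into
  a shift of a lower one.\<close>

lemma Poisson_sums:
  fixes l :: real
  defines "q \<equiv> \<lambda>k::nat. l ^ k / fact k * exp (- l)"
  shows "q sums 1" "(\<lambda>k. q k * real k) sums l" "(\<lambda>k. q k * (real k)\<^sup>2) sums (l\<^sup>2 + l)"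
proof -
  have e: "(\<lambda>k. l ^ k / fact k) sums exp l"
    using exp_converges[of l] by (simp add: field_simps scaleR_conv_of_real)
  from sums_mult2[OF this, of "exp (- l)"] show q: "q sums 1"
    unfolding q_def by (simp add: mult_exp_exp)
  have shift: "q (Suc k) * real (Suc k) = l * q k" for k
    unfolding q_def by (simp add: divide_simps del: of_nat_Suc)
  have "(\<lambda>k. q (Suc k) * real (Suc k)) sums l"
    using sums_mult[OF q, of l] unfolding shift by simp
  then show m: "(\<lambda>k. q k * real k) sums l" by (subst (asm) sums_Suc_iff) simp
  have "(\<lambda>k. l * (q k * real k) + l * q k) sums (l * l + l * 1)"
    by (intro sums_add sums_mult m q)
  moreover have "l * (q k * real k) + l * q k = q (Suc k) * (real (Suc k))\<^sup>2" for k
    using arg_cong[OF shift[of k], of "\<lambda>x. x * real (Suc k)"]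
    by (simp add: power2_eq_square algebra_simps)
  ultimately have "(\<lambda>k. q (Suc k) * (real (Suc k))\<^sup>2) sums (l * l + l)" by simp
  then show "(\<lambda>k. q k * (real k)\<^sup>2) sums (l\<^sup>2 + l)"
    by (subst (asm) sums_Suc_iff) (simp add: power2_eq_square)
qed

lemma borel_measurable_cis [measurable]: "cis \<in> borel_measurable borel"
  by (intro borel_measurable_continuous_onI continuous_intros)

context ppp
begin

definition p :: "'a set \<Rightarrow> 'w \<Rightarrow> real" where "p A w = enn2real (P A w)"

lemma p_measurable [measurable (raw), simp]: "A \<in> sets M \<Longrightarrow> p A \<in> borel_measurable \<Omega>"
  unfolding p_def[abs_def] by measurable

lemma p_fin_measurable [measurable]: "A \<in> fin \<Longrightarrow> p A \<in> borel_measurable \<Omega>"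
  by simp

lemma p_nonneg [simp]: "0 \<le> p A w" by (simp add: p_def)

lemma AE_P_eq_p: assumes "A \<in> fin" shows "AE w in \<Omega>. P A w = ennreal (p A w)"
  using AE_P_nat[OF assms] by eventually_elim (auto simp: p_def ennreal_of_nat_eq_real_of_nat)

lemma AE_p_nat: assumes "A \<in> fin" shows "AE w in \<Omega>. \<exists>k::nat. p A w = real k"
  using AE_P_nat[OF assms] by eventually_elim (auto simp: p_def)

lemma prob_p_eq:
  assumes A: "A \<in> fin"
  shows "prob {w \<in> space \<Omega>. p A w = real k} = measure M A ^ k / fact k * exp (- measure M A)"
proof -
  have "prob {w \<in> space \<Omega>. p A w = real k} = prob {w \<in> space \<Omega>. P A w = of_nat k}"
  proof (rule measure_eq_AE)
    show "AE x in \<Omega>. x \<in> {w \<in> space \<Omega>. p A w = real k} \<longleftrightarrow> x \<in> {w \<in> space \<Omega>. P A w = of_nat k}"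
      using AE_P_nat[OF A] by eventually_elim (auto simp: p_def)
  qed (use A in \<open>measurable, simp_all\<close>)
  then show ?thesis using prob_P_eq[OF A] by simp
qed

lemma
  fixes g :: "real \<Rightarrow> 'b::{banach, second_countable_topology}"
  assumes A: "A \<in> fin" and [measurable]: "g \<in> borel_measurable borel"
    and summ: "summable (\<lambda>k. measure M A ^ k / fact k * exp (- measure M A) * norm (g (real k)))"
  shows integrable_p: "integrable \<Omega> (\<lambda>w. g (p A w))"
    and integral_p: "(\<integral>w. g (p A w) \<partial>\<Omega>) =
       (\<Sum>k. (measure M A ^ k / fact k * exp (- measure M A)) *\<^sub>R g (real k))"
proof -
  define q where "q k = measure M A ^ k / fact k * exp (- measure M A)" for k :: nat
  have q: "0 \<le> q k" for k unfolding q_def by simp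
  \<comment> \<open>\<open>p A\<close> is integer-valued only almost surely. Rounding down makes it
    so everywhere; the law then lives on a countable space and expectations become series.\<close>
  define K where "K w = nat \<lfloor>p A w\<rfloor>" for w
  have [measurable]: "K \<in> measurable \<Omega> (count_space UNIV)" unfolding K_def using A by measurable
  have pK: "AE w in \<Omega>. p A w = real (K w)" using AE_p_nat[OF A] by eventually_elim (auto simp: K_def)
  have law: "distr \<Omega> (count_space UNIV) K = density (count_space UNIV) (\<lambda>k. ennreal (q k))"
  proof (rule measure_eqI_countable[where A=UNIV])
    fix k
    have "emeasure (distr \<Omega> (count_space UNIV) K) {k} = ennreal (prob {w \<in> space \<Omega>. K w = k})"
      by (subst emeasure_distr) (auto simp: emeasure_eq_measure vimage_def Int_def conj_commute)
    also have "prob {w \<in> space \<Omega>. K w = k} = prob {w \<in> space \<Omega>. p A w = real k}"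
    proof (rule measure_eq_AE)
      show "AE x in \<Omega>. x \<in> {w \<in> space \<Omega>. K w = k} \<longleftrightarrow> x \<in> {w \<in> space \<Omega>. p A w = real k}"
        using pK by eventually_elim auto
    qed (use A in \<open>measurable, simp_all\<close>)
    also have "ennreal \<dots> = emeasure (density (count_space UNIV) (\<lambda>k. ennreal (q k))) {k}"
      by (simp add: emeasure_density prob_p_eq[OF A] q_def nn_integral_count_space_indicator[symmetric])
    finally show "emeasure (distr \<Omega> (count_space UNIV) K) {k} = emeasure (density (count_space UNIV) (\<lambda>k. ennreal (q k))) {k}" .
  qed auto
  have i: "integrable (count_space UNIV) (\<lambda>k. q k *\<^sub>R g (real k))"
    using summ q by (simp add: integrable_count_space_nat_iff q_def)
  then have "integrable (distr \<Omega> (count_space UNIV) K) (\<lambda>k. g (real k))"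
    unfolding law using q by (subst integrable_density) auto
  then have iK: "integrable \<Omega> (\<lambda>w. g (real (K w)))" by (subst (asm) integrable_distr_eq) auto
  then show "integrable \<Omega> (\<lambda>w. g (p A w))"
    by (rule integrable_cong_AE_imp) (use A pK in \<open>auto elim!: eventually_mono\<close>)
  have "(\<integral>w. g (p A w) \<partial>\<Omega>) = (\<integral>w. g (real (K w)) \<partial>\<Omega>)"
    by (rule integral_cong_AE) (use A pK in \<open>auto elim!: eventually_mono\<close>)
  also have "\<dots> = (\<integral>k. g (real k) \<partial>distr \<Omega> (count_space UNIV) K)"
    by (subst integral_distr) auto
  also have "\<dots> = (\<integral>k. q k *\<^sub>R g (real k) \<partial>count_space UNIV)"
    unfolding law using q by (subst integral_density) auto
  also have "\<dots> = (\<Sum>k. q k *\<^sub>R g (real k))"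
    using i by (rule integral_count_space_nat)
  finally show "(\<integral>w. g (p A w) \<partial>\<Omega>) = (\<Sum>k. (measure M A ^ k / fact k * exp (- measure M A)) *\<^sub>R g (real k))"
    by (simp add: q_def)
qed

lemma
  assumes A: "A \<in> fin"
  shows integrable_p1 [simp]: "integrable \<Omega> (p A)" and expectation_p: "expectation (p A) = measure M A"
    and integrable_p2: "integrable \<Omega> (\<lambda>w. (p A w)\<^sup>2)"
    and expectation_p2: "expectation (\<lambda>w. (p A w)\<^sup>2) = (measure M A)\<^sup>2 + measure M A"
proof -
  note s = Poisson_sums[of "measure M A"]
  show "integrable \<Omega> (p A)" using integrable_p[OF A, of "\<lambda>x. x"] sums_summable[OF s(2)] by simp
  show "integrable \<Omega> (\<lambda>w. (p A w)\<^sup>2)"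
    using integrable_p[OF A, of "\<lambda>x. x\<^sup>2"] sums_summable[OF s(3)] by simp
  show "expectation (p A) = measure M A"
    using integral_p[OF A, of "\<lambda>x. x"] s(2) by (simp add: sums_iff)
  show "expectation (\<lambda>w. (p A w)\<^sup>2) = (measure M A)\<^sup>2 + measure M A"
    using integral_p[OF A, of "\<lambda>x. x\<^sup>2"] s(3) by (simp add: sums_iff)
qed

lemma char_p:
  assumes A: "A \<in> fin"
  shows "(CLINT w|\<Omega>. cis (c * p A w)) = exp (measure M A * (cis c - 1))"
proof -
  let ?l = "measure M A"
  have "(\<lambda>k. complex_of_real (exp (- ?l)) * ((?l * cis c) ^ k /\<^sub>R fact k)) sums (exp (- ?l) * exp (?l * cis c))"
    by (intro sums_mult exp_converges)
  moreover have "complex_of_real (exp (- ?l)) * ((?l * cis c) ^ k /\<^sub>R fact k)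
      = (?l ^ k / fact k * exp (- ?l)) *\<^sub>R cis (c * real k)" for k
    unfolding mult.commute[of c "real k"] Complex.DeMoivre[symmetric]
    by (simp add: scaleR_conv_of_real power_mult_distrib divide_inverse)
  ultimately have "(\<lambda>k. (?l ^ k / fact k * exp (- ?l)) *\<^sub>R cis (c * real k)) sums (exp (- ?l) * exp (?l * cis c))"
    by simp
  moreover have "(CLINT w|\<Omega>. cis (c * p A w)) = (\<Sum>k. (?l ^ k / fact k * exp (- ?l)) *\<^sub>R cis (c * real k))"
    using integral_p[OF A, of "\<lambda>x. cis (c * x)"] sums_summable[OF Poisson_sums(1)[of ?l]] by simp
  ultimately have "(CLINT w|\<Omega>. cis (c * p A w)) = exp (- ?l) * exp (?l * cis c)"
    by (simp add: sums_iff)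
  also have "complex_of_real (exp (- ?l)) = exp (- complex_of_real ?l)"
    by (metis exp_of_real of_real_minus)
  also have "\<dots> * exp (?l * cis c) = exp (?l * (cis c - 1))"
    by (simp add: exp_add[symmetric] algebra_simps)
  finally show ?thesis .
qed

lemma norm_char_p:
  assumes A: "A \<in> fin"
  shows "norm (CLINT w|\<Omega>. cis (c * p A w)) = exp (- (measure M A * (1 - cos c)))"
  unfolding char_p[OF A] norm_exp_eq_Re by (simp add: algebra_simps)

end

section \<open>Reconstructing the process from its void events\<close>

text \<open>When a set is split by non-atomicity, both parts have positive measure and one of them
  has at most half of it; iterating gets below any \<open>e\<close>.\<close>

lemma nonatomic_small_subset:
  assumes "nonatomic M" "A \<in> fmeasurable M" "0 < measure M A" "0 < e"
  shows "\<exists>B\<in>sets M. B \<subseteq> A \<and> 0 < measure M B \<and> measure M B \<le> e"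
proof -
  have "\<exists>B\<in>sets M. B \<subseteq> A \<and> 0 < measure M B \<and> measure M B \<le> measure M A / 2 ^ n" for n
  proof (induction n)
    case 0
    then show ?case using assms by (intro bexI[of _ A]) auto
  next
    case (Suc n)
    then obtain B where B: "B \<in> sets M" "B \<subseteq> A" "0 < measure M B" "measure M B \<le> measure M A / 2 ^ n" by auto
    have fB: "B \<in> fmeasurable M" using fmeasurableI2[OF assms(2) B(2,1)] .
    then have "0 < emeasure M B" using B(3) by (simp add: emeasure_eq_measure2)
    then obtain C where C: "C \<in> sets M" "C \<subseteq> B" "0 < emeasure M C" "emeasure M C < emeasure M B"
      using assms(1) B(1) unfolding nonatomic_def by blast
    have fC: "C \<in> fmeasurable M" using fmeasurableI2[OF fB C(2,1)] .
    have mC: "0 < measure M C" "measure M C < measure M B"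
      using C(3,4) fB fC by (simp_all add: emeasure_eq_measure2 ennreal_less_iff)
    have mD: "measure M (B - C) = measure M B - measure M C"
      using fB fC C(2) by (intro measurable_measure_Diff) auto
    show ?case
    proof (cases "measure M C \<le> measure M B / 2")
      case True
      then show ?thesis using C B mC by (intro bexI[of _ C]) auto
    next
      case False
      then show ?thesis using C B mC mD by (intro bexI[of _ "B - C"]) auto
    qed
  qed
  moreover obtain n where "measure M A / 2 ^ n < e"
  proof -
    have "eventually (\<lambda>n. measure M A / 2 ^ n < e) sequentially"
      using assms(4) by (intro order_tendstoD(2)[of _ 0] LIMSEQ_divide_realpow_zero) auto
    then show ?thesis using that by (auto simp: eventually_sequentially)
  qed
  ultimately show ?thesis by (meson less_imp_le order.trans)
qed

text \<open>Exhaustion. Among the subsets of \<open>A\<close> that admit a finite partition as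
  required, take a sequence of nearly maximal measure. A positive remainder would contain a small
  set by \<open>nonatomic_small_subset\<close>, contradicting maximality. So the remainders
  \<open>R n\<close> tend to measure 0, and as soon as one has measure below \<open>e\<close> it
  serves as a last piece.\<close>

lemma nonatomic_partition:
  assumes na: "nonatomic M" and A: "A \<in> fmeasurable M" and e: "0 < e"
  shows "\<exists>\<D>. finite \<D> \<and> \<D> \<subseteq> sets M \<and> disjoint \<D> \<and> \<Union>\<D> = A \<and> (\<forall>D\<in>\<D>. measure M D \<le> e)"
proof -
  define part where "part E \<longleftrightarrow> E \<subseteq> A \<and>
    (\<exists>\<D>. finite \<D> \<and> \<D> \<subseteq> sets M \<and> disjoint \<D> \<and> \<Union>\<D> = E \<and> (\<forall>D\<in>\<D>. measure M D \<le> e))" for E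
  have fm: "B \<in> fmeasurable M" if "B \<in> sets M" "B \<subseteq> A" for B using fmeasurableI2[OF A] that by blast
  have partD: "E \<in> sets M" "E \<subseteq> A" if "part E" for E using that unfolding part_def by auto
  have small: "part B" if "B \<in> sets M" "B \<subseteq> A" "measure M B \<le> e" for B
    unfolding part_def using that by (intro conjI exI[of _ "{B}"]) auto
  have union: "part (E \<union> E')" if E: "part E" and E': "part E'" for E E'
  proof -
    obtain \<D> \<D>' where D: "finite \<D>" "\<D> \<subseteq> sets M" "disjoint \<D>" "\<Union>\<D> = E" "\<And>D. D \<in> \<D> \<Longrightarrow> measure M D \<le> e"
      and D': "finite \<D>'" "\<D>' \<subseteq> sets M" "disjoint \<D>'" "\<Union>\<D>' = E'" "\<And>D. D \<in> \<D>' \<Longrightarrow> measure M D \<le> e"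
      using E E' unfolding part_def by metis
    have "disjoint (\<D> \<union> (\<lambda>D. D - E) ` \<D>')"
    proof (rule disjoint_union)
      show "disjoint ((\<lambda>D. D - E) ` \<D>')"
        unfolding disjoint_def
      proof (intro ballI impI)
        fix X Y assume "X \<in> (\<lambda>D. D - E) ` \<D>'" "Y \<in> (\<lambda>D. D - E) ` \<D>'" "X \<noteq> Y"
        then obtain D1 D2 where "D1 \<in> \<D>'" "D2 \<in> \<D>'" "X = D1 - E" "Y = D2 - E" "D1 \<noteq> D2" by auto
        with D'(3) have "D1 \<inter> D2 = {}" unfolding disjoint_def by blast
        then show "X \<inter> Y = {}" using \<open>X = D1 - E\<close> \<open>Y = D2 - E\<close> by blast
      qed
    qed (use D in auto)
    moreover have "\<Union>(\<D> \<union> (\<lambda>D. D - E) ` \<D>') = E \<union> E'" using D(4) D'(4) by auto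
    moreover have "measure M (D - E) \<le> e" if "D \<in> \<D>'" for D
    proof -
      have "D \<in> fmeasurable M" using that D' E' by (intro fm) (auto simp: part_def)
      then have "measure M (D - E) \<le> measure M D"
        using partD[OF E] that D' by (intro measure_mono_fmeasurable) auto
      then show ?thesis using D'(5)[OF that] by simp
    qed
    ultimately show ?thesis unfolding part_def
      using partD[OF E] partD[OF E'] D D' by (intro conjI exI[of _ "\<D> \<union> (\<lambda>D. D - E) ` \<D>'"]) auto
  qed
  define s where "s = Sup (measure M ` {E. part E})"
  have bdd: "bdd_above (measure M ` {E. part E})"
    by (rule bdd_aboveI[of _ "measure M A"]) (use partD A in \<open>auto intro!: measure_mono_fmeasurable\<close>)
  have pe: "part {}" by (rule small) (use e in auto)
  have "\<exists>E. part E \<and> s - 1 / Suc n < measure M E" for n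
  proof -
    have "s - 1 / Suc n < s" by simp
    then show ?thesis unfolding s_def using less_cSupD[of "measure M ` {E. part E}"] pe by fastforce
  qed
  then obtain E where E: "\<And>n. part (E n)" "\<And>n. s - 1 / Suc n < measure M (E n)" by metis
  have Em: "E n \<in> sets M" for n using E partD by auto
  define R where "R n = A - (\<Union>i<n. E i)" for n
  have R: "R n \<in> sets M" "R n \<subseteq> A" for n using A Em unfolding R_def by auto
  have "measure M (\<Inter>n. R n) = 0"
  proof (rule ccontr)
    assume "measure M (\<Inter>n. R n) \<noteq> 0"
    then have pos: "0 < measure M (\<Inter>n. R n)" by (simp add: zero_less_measure_iff)
    have RR: "(\<Inter>n. R n) \<in> sets M" "(\<Inter>n. R n) \<subseteq> A" using R(1) R(2)[of 0] by auto
    obtain B where B: "B \<in> sets M" "B \<subseteq> (\<Inter>n. R n)" "0 < measure M B" "measure M B \<le> e"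
      using nonatomic_small_subset[OF na fm[OF RR] pos e] by blast
    obtain n where n: "1 / real (Suc n) < measure M B" using nat_approx_posE[OF B(3)] by auto
    have BA: "B \<subseteq> A" using B(2) RR(2) by blast
    have "E n \<inter> B = {}" using B(2) unfolding R_def by auto
    then have "measure M (E n \<union> B) = measure M (E n) + measure M B"
      using fm[OF Em partD(2)[OF E(1)]] fm[OF B(1) BA] by (intro measure_Union) (auto simp: fmeasurable_def less_top[symmetric])
    moreover have "part (E n \<union> B)" by (intro union E small B BA)
    then have "measure M (E n \<union> B) \<le> s" unfolding s_def by (intro cSup_upper bdd) auto
    ultimately show False using E(2)[of n] n by simp
  qed
  moreover have "(\<lambda>n. measure M (R n)) \<longlonglongrightarrow> measure M (\<Inter>n. R n)"
  proof (rule Lim_measure_decseq)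
    show "decseq R" unfolding R_def by (auto simp: decseq_def)
    show "emeasure M (R n) \<noteq> \<infinity>" for n using fm[OF R(1) R(2)] by (auto simp: fmeasurable_def less_top[symmetric])
  qed (use R in auto)
  ultimately have "eventually (\<lambda>n. measure M (R n) < e) sequentially"
    using e by (auto intro: order_tendstoD)
  then obtain n where n: "measure M (R n) < e" by (auto simp: eventually_sequentially)
  have partU: "part (\<Union>i<m. E i)" for m
    by (induction m) (use pe union E in \<open>auto simp: lessThan_Suc\<close>)
  have "part ((\<Union>i<n. E i) \<union> R n)" by (rule union[OF partU small[OF R]]) (use n in simp)
  moreover have "(\<Union>i<n. E i) \<union> R n = A" using partD(2)[OF E(1)] unfolding R_def by auto
  ultimately show ?thesis unfolding part_def by auto
qed

context ppp
begin

definition occupied :: "'i set \<Rightarrow> ('i \<Rightarrow> 'a set) \<Rightarrow> 'w \<Rightarrow> ennreal" where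
  "occupied I A w = (\<Sum>i\<in>I. if P (A i) w = 0 then 0 else 1)"

text \<open>This is \<open>1 - exp (- l) * (1 + l) \<le> l\<^sup>2\<close>, from
  \<open>exp (- l) \<ge> 1 - l\<close>. The quadratic order makes the sum over a fine partition
  small.\<close>

lemma prob_P_ge_2:
  assumes A: "A \<in> fin"
  shows "prob {w \<in> space \<Omega>. P A w \<noteq> 0 \<and> P A w \<noteq> 1} \<le> (measure M A)\<^sup>2"
proof -
  let ?l = "measure M A"
  have [measurable]: "A \<in> sets M" using A by simp
  have "prob {w \<in> space \<Omega>. P A w \<noteq> 0 \<and> P A w \<noteq> 1} = prob (space \<Omega> - ({w \<in> space \<Omega>. P A w = 0} \<union> {w \<in> space \<Omega>. P A w = 1}))"
    by (rule arg_cong[where f=prob]) auto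
  also have "\<dots> = 1 - prob ({w \<in> space \<Omega>. P A w = 0} \<union> {w \<in> space \<Omega>. P A w = 1})"
    by (rule prob_compl) measurable
  also have "prob ({w \<in> space \<Omega>. P A w = 0} \<union> {w \<in> space \<Omega>. P A w = 1})
      = prob {w \<in> space \<Omega>. P A w = 0} + prob {w \<in> space \<Omega>. P A w = 1}"
    by (rule finite_measure_Union) auto
  also have "\<dots> = exp (- ?l) * (1 + ?l)"
    using prob_P_eq[OF A, of 0] prob_P_eq[OF A, of 1] by (simp add: algebra_simps)
  also have "1 - \<dots> \<le> 1 - (1 - ?l) * (1 + ?l)"
    using exp_ge_add_one_self[of "- ?l"] by (intro diff_mono order_refl mult_right_mono) auto
  also have "\<dots> = ?l\<^sup>2" by (simp add: power2_eq_square algebra_simps)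
  finally show ?thesis .
qed

text \<open>The count can be wrong only if some piece carries neither 0 nor 1 points, and the sum of
  the squares \<open>(measure M (A i))\<^sup>2\<close> is at most \<open>e\<close> times the total
  measure.\<close>

lemma prob_occupied_neq:
  assumes I: "finite I" "disjoint_family_on A I" and A: "\<And>i. i \<in> I \<Longrightarrow> A i \<in> fin"
    and e: "\<And>i. i \<in> I \<Longrightarrow> measure M (A i) \<le> e"
  shows "prob {w \<in> space \<Omega>. occupied I A w \<noteq> P (\<Union>i\<in>I. A i) w} \<le> e * measure M (\<Union>i\<in>I. A i)"
proof -
  have U: "(\<Union>i\<in>I. A i) \<in> fin" using I A by (intro fin_UN)
  have [measurable]: "A i \<in> sets M" if "i \<in> I" for i using A that by auto
  have "prob {w \<in> space \<Omega>. occupied I A w \<noteq> P (\<Union>i\<in>I. A i) w}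
      \<le> prob (\<Union>i\<in>I. {w \<in> space \<Omega>. P (A i) w \<noteq> 0 \<and> P (A i) w \<noteq> 1})"
  proof (rule finite_measure_mono_AE)
    have "AE w in \<Omega>. P (\<Union>i\<in>I. A i) w = (\<Sum>i\<in>I. P (A i) w)"
      using I A by (intro AE_P_UN) auto
    then show "AE w in \<Omega>. w \<in> {w \<in> space \<Omega>. occupied I A w \<noteq> P (\<Union>i\<in>I. A i) w} \<longrightarrow>
        w \<in> (\<Union>i\<in>I. {w \<in> space \<Omega>. P (A i) w \<noteq> 0 \<and> P (A i) w \<noteq> 1})"
      by eventually_elim (auto simp: occupied_def intro!: sum.cong)
    show "(\<Union>i\<in>I. {w \<in> space \<Omega>. P (A i) w \<noteq> 0 \<and> P (A i) w \<noteq> 1}) \<in> events"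
      using I(1) by (intro sets.finite_UN) measurable
  qed
  also have "\<dots> \<le> (\<Sum>i\<in>I. prob {w \<in> space \<Omega>. P (A i) w \<noteq> 0 \<and> P (A i) w \<noteq> 1})"
    by (rule finite_measure_subadditive_finite) (use I(1) in auto)
  also have "\<dots> \<le> (\<Sum>i\<in>I. e * measure M (A i))"
  proof (rule sum_mono)
    fix i assume i: "i \<in> I"
    have "prob {w \<in> space \<Omega>. P (A i) w \<noteq> 0 \<and> P (A i) w \<noteq> 1} \<le> measure M (A i) * measure M (A i)"
      using prob_P_ge_2[OF A[OF i]] by (simp add: power2_eq_square)
    also have "\<dots> \<le> e * measure M (A i)" using e[OF i] by (intro mult_right_mono) auto
    finally show "prob {w \<in> space \<Omega>. P (A i) w \<noteq> 0 \<and> P (A i) w \<noteq> 1} \<le> e * measure M (A i)" .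
  qed
  also have "\<dots> = e * measure M (\<Union>i\<in>I. A i)"
    using I A by (subst measure_finite_Union) (auto simp: sum_distrib_left emeasure_fin)
  finally show ?thesis .
qed

text \<open>The pieces are indexed rather than collected in a set: the lemma is also applied to the
  preimages of a partition under its own indices, where distinct pieces may have the same empty
  preimage, and the counts in the two spaces are compared term by term.\<close>

lemma AE_occupied_eq:
  fixes I :: "nat \<Rightarrow> 'i set"
  assumes A: "A \<in> fin"
    and I: "\<And>n. finite (I n)" "\<And>n. disjoint_family_on (D n) (I n)" "\<And>n. (\<Union>i\<in>I n. D n i) = A"
    and D: "\<And>n i. i \<in> I n \<Longrightarrow> D n i \<in> sets M" "\<And>n i. i \<in> I n \<Longrightarrow> measure M (D n i) \<le> (1/2) ^ n"
  shows "AE w in \<Omega>. eventually (\<lambda>n. occupied (I n) (D n) w = P A w) sequentially"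
proof -
  have Df: "D n i \<in> fin" if "i \<in> I n" for n i
    using fin_subset[OF A D(1)[OF that]] I(3)[of n] that by blast
  have [measurable]: "A \<in> sets M" "\<And>n i. i \<in> I n \<Longrightarrow> D n i \<in> sets M" using A D by auto
  define E where "E n = {w \<in> space \<Omega>. occupied (I n) (D n) w \<noteq> P A w}" for n
  have E[measurable]: "E n \<in> sets \<Omega>" for n unfolding E_def occupied_def by measurable
  have "AE w in \<Omega>. eventually (\<lambda>n. w \<in> space \<Omega> - E n) sequentially"
  proof (rule borel_cantelli_AE1)
    have "prob (E n) \<le> (1/2)^n * measure M A" for n
      using prob_occupied_neq[OF I(1) I(2) Df D(2)] unfolding E_def I(3) by blast
    then have le: "norm (prob (E n)) \<le> (1/2)^n * measure M A" for n
      by (simp only: real_norm_def abs_of_nonneg measure_nonneg)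
    have "summable (\<lambda>n. (1/2)^n * measure M A)"
      by (intro summable_mult2 summable_geometric) simp
    then show "summable (\<lambda>n. measure \<Omega> (E n))"
      by (rule summable_comparison_test'[where N=0]) (rule le)
  qed (simp_all add: emeasure_eq_measure)
  then show ?thesis
    by eventually_elim (erule eventually_mono, simp add: E_def)
qed

lemma fine_partitions:
  assumes "A \<in> fin"
  obtains \<D> :: "nat \<Rightarrow> 'a set set" where "\<And>n. finite (\<D> n)" "\<And>n. disjoint_family_on (\<lambda>D. D) (\<D> n)" "\<And>n. \<Union>(\<D> n) = A"
    "\<And>n D. D \<in> \<D> n \<Longrightarrow> D \<in> sets M" "\<And>n D. D \<in> \<D> n \<Longrightarrow> measure M D \<le> (1/2) ^ n"
proof -
  have "\<forall>n. \<exists>\<D>. finite \<D> \<and> \<D> \<subseteq> sets M \<and> disjoint \<D> \<and> \<Union>\<D> = A \<and> (\<forall>D\<in>\<D>. measure M D \<le> (1/2) ^ n)"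
    using nonatomic_partition[OF nonatomic_base fmeasurable_fin[OF assms]] by auto
  then obtain \<D> where "\<And>n. finite (\<D> n) \<and> \<D> n \<subseteq> sets M \<and> disjoint (\<D> n) \<and> \<Union>(\<D> n) = A \<and> (\<forall>D\<in>\<D> n. measure M D \<le> (1/2) ^ n)"
    by metis
  note * = this
  show ?thesis
  proof (rule that[of \<D>])
    show "disjoint_family_on (\<lambda>D. D) (\<D> n)" for n
      using *[of n] unfolding disjoint_family_on_def disjoint_def by blast
    show "D \<in> sets M" "measure M D \<le> (1/2) ^ n" if "D \<in> \<D> n" for n D
      using *[of n] that by blast+
  qed (use * in blast)+
qed

end

section \<open>Lifting maps of the base to maps of the process\<close>

text \<open>A configuration is encoded by the set of those sets of finite measure that it does not charge;
  unlike the void events themselves, the generators below are closed under intersection exactly,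
  not just modulo null sets.\<close>

definition void_space :: "'a set set \<Rightarrow> 'a set set measure" where
  "void_space F = sigma UNIV {{z. J \<subseteq> z} | J. finite J \<and> J \<subseteq> F}"

lemma space_void_space [simp]: "space (void_space F) = UNIV"
  by (simp add: void_space_def space_measure_of_conv)

lemma sets_void_space: "sets (void_space F) = sigma_sets UNIV {{z. J \<subseteq> z} | J. finite J \<and> J \<subseteq> F}"
  by (simp add: void_space_def sets_measure_of_conv)

lemma void_mem_sets [measurable]: "A \<in> F \<Longrightarrow> {z. A \<in> z} \<in> sets (void_space F)"
  unfolding sets_void_space by (intro sigma_sets.Basic CollectI exI[of _ "{A}"]) auto

lemma measurable_void_space:
  assumes "\<And>A. A \<in> F \<Longrightarrow> {w \<in> space N. A \<in> Z w} \<in> sets N"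
  shows "Z \<in> measurable N (void_space F)"
proof (rule measurable_sigma_sets[OF sets_void_space])
  fix B assume "B \<in> {{z. J \<subseteq> z} | J. finite J \<and> J \<subseteq> F}"
  then obtain J where J: "finite J" "J \<subseteq> F" "B = {z. J \<subseteq> z}" by auto
  have "Z -` B \<inter> space N = {w \<in> space N. \<forall>A\<in>J. A \<in> Z w}" using J(3) by auto
  also have "\<dots> \<in> sets N" using J assms by (intro sets.sets_Collect_finite_All) auto
  finally show "Z -` B \<inter> space N \<in> sets N" .
qed auto

lemma void_law_eqI:
  assumes "prob_space N1" "prob_space N2"
    and Z: "Z1 \<in> measurable N1 (void_space F)" "Z2 \<in> measurable N2 (void_space F)"
    and eq: "\<And>J. finite J \<Longrightarrow> J \<subseteq> F \<Longrightarrow>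
      measure N1 {w \<in> space N1. J \<subseteq> Z1 w} = measure N2 {w \<in> space N2. J \<subseteq> Z2 w}"
  shows "distr N1 (void_space F) Z1 = distr N2 (void_space F) Z2"
proof -
  interpret N1: prob_space N1 by fact
  interpret N2: prob_space N2 by fact
  let ?E = "{{z. J \<subseteq> z} | J. finite J \<and> J \<subseteq> F}"
  have E: "?E \<subseteq> sets (void_space F)" unfolding sets_void_space by auto
  show ?thesis
  proof (rule measure_eqI_generator_eq[where E="?E" and \<Omega>=UNIV and A="\<lambda>_. UNIV"])
    show "Int_stable ?E"
    proof (rule Int_stableI)
      fix a b assume "a \<in> ?E" "b \<in> ?E"
      then obtain J K where "a = {z. J \<subseteq> z}" "b = {z. K \<subseteq> z}" "finite J" "finite K" "J \<subseteq> F" "K \<subseteq> F" by auto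
      then show "a \<inter> b \<in> ?E" by (intro CollectI exI[of _ "J \<union> K"]) auto
    qed
    show "emeasure (distr N1 (void_space F) Z1) X = emeasure (distr N2 (void_space F) Z2) X" if X: "X \<in> ?E" for X
    proof -
      obtain J where J: "X = {z. J \<subseteq> z}" "finite J" "J \<subseteq> F" using X by auto
      have X': "X \<in> sets (void_space F)" using X E by blast
      have "Z1 -` X \<inter> space N1 = {w \<in> space N1. J \<subseteq> Z1 w}" "Z2 -` X \<inter> space N2 = {w \<in> space N2. J \<subseteq> Z2 w}"
        using J(1) by auto
      then show ?thesis
        using emeasure_distr[OF Z(1) X'] emeasure_distr[OF Z(2) X'] eq[OF J(2,3)]
        by (simp add: N1.emeasure_eq_measure N2.emeasure_eq_measure)
    qed
    show "range (\<lambda>_. UNIV) \<subseteq> ?E" by (auto intro!: exI[of _ "{}"])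
    show "emeasure (distr N1 (void_space F) Z1) UNIV \<noteq> \<infinity>"
      using N1.emeasure_finite by (subst emeasure_distr[OF Z(1)]) (use sets.top[of "void_space F"] in auto)
  qed (auto simp: sets_void_space)
qed

lemma AE_same_law:
  assumes "Z1 \<in> measurable N1 K" "Z2 \<in> measurable N2 K" "distr N1 K Z1 = distr N2 K Z2"
    and "{z \<in> space K. Q z} \<in> sets K" and "AE w in N2. Q (Z2 w)"
  shows "AE w in N1. Q (Z1 w)"
  unfolding AE_distr_iff[OF assms(1,4), symmetric] assms(3)
  using AE_distr_iff[OF assms(2,4)] assms(5) by blast

text \<open>Modulo null sets every event \<open>F\<close> of \<open>N2\<close> has the form
  \<open>Z2 w \<in> b F\<close>. The choice of \<open>b\<close> is arbitrary and respects no set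
  operation, but the relations that hold almost everywhere along \<open>Z2\<close> hold along
  \<open>Z1\<close> too, because the laws agree. So replacing \<open>Z2\<close> by \<open>Z1\<close>
  gives a homomorphism modulo null sets, to which \<open>point_realization\<close> applies.\<close>

lemma factor_map:
  assumes N2: "standard_borel N2" "space N2 \<noteq> {}"
    and Z1[measurable]: "Z1 \<in> measurable N1 K" and Z2[measurable]: "Z2 \<in> measurable N2 K"
    and law: "distr N1 K Z1 = distr N2 K Z2"
    and gen: "\<And>F. F \<in> sets N2 \<Longrightarrow> \<exists>B\<in>sets K. AE w in N2. w \<in> F \<longleftrightarrow> Z2 w \<in> B"
  obtains f where "f \<in> measurable N1 N2" "distr N1 N2 f = N2"
    "\<And>B. B \<in> sets K \<Longrightarrow> AE w in N1. Z2 (f w) \<in> B \<longleftrightarrow> Z1 w \<in> B"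
proof -
  obtain b where b[measurable]: "\<And>F. F \<in> sets N2 \<Longrightarrow> b F \<in> sets K"
    and bF: "\<And>F. F \<in> sets N2 \<Longrightarrow> AE w in N2. w \<in> F \<longleftrightarrow> Z2 w \<in> b F"
    using gen by metis
  note transfer = AE_same_law[OF Z1 Z2 law]
  define \<Phi> where "\<Phi> F = Z1 -` b F \<inter> space N1" for F
  have \<Phi>: "AE w in N1. w \<in> \<Phi> F \<longleftrightarrow> Z1 w \<in> b F" for F
    using AE_space by eventually_elim (simp add: \<Phi>_def)
  obtain f where f: "f \<in> measurable N1 N2" and fF: "\<And>F. F \<in> sets N2 \<Longrightarrow> AE w in N1. f w \<in> F \<longleftrightarrow> w \<in> \<Phi> F"
  proof (rule point_realization[OF N2, of \<Phi> N1])
    show "\<Phi> F \<in> sets N1" if "F \<in> sets N2" for F using b[OF that] Z1 unfolding \<Phi>_def by auto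
    show "AE w in N1. w \<in> \<Phi> (space N2 - F) \<longleftrightarrow> w \<notin> \<Phi> F" if F: "F \<in> sets N2" for F
    proof -
      have F': "space N2 - F \<in> sets N2" using F by auto
      have "AE w in N2. Z2 w \<in> b (space N2 - F) \<longleftrightarrow> Z2 w \<notin> b F"
        using bF[OF F] bF[OF F'] AE_space by eventually_elim auto
      then have "AE w in N1. Z1 w \<in> b (space N2 - F) \<longleftrightarrow> Z1 w \<notin> b F"
        by (rule transfer[rotated]) (use b[OF F] b[OF F'] in measurable)
      then show ?thesis using \<Phi>[of F] \<Phi>[of "space N2 - F"] by eventually_elim auto
    qed
    show "AE w in N1. w \<in> \<Phi> (\<Union>n. A n) \<longleftrightarrow> (\<exists>n. w \<in> \<Phi> (A n))" if A: "range A \<subseteq> sets N2" for A :: "nat \<Rightarrow> _ set"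
    proof -
      have An: "A n \<in> sets N2" for n using A by auto
      have U: "(\<Union>n. A n) \<in> sets N2" using A by auto
      have [measurable]: "b (A n) \<in> sets K" "b (\<Union>n. A n) \<in> sets K" for n using b An U by auto
      have "AE w in N2. \<forall>n. w \<in> A n \<longleftrightarrow> Z2 w \<in> b (A n)" unfolding AE_all_countable using bF[OF An] by blast
      then have "AE w in N2. Z2 w \<in> b (\<Union>n. A n) \<longleftrightarrow> (\<exists>n. Z2 w \<in> b (A n))"
        using bF[OF U] by eventually_elim auto
      then have "AE w in N1. Z1 w \<in> b (\<Union>n. A n) \<longleftrightarrow> (\<exists>n. Z1 w \<in> b (A n))"
        by (rule transfer[rotated]) measurable
      then show ?thesis using AE_space by eventually_elim (simp add: \<Phi>_def)
    qed
  qed blast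
  have fZ: "AE w in N1. f w \<in> F \<longleftrightarrow> Z1 w \<in> b F" if "F \<in> sets N2" for F
    using fF[OF that] \<Phi>[of F] by eventually_elim simp
  show ?thesis
  proof
    show "f \<in> measurable N1 N2" by fact
    show "distr N1 N2 f = N2"
    proof (rule measure_eqI)
      fix F assume "F \<in> sets (distr N1 N2 f)"
      then have F: "F \<in> sets N2" by simp
      have "emeasure (distr N1 N2 f) F = emeasure N1 (f -` F \<inter> space N1)" by (rule emeasure_distr[OF f F])
      also have "\<dots> = emeasure N1 (Z1 -` b F \<inter> space N1)"
        using fZ[OF F] f F b[OF F] Z1 AE_space
        by (intro emeasure_eq_AE) (auto elim!: eventually_elim2 intro: measurable_sets)
      also have "\<dots> = emeasure (distr N2 K Z2) (b F)"
        unfolding law[symmetric] by (rule emeasure_distr[OF Z1 b[OF F], symmetric])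
      also have "\<dots> = emeasure N2 (Z2 -` b F \<inter> space N2)" by (rule emeasure_distr[OF Z2 b[OF F]])
      also have "\<dots> = emeasure N2 F"
      proof (rule emeasure_eq_AE)
        show "AE x in N2. x \<in> Z2 -` b F \<inter> space N2 \<longleftrightarrow> x \<in> F"
          using bF[OF F] AE_space by eventually_elim simp
      qed (use F b[OF F] Z2 in \<open>auto intro: measurable_sets\<close>)
      finally show "emeasure (distr N1 N2 f) F = emeasure N2 F" .
    qed simp
    fix B assume B[measurable]: "B \<in> sets K"
    let ?F = "Z2 -` B \<inter> space N2"
    have F: "?F \<in> sets N2" by measurable
    have "AE w in N2. Z2 w \<in> b ?F \<longleftrightarrow> Z2 w \<in> B"
      using bF[OF F] AE_space by eventually_elim simp
    then have "AE w in N1. Z1 w \<in> b ?F \<longleftrightarrow> Z1 w \<in> B"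
      by (rule transfer[rotated]) (use b[OF F] in measurable)
    then show "AE w in N1. Z2 (f w) \<in> B \<longleftrightarrow> Z1 w \<in> B"
      using fZ[OF F] AE_space by eventually_elim (use measurable_space[OF f] in auto)
  qed
qed

context ppp
begin

definition void :: "'w \<Rightarrow> 'a set set" where "void w = {A \<in> fin. P A w = 0}"

lemma measurable_void_subset: "F \<subseteq> fin \<Longrightarrow> void \<in> measurable \<Omega> (void_space F)"
  by (rule measurable_void_space) (auto simp: void_def)

lemma measurable_void [measurable]: "void \<in> measurable \<Omega> (void_space fin)"
  by (rule measurable_void_subset) simp

lemma prob_void_superset:
  assumes "finite J" "J \<subseteq> fin"
  shows "prob {w \<in> space \<Omega>. J \<subseteq> void w} = exp (- measure M (\<Union>J))"
proof -
  have "{w \<in> space \<Omega>. J \<subseteq> void w} = {w \<in> space \<Omega>. \<forall>A\<in>J. P A w = 0}"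
    using assms by (auto simp: void_def)
  then show ?thesis using prob_all_void[OF assms] by simp
qed

text \<open>The point is locality: only void events of subsets of \<open>A\<close> are used. This is
  what makes the values on disjoint sets independent in \<open>indep_p\<close>.\<close>

lemma AE_P_factor_void:
  assumes A: "A \<in> sets M"
  obtains L where "L \<in> borel_measurable (void_space {B \<in> fin. B \<subseteq> A})" "AE w in \<Omega>. P A w = L (void w)"
proof (cases "emeasure M A < \<infinity>")
  case False
  then have "AE w in \<Omega>. P A w = \<infinity>" using A by (intro AE_P_infinite) (auto simp: less_top[symmetric])
  then show ?thesis by (intro that[of "\<lambda>_. \<infinity>"]) auto
next
  case True
  with A have A: "A \<in> fin" by (auto intro: finI)
  obtain \<D> :: "nat \<Rightarrow> 'a set set" where D: "\<And>n. finite (\<D> n)" "\<And>n. disjoint_family_on (\<lambda>D. D) (\<D> n)" "\<And>n. \<Union>(\<D> n) = A"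
    "\<And>n D. D \<in> \<D> n \<Longrightarrow> D \<in> sets M" "\<And>n D. D \<in> \<D> n \<Longrightarrow> measure M D \<le> (1/2) ^ n"
    using fine_partitions[OF A] by metis
  have Df: "D \<in> {B \<in> fin. B \<subseteq> A}" if "D \<in> \<D> n" for n D
    using fin_subset[OF A D(4)[OF that]] D(3)[of n] that by blast
  \<comment> \<open>The counts converge only almost surely; the lower limit is defined and
    measurable everywhere and agrees with the limit where it exists.\<close>
  define L where "L z = liminf (\<lambda>n. (\<Sum>D\<in>\<D> n. if D \<in> z then 0 else 1 :: ennreal))" for z
  have L: "L \<in> borel_measurable (void_space {B \<in> fin. B \<subseteq> A})"
    unfolding L_def[abs_def]
  proof (intro borel_measurable_liminf borel_measurable_sum)
    fix n D assume "D \<in> \<D> n"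
    then have "{z. D \<in> z} \<in> sets (void_space {B \<in> fin. B \<subseteq> A})" using Df by (intro void_mem_sets)
    then show "(\<lambda>z. if D \<in> z then 0 else 1 :: ennreal) \<in> borel_measurable (void_space {B \<in> fin. B \<subseteq> A})"
      by (intro measurable_If) auto
  qed
  have "AE w in \<Omega>. eventually (\<lambda>n. occupied (\<D> n) (\<lambda>D. D) w = P A w) sequentially"
    using AE_occupied_eq[OF A, of \<D> "\<lambda>_ D. D"] D by auto
  then have "AE w in \<Omega>. P A w = L (void w)"
  proof eventually_elim
    case (elim w)
    have "occupied (\<D> n) (\<lambda>D. D) w = (\<Sum>D\<in>\<D> n. if D \<in> void w then 0 else 1)" for n
      unfolding occupied_def using Df by (intro sum.cong) (auto simp: void_def)
    with elim have "eventually (\<lambda>n. (\<Sum>D\<in>\<D> n. if D \<in> void w then 0 else 1) = P A w) sequentially" by simp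
    then have "L (void w) = liminf (\<lambda>n::nat. P A w)" unfolding L_def by (intro Liminf_eq)
    then show ?case by (simp add: Liminf_const)
  qed
  with L show ?thesis by (rule that)
qed

lemma generative_void:
  assumes gen: "generative M \<Omega> P" and F: "F \<in> sets \<Omega>"
  shows "\<exists>B\<in>sets (void_space fin). AE w in \<Omega>. w \<in> F \<longleftrightarrow> void w \<in> B"
proof -
  obtain F' where F': "F' \<in> sigma_sets (space \<Omega>) {P A -` E \<inter> space \<Omega> | A E. A \<in> sets M \<and> E \<in> sets borel}"
    and FF: "sym_diff F F' \<in> null_sets \<Omega>"
    using gen F unfolding generative_def by blast
  have "\<exists>B\<in>sets (void_space fin). AE w in \<Omega>. w \<in> F' \<longleftrightarrow> void w \<in> B"
    using F'
  proof induction
    case (Basic X)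
    then obtain A E where X: "X = P A -` E \<inter> space \<Omega>" "A \<in> sets M" "E \<in> sets borel" by auto
    obtain L where L: "L \<in> borel_measurable (void_space {B \<in> fin. B \<subseteq> A})" "AE w in \<Omega>. P A w = L (void w)"
      using AE_P_factor_void[OF X(2)] by metis
    have "L -` E \<inter> space (void_space {B \<in> fin. B \<subseteq> A}) \<in> sets (void_space {B \<in> fin. B \<subseteq> A})"
      by (rule measurable_sets[OF L(1) X(3)])
    also have "sets (void_space {B \<in> fin. B \<subseteq> A}) \<subseteq> sets (void_space fin)"
      unfolding sets_void_space by (rule sigma_sets_mono') auto
    finally have LE: "L -` E \<in> sets (void_space fin)" by simp
    have "AE w in \<Omega>. w \<in> X \<longleftrightarrow> void w \<in> L -` E"
      using L(2) AE_space by eventually_elim (simp add: X(1))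
    then show ?case using LE by blast
  next
    case Empty
    then show ?case by (intro bexI[of _ "{}"]) auto
  next
    case (Compl X)
    then obtain B where B: "B \<in> sets (void_space fin)" "AE w in \<Omega>. w \<in> X \<longleftrightarrow> void w \<in> B" by auto
    have "AE w in \<Omega>. w \<in> space \<Omega> - X \<longleftrightarrow> void w \<in> space (void_space fin) - B"
      using B(2) AE_space by eventually_elim simp
    then show ?case using sets.compl_sets[OF B(1)] by blast
  next
    case (Union X)
    then have "\<forall>n. \<exists>B. B \<in> sets (void_space fin) \<and> (AE w in \<Omega>. w \<in> X n \<longleftrightarrow> void w \<in> B)" by blast
    from choice[OF this] obtain B where B: "\<And>n::nat. B n \<in> sets (void_space fin)"
        "\<And>n. AE w in \<Omega>. w \<in> X n \<longleftrightarrow> void w \<in> B n"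
      by blast
    have "AE w in \<Omega>. \<forall>n. w \<in> X n \<longleftrightarrow> void w \<in> B n" unfolding AE_all_countable using B(2) by auto
    then have "AE w in \<Omega>. w \<in> (\<Union>n. X n) \<longleftrightarrow> void w \<in> (\<Union>n. B n)" by eventually_elim simp
    then show ?case using B(1) by (intro bexI[of _ "\<Union>n. B n"]) auto
  qed
  then obtain B where B: "B \<in> sets (void_space fin)" "AE w in \<Omega>. w \<in> F' \<longleftrightarrow> void w \<in> B" by auto
  have "AE w in \<Omega>. w \<notin> sym_diff F F'" using FF by (rule AE_not_in)
  with B(2) have "AE w in \<Omega>. w \<in> F \<longleftrightarrow> void w \<in> B" by eventually_elim auto
  with B(1) show ?thesis by blast
qed

text \<open>Generativity as a uniqueness principle: a measure preserving map into
  \<open>\<Omega>\<close> is determined by the process along it. Measure preservation is what pulls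
  the null set between \<open>F\<close> and \<open>F'\<close> back to a null set of
  \<open>N\<close>.\<close>

lemma AE_eq_if_AE_P_eq:
  assumes gen: "generative M \<Omega> P"
    and f: "f \<in> measurable N \<Omega>" "distr N \<Omega> f = \<Omega>" and g: "g \<in> measurable N \<Omega>" "distr N \<Omega> g = \<Omega>"
    and eq: "\<And>A. A \<in> sets M \<Longrightarrow> AE w in N. P A (f w) = P A (g w)"
  shows "AE w in N. f w = g w"
proof (rule AE_eq_if_AE_mem_iff[OF standard_borel_prob f(1) g(1)])
  fix F assume "F \<in> sets \<Omega>"
  then obtain F' where F': "F' \<in> sigma_sets (space \<Omega>) {P A -` E \<inter> space \<Omega> | A E. A \<in> sets M \<and> E \<in> sets borel}"
    and FF: "sym_diff F F' \<in> null_sets \<Omega>"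
    using gen unfolding generative_def by blast
  have sp: "f w \<in> space \<Omega>" "g w \<in> space \<Omega>" if "w \<in> space N" for w
    using that measurable_space[OF f(1)] measurable_space[OF g(1)] by auto
  have "AE w in N. f w \<in> F' \<longleftrightarrow> g w \<in> F'"
    using F'
  proof induction
    case (Basic X)
    then obtain A E where X: "X = P A -` E \<inter> space \<Omega>" "A \<in> sets M" by auto
    show ?case using eq[OF X(2)] AE_space by eventually_elim (use sp X(1) in auto)
  next
    case (Compl X)
    from Compl.IH show ?case using AE_space by eventually_elim (use sp in auto)
  next
    case (Union X)
    then have "AE w in N. \<forall>n. f w \<in> X n \<longleftrightarrow> g w \<in> X n" unfolding AE_all_countable by blast
    then show ?case by eventually_elim auto
  qed simp
  moreover have "AE w in \<Omega>. w \<in> F \<longleftrightarrow> w \<in> F'" using AE_not_in[OF FF] by eventually_elim auto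
  note distr_AE_iff[OF f this] distr_AE_iff[OF g this]
  ultimately show "AE w in N. f w \<in> F \<longleftrightarrow> g w \<in> F" by eventually_elim auto
qed

end

text \<open>Preimages commute with unions, so the void events of the sets \<open>pre A\<close> have
  the joint law of the void events of the target, and \<open>factor_map\<close> gives a map that
  matches them. The values of the process are then recovered by counting occupied pieces.\<close>

lemma lift_map:
  fixes M1 :: "'a1 measure" and \<Omega>1 :: "'w1 measure" and M2 :: "'a2 measure" and \<Omega>2 :: "'w2 measure"
  assumes "ppp M1 \<Omega>1 P1" "ppp M2 \<Omega>2 P2" "generative M2 \<Omega>2 P2"
    and \<phi>: "\<phi> \<in> measurable M1 M2" "distr M1 M2 \<phi> = M2"
  obtains f where "f \<in> measurable \<Omega>1 \<Omega>2" "distr \<Omega>1 \<Omega>2 f = \<Omega>2"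
    "\<And>A. A \<in> sets M2 \<Longrightarrow> AE w in \<Omega>1. P2 A (f w) = P1 (\<phi> -` A \<inter> space M1) w"
proof -
  interpret p1: ppp M1 \<Omega>1 P1 by fact
  interpret p2: ppp M2 \<Omega>2 P2 by fact
  define pre where "pre A = \<phi> -` A \<inter> space M1" for A
  have pre: "pre A \<in> sets M1" if "A \<in> sets M2" for A unfolding pre_def using \<phi>(1) that by auto
  have em: "emeasure M1 (pre A) = emeasure M2 A" if "A \<in> sets M2" for A
    unfolding pre_def by (rule emeasure_vimage_mp[OF \<phi> that])
  have mm: "measure M1 (pre A) = measure M2 A" if "A \<in> sets M2" for A using em[OF that] by (simp add: measure_def)
  have pref: "pre A \<in> p1.fin" if "A \<in> p2.fin" for A
    using that by (intro p1.finI pre) (auto simp: em)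
  define Z where "Z w = {A \<in> p2.fin. P1 (pre A) w = 0}" for w
  have Z: "Z \<in> measurable \<Omega>1 (void_space p2.fin)"
    by (rule measurable_void_space) (use pref in \<open>auto simp: Z_def\<close>)
  have law: "distr \<Omega>1 (void_space p2.fin) Z = distr \<Omega>2 (void_space p2.fin) p2.void"
  proof (rule void_law_eqI[OF p1.prob_space_Omega p2.prob_space_Omega Z p2.measurable_void])
    fix J assume J: "finite J" "J \<subseteq> p2.fin"
    have "{w \<in> space \<Omega>1. J \<subseteq> Z w} = {w \<in> space \<Omega>1. \<forall>A\<in>pre ` J. P1 A w = 0}"
      using J by (auto simp: Z_def)
    moreover have "pre ` J \<subseteq> p1.fin" using J(2) pref by blast
    ultimately have "p1.prob {w \<in> space \<Omega>1. J \<subseteq> Z w} = exp (- measure M1 (\<Union>(pre ` J)))"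
      using p1.prob_all_void[of "pre ` J"] J(1) by simp
    also have "\<Union>(pre ` J) = pre (\<Union>J)" unfolding pre_def by auto
    also have "measure M1 (pre (\<Union>J)) = measure M2 (\<Union>J)" using J by (intro mm sets.finite_Union) auto
    finally show "p1.prob {w \<in> space \<Omega>1. J \<subseteq> Z w} = p2.prob {w \<in> space \<Omega>2. J \<subseteq> p2.void w}"
      using p2.prob_void_superset[OF J] by simp
  qed
  obtain f where f: "f \<in> measurable \<Omega>1 \<Omega>2" "distr \<Omega>1 \<Omega>2 f = \<Omega>2"
    and fZ: "\<And>B. B \<in> sets (void_space p2.fin) \<Longrightarrow> AE w in \<Omega>1. p2.void (f w) \<in> B \<longleftrightarrow> Z w \<in> B"
    by (rule factor_map[OF p2.standard_borel_prob p2.not_empty Z p2.measurable_void law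
      p2.generative_void[OF assms(3)]]) blast+
  have void: "AE w in \<Omega>1. P2 A (f w) = 0 \<longleftrightarrow> P1 (pre A) w = 0" if "A \<in> p2.fin" for A
    using fZ[OF void_mem_sets[OF that]] by eventually_elim (use that in \<open>auto simp: p2.void_def Z_def\<close>)
  show ?thesis
  proof (rule that[OF f])
    fix A assume A: "A \<in> sets M2"
    show "AE w in \<Omega>1. P2 A (f w) = P1 (\<phi> -` A \<inter> space M1) w"
    proof (cases "emeasure M2 A < \<infinity>")
      case False
      then have "AE w in \<Omega>2. P2 A w = \<infinity>" using A by (intro p2.AE_P_infinite) (auto simp: less_top[symmetric])
      note 2 = distr_AE_iff[OF f this]
      have "AE w in \<Omega>1. P1 (pre A) w = \<infinity>"
        using False A em[OF A] by (intro p1.AE_P_infinite pre) (auto simp: less_top[symmetric])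
      with 2 show ?thesis unfolding pre_def by eventually_elim simp
    next
      case True
      with A have A: "A \<in> p2.fin" by (auto intro: p2.finI)
      obtain \<D> :: "nat \<Rightarrow> 'a2 set set" where D: "\<And>n. finite (\<D> n)" "\<And>n. disjoint_family_on (\<lambda>D. D) (\<D> n)" "\<And>n. \<Union>(\<D> n) = A"
        "\<And>n D. D \<in> \<D> n \<Longrightarrow> D \<in> sets M2" "\<And>n D. D \<in> \<D> n \<Longrightarrow> measure M2 D \<le> (1/2) ^ n"
        using p2.fine_partitions[OF A] by metis
      have Df: "D \<in> p2.fin" if "D \<in> \<D> n" for n D
        using p2.fin_subset[OF A D(4)[OF that]] D(3)[of n] that by blast
      have "AE w in \<Omega>2. eventually (\<lambda>n. p2.occupied (\<D> n) (\<lambda>D. D) w = P2 A w) sequentially"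
        using p2.AE_occupied_eq[OF A, of \<D> "\<lambda>_ D. D"] D by auto
      note 2 = distr_AE_iff[OF f this]
      \<comment> \<open>The preimages of the pieces partition \<open>pre A\<close> with the same
        measures, so one sequence of partitions computes both sides, and the counts agree once the
        void events do.\<close>
      have 1: "AE w in \<Omega>1. eventually (\<lambda>n. p1.occupied (\<D> n) pre w = P1 (pre A) w) sequentially"
      proof (rule p1.AE_occupied_eq[OF pref[OF A]])
        show "disjoint_family_on pre (\<D> n)" for n
          using D(2)[of n] unfolding disjoint_family_on_def pre_def by blast
        show "(\<Union>D\<in>\<D> n. pre D) = pre A" for n using D(3)[of n] unfolding pre_def by auto
      qed (use D pre mm in auto)
      have "AE w in \<Omega>1. \<forall>n. \<forall>D\<in>\<D> n. P2 D (f w) = 0 \<longleftrightarrow> P1 (pre D) w = 0"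
        unfolding AE_all_countable using void Df D(1) by (auto intro!: AE_finite_allI)
      then show ?thesis using 1 2
      proof eventually_elim
        case (elim w)
        have eq: "p2.occupied (\<D> n) (\<lambda>D. D) (f w) = p1.occupied (\<D> n) pre w" for n
          unfolding p1.occupied_def p2.occupied_def using elim(1) by (intro sum.cong) auto
        have "eventually (\<lambda>n::nat. P2 A (f w) = P1 (pre A) w) sequentially"
          using elim(2,3) by eventually_elim (simp add: eq)
        then show ?case unfolding pre_def by simp
      qed
    qed
  qed
qed

text \<open>Along \<open>h \<circ> f\<close> the process takes at \<open>A\<close> the value at the
  preimage of \<open>A\<close> under \<open>\<psi> \<circ> \<phi>\<close>, which is \<open>A\<close>
  up to a null set; the uniqueness principle then gives the identity.\<close>

lemma lift_left_inverse:
  fixes M1 :: "'a1 measure" and \<Omega>1 :: "'w1 measure" and M2 :: "'a2 measure" and \<Omega>2 :: "'w2 measure"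
  assumes 1: "generative_ppp M1 \<Omega>1 P1"
    and \<phi>: "\<phi> \<in> measurable M1 M2" and \<psi>: "\<psi> \<in> measurable M2 M1" "AE x in M1. \<psi> (\<phi> x) = x"
    and f: "f \<in> measurable \<Omega>1 \<Omega>2" "distr \<Omega>1 \<Omega>2 f = \<Omega>2"
      "\<And>A. A \<in> sets M2 \<Longrightarrow> AE w in \<Omega>1. P2 A (f w) = P1 (\<phi> -` A \<inter> space M1) w"
    and h: "h \<in> measurable \<Omega>2 \<Omega>1" "distr \<Omega>2 \<Omega>1 h = \<Omega>1"
      "\<And>A. A \<in> sets M1 \<Longrightarrow> AE w in \<Omega>2. P1 A (h w) = P2 (\<psi> -` A \<inter> space M2) w"
  shows "AE w in \<Omega>1. h (f w) = w"
proof -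
  interpret ppp M1 \<Omega>1 P1 using 1 by unfold_locales (auto simp: generative_ppp_def)
  show ?thesis
  proof (rule AE_eq_if_AE_P_eq)
    show "generative M1 \<Omega>1 P1" using 1 by (simp add: generative_ppp_def)
    show "(\<lambda>w. h (f w)) \<in> measurable \<Omega>1 \<Omega>1" using f(1) h(1) by measurable
    have "distr \<Omega>1 \<Omega>1 (h \<circ> f) = distr (distr \<Omega>1 \<Omega>2 f) \<Omega>1 h" using f(1) h(1) by (rule distr_distr[symmetric, rotated])
    then show "distr \<Omega>1 \<Omega>1 (\<lambda>w. h (f w)) = \<Omega>1" by (simp add: f(2) h(2) o_def)
    fix A assume A: "A \<in> sets M1"
    let ?B = "\<psi> -` A \<inter> space M2"
    have B: "?B \<in> sets M2" by (rule measurable_sets[OF \<psi>(1) A])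
    have "\<phi> -` ?B \<inter> space M1 \<in> sets M1" by (rule measurable_sets[OF \<phi> B])
    then have "AE w in \<Omega>1. P1 (\<phi> -` ?B \<inter> space M1) w = P1 A w"
    proof (rule AE_P_eq_of_AE[OF _ A])
      show "AE x in M1. x \<in> \<phi> -` ?B \<inter> space M1 \<longleftrightarrow> x \<in> A"
        using \<psi>(2) AE_space by eventually_elim (use \<phi> in \<open>auto dest: measurable_space\<close>)
    qed
    then show "AE w in \<Omega>1. P1 A (h (f w)) = P1 A w"
      using distr_AE_iff[OF f(1,2) h(3)[OF A]] f(3)[OF B] by eventually_elim simp
  qed (auto simp: distr_id2)
qed

lemma lift_iso:
  fixes M1 :: "'a1 measure" and \<Omega>1 :: "'w1 measure" and M2 :: "'a2 measure" and \<Omega>2 :: "'w2 measure"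
  assumes "generative_ppp M1 \<Omega>1 P1" "generative_ppp M2 \<Omega>2 P2" and \<phi>: "\<phi> \<in> mp_iso M1 M2"
  obtains f where "f \<in> mp_iso \<Omega>1 \<Omega>2"
    "\<And>A. A \<in> sets M2 \<Longrightarrow> AE w in \<Omega>1. P2 A (f w) = P1 (\<phi> -` A \<inter> space M1) w"
proof -
  have g1: "generative M1 \<Omega>1 P1" and g2: "generative M2 \<Omega>2 P2"
    using assms unfolding generative_ppp_def by auto
  interpret p1: ppp M1 \<Omega>1 P1 using assms by unfold_locales (auto simp: generative_ppp_def)
  interpret p2: ppp M2 \<Omega>2 P2 using assms by unfold_locales (auto simp: generative_ppp_def)
  note \<phi>m = mp_isoD[OF \<phi>]
  obtain \<psi> where \<psi>: "\<psi> \<in> measurable M2 M1" "distr M2 M1 \<psi> = M1"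
    "AE x in M1. \<psi> (\<phi> x) = x" "AE y in M2. \<phi> (\<psi> y) = y"
    using mp_iso_inverse[OF \<phi> p1.space_base_nonempty] by metis
  obtain f where f: "f \<in> measurable \<Omega>1 \<Omega>2" "distr \<Omega>1 \<Omega>2 f = \<Omega>2"
    "\<And>A. A \<in> sets M2 \<Longrightarrow> AE w in \<Omega>1. P2 A (f w) = P1 (\<phi> -` A \<inter> space M1) w"
    using lift_map[OF p1.ppp_axioms p2.ppp_axioms g2 \<phi>m] by metis
  obtain h where h: "h \<in> measurable \<Omega>2 \<Omega>1" "distr \<Omega>2 \<Omega>1 h = \<Omega>1"
    "\<And>A. A \<in> sets M1 \<Longrightarrow> AE w in \<Omega>2. P1 A (h w) = P2 (\<psi> -` A \<inter> space M2) w"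
    using lift_map[OF p2.ppp_axioms p1.ppp_axioms g1 \<psi>(1,2)] by metis
  have hf: "AE w in \<Omega>1. h (f w) = w"
    by (rule lift_left_inverse[OF assms(1) \<phi>m(1) \<psi>(1,3) f h])
  have fh: "AE w in \<Omega>2. f (h w) = w"
    by (rule lift_left_inverse[OF assms(2) \<psi>(1) \<phi>m(1) \<psi>(4) h f])
  have "f \<in> mp_iso \<Omega>1 \<Omega>2"
    by (rule mp_isoI[OF p1.standard_borel_prob p2.standard_borel_prob f(1) h(1) f(2) hf fh])
  with f(3) show ?thesis using that by blast
qed

text \<open>The lift of the base isomorphism is equivariant by uniqueness: along
  \<open>S2 g \<circ> f\<close> and along \<open>f \<circ> S1 g\<close> the process is evaluated at
  preimages under two maps that agree almost everywhere.\<close>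

lemma isomorphic_actions_lift:
  fixes S1 :: "'g::{topological_group_add, polish_space} \<Rightarrow> 'w1 \<Rightarrow> 'w1"
    and S2 :: "'g \<Rightarrow> 'w2 \<Rightarrow> 'w2"
  assumes 1: "generative_ppp M1 \<Omega>1 P1" "mp_action \<Omega>1 S1" "base_action M1 \<Omega>1 P1 S1 T1"
    and 2: "generative_ppp M2 \<Omega>2 P2" "mp_action \<Omega>2 S2" "base_action M2 \<Omega>2 P2 S2 T2"
    and iso: "isomorphic_actions M1 T1 M2 T2"
  shows "isomorphic_actions \<Omega>1 S1 \<Omega>2 S2"
proof -
  interpret p1: ppp M1 \<Omega>1 P1 using 1 by unfold_locales (auto simp: generative_ppp_def)
  interpret p2: ppp M2 \<Omega>2 P2 using 2 by unfold_locales (auto simp: generative_ppp_def)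
  obtain \<phi> where \<phi>: "\<phi> \<in> mp_iso M1 M2" "\<And>g. AE x in M1. T2 g (\<phi> x) = \<phi> (T1 g x)"
    using iso unfolding isomorphic_actions_def by auto
  note \<phi>m = mp_isoD[OF \<phi>(1)]
  obtain f where f: "f \<in> mp_iso \<Omega>1 \<Omega>2"
    "\<And>A. A \<in> sets M2 \<Longrightarrow> AE w in \<Omega>1. P2 A (f w) = P1 (\<phi> -` A \<inter> space M1) w"
    using lift_iso[OF 1(1) 2(1) \<phi>(1)] by metis
  note fm = mp_isoD[OF f(1)]
  have "AE w in \<Omega>1. S2 g (f w) = f (S1 g w)" for g
  proof (rule p2.AE_eq_if_AE_P_eq)
    show "generative M2 \<Omega>2 P2" using 2 unfolding generative_ppp_def by auto
    have S1: "S1 g \<in> measurable \<Omega>1 \<Omega>1" "distr \<Omega>1 \<Omega>1 (S1 g) = \<Omega>1"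
      and S2: "S2 g \<in> measurable \<Omega>2 \<Omega>2" "distr \<Omega>2 \<Omega>2 (S2 g) = \<Omega>2"
      and T1: "T1 g \<in> measurable M1 M1" and T2: "T2 g \<in> measurable M2 M2"
      using 1 2 unfolding mp_action_def base_action_def Aut_def mp_iso_def by auto
    show "(\<lambda>w. S2 g (f w)) \<in> measurable \<Omega>1 \<Omega>2" "(\<lambda>w. f (S1 g w)) \<in> measurable \<Omega>1 \<Omega>2"
      using fm(1) S1(1) S2(1) by measurable
    have "distr \<Omega>1 \<Omega>2 (S2 g \<circ> f) = distr (distr \<Omega>1 \<Omega>2 f) \<Omega>2 (S2 g)"
      using fm(1) S2(1) by (rule distr_distr[symmetric, rotated])
    then show "distr \<Omega>1 \<Omega>2 (\<lambda>w. S2 g (f w)) = \<Omega>2" by (simp add: fm S2 o_def)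
    have "distr \<Omega>1 \<Omega>2 (f \<circ> S1 g) = distr (distr \<Omega>1 \<Omega>1 (S1 g)) \<Omega>2 f"
      using S1(1) fm(1) by (rule distr_distr[symmetric, rotated])
    then show "distr \<Omega>1 \<Omega>2 (\<lambda>w. f (S1 g w)) = \<Omega>2" by (simp add: fm S1 o_def)
    fix A assume A: "A \<in> sets M2"
    let ?A2 = "T2 g -` A \<inter> space M2" and ?A1 = "\<phi> -` A \<inter> space M1"
    have A2: "?A2 \<in> sets M2" using A T2 by auto
    have A1: "?A1 \<in> sets M1" using A \<phi>m by auto
    have "AE w in \<Omega>2. P2 A (S2 g w) = P2 ?A2 w" using 2(3) A unfolding base_action_def by blast
    from distr_AE_iff[OF fm this] f(2)[OF A2]
    have L: "AE w in \<Omega>1. P2 A (S2 g (f w)) = P1 (\<phi> -` ?A2 \<inter> space M1) w" by eventually_elim simp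
    have "AE w in \<Omega>1. P1 ?A1 (S1 g w) = P1 (T1 g -` ?A1 \<inter> space M1) w"
      using 1(3) A1 unfolding base_action_def by blast
    with distr_AE_iff[OF S1 f(2)[OF A]]
    have R: "AE w in \<Omega>1. P2 A (f (S1 g w)) = P1 (T1 g -` ?A1 \<inter> space M1) w" by eventually_elim simp
    have "AE w in \<Omega>1. P1 (\<phi> -` ?A2 \<inter> space M1) w = P1 (T1 g -` ?A1 \<inter> space M1) w"
    proof (rule p1.AE_P_eq_of_AE)
      show "\<phi> -` ?A2 \<inter> space M1 \<in> sets M1" by (rule measurable_sets[OF \<phi>m(1) A2])
      show "T1 g -` ?A1 \<inter> space M1 \<in> sets M1" by (rule measurable_sets[OF T1 A1])
      show "AE x in M1. x \<in> \<phi> -` ?A2 \<inter> space M1 \<longleftrightarrow> x \<in> T1 g -` ?A1 \<inter> space M1"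
        using \<phi>(2)[of g] AE_space
        by eventually_elim (use measurable_space[OF \<phi>m(1)] measurable_space[OF T1] in auto)
    qed
    with L R show "AE w in \<Omega>1. P2 A (S2 g (f w)) = P2 A (f (S1 g w))" by eventually_elim simp
  qed
  with f(1) show ?thesis unfolding isomorphic_actions_def by auto
qed

section \<open>Continuity in the weak topology\<close>

abbreviation vim :: "'a measure \<Rightarrow> ('a \<Rightarrow> 'b) \<Rightarrow> 'b set \<Rightarrow> 'a set" where
  "vim M f A \<equiv> f -` A \<inter> space M"

lemma AutD:
  assumes "f \<in> Aut M"
  shows "f \<in> measurable M M" "distr M M f = M"
    "A \<in> sets M \<Longrightarrow> vim M f A \<in> sets M" "A \<in> sets M \<Longrightarrow> emeasure M (vim M f A) = emeasure M A"
  using mp_isoD[of f M M] assms emeasure_vimage_mp[of f M M A] by (auto simp: Aut_def)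

text \<open>The generating sets of the topology are centred at arbitrary automorphisms, not at the
  values \<open>T g0\<close>. The triangle inequality for the measure of the symmetric difference
  moves the centre.\<close>

lemma continuous_weak_topologyI:
  fixes T :: "'g::topological_space \<Rightarrow> 'a \<Rightarrow> 'a"
  assumes Aut: "\<And>g. T g \<in> Aut M"
    and lim: "\<And>A g0. A \<in> sets M \<Longrightarrow> emeasure M A < \<infinity> \<Longrightarrow>
      ((\<lambda>g. measure M (sym_diff (vim M (T g) A) (vim M (T g0) A))) \<longlongrightarrow> 0) (nhds g0)"
  shows "continuous_map euclidean (weak_topology M) T"
  unfolding weak_topology_def
proof (rule continuous_on_generated_topo)
  fix U assume "U \<in> {{S \<in> Aut M. emeasure M (sym_diff (S -` A \<inter> space M) (S\<^sub>0 -` A \<inter> space M)) < ennreal \<epsilon>}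
        | S\<^sub>0 A \<epsilon>. S\<^sub>0 \<in> Aut M \<and> A \<in> sets M \<and> emeasure M A < \<infinity> \<and> 0 < \<epsilon>}"
  then obtain S A e where U: "U = {R \<in> Aut M. emeasure M (sym_diff (vim M R A) (vim M S A)) < ennreal e}"
    and S: "S \<in> Aut M" and A: "A \<in> sets M" "emeasure M A < \<infinity>" and e: "0 < e" by blast
  have fm: "vim M R A \<in> fmeasurable M" if "R \<in> Aut M" for R
    using AutD[OF that] A by (simp add: fmeasurable_def)
  have sf: "sym_diff (vim M R A) (vim M R' A) \<in> fmeasurable M" if "R \<in> Aut M" "R' \<in> Aut M" for R R'
    using fm[OF that(1)] fm[OF that(2)] by (intro fmeasurable.Un fmeasurable.Diff)
  have "open {g. T g \<in> U}"
  proof (subst open_subopen, intro ballI)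
    fix g0 assume "g0 \<in> {g. T g \<in> U}"
    then have g0: "measure M (sym_diff (vim M (T g0) A) (vim M S A)) < e"
      using sf[OF Aut[of g0] S] e by (simp add: U emeasure_eq_measure2 ennreal_less_iff)
    have "eventually (\<lambda>g. measure M (sym_diff (vim M (T g) A) (vim M (T g0) A))
        < e - measure M (sym_diff (vim M (T g0) A) (vim M S A))) (nhds g0)"
      using g0 by (intro order_tendstoD(2)[OF lim[OF A]]) simp
    then have "eventually (\<lambda>g. T g \<in> U) (nhds g0)"
    proof eventually_elim
      case (elim g)
      have "measure M (sym_diff (vim M (T g) A) (vim M S A))
          \<le> measure M (sym_diff (vim M (T g) A) (vim M (T g0) A) \<union> sym_diff (vim M (T g0) A) (vim M S A))"
        using sf[OF Aut Aut, of g g0] sf[OF Aut S, of g0] sf[OF Aut S, of g]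
        by (intro measure_mono_fmeasurable) auto
      also have "\<dots> \<le> measure M (sym_diff (vim M (T g) A) (vim M (T g0) A)) + measure M (sym_diff (vim M (T g0) A) (vim M S A))"
        using sf[OF Aut Aut, of g g0] sf[OF Aut S, of g0] by (intro measure_Un_le) auto
      also have "\<dots> < e" using elim by simp
      finally show ?case
        using sf[OF Aut S, of g] Aut e by (simp add: U emeasure_eq_measure2 ennreal_less_iff)
    qed
    then show "\<exists>V. open V \<and> g0 \<in> V \<and> V \<subseteq> {g. T g \<in> U}"
      unfolding eventually_nhds by auto
  qed
  then show "openin euclidean (T -` U \<inter> topspace euclidean)" by (simp add: vimage_def)
next
  \<comment> \<open>For the empty set the generating set is all of \<open>Aut M\<close>, so the
    generators cover the range of \<open>T\<close>.\<close>
  have "T g \<in> {S \<in> Aut M. emeasure M (sym_diff (vim M S {}) (vim M (T g) {})) < ennreal 1}" for g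
    using Aut by simp
  then show "T ` topspace euclidean \<subseteq> \<Union>{{S \<in> Aut M. emeasure M (sym_diff (S -` A \<inter> space M) (S\<^sub>0 -` A \<inter> space M)) < ennreal \<epsilon>}
        | S\<^sub>0 A \<epsilon>. S\<^sub>0 \<in> Aut M \<and> A \<in> sets M \<and> emeasure M A < \<infinity> \<and> 0 < \<epsilon>}"
    using Aut by (fastforce intro!: exI[of _ "{}"] exI[of _ "1::real"])
qed

lemma continuous_weak_topologyD:
  fixes T :: "'g::topological_space \<Rightarrow> 'a \<Rightarrow> 'a"
  assumes Aut: "\<And>g. T g \<in> Aut M" and cont: "continuous_map euclidean (weak_topology M) T"
    and A: "A \<in> sets M" "emeasure M A < \<infinity>"
  shows "((\<lambda>g. measure M (sym_diff (vim M (T g) A) (vim M (T g0) A))) \<longlongrightarrow> 0) (nhds g0)"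
proof (rule tendstoI)
  fix e :: real assume e: "0 < e"
  have fm: "vim M (T g) A \<in> fmeasurable M" for g
    using AutD[OF Aut] A by (simp add: fmeasurable_def)
  have sf: "sym_diff (vim M (T g) A) (vim M (T g0) A) \<in> fmeasurable M" for g
    using fm by (intro fmeasurable.Un fmeasurable.Diff) auto
  define U where "U = {S \<in> Aut M. emeasure M (sym_diff (vim M S A) (vim M (T g0) A)) < ennreal e}"
  have "openin (weak_topology M) U"
    unfolding weak_topology_def U_def
    by (rule topology_generated_by_Basis) (use Aut A e in blast)
  from openin_continuous_map_preimage[OF cont this] have "open {g. T g \<in> U}" by simp
  moreover have "g0 \<in> {g. T g \<in> U}" using Aut e by (simp add: U_def)
  ultimately have "eventually (\<lambda>g. T g \<in> U) (nhds g0)" unfolding eventually_nhds by auto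
  then show "eventually (\<lambda>g. dist (measure M (sym_diff (vim M (T g) A) (vim M (T g0) A))) 0 < e) (nhds g0)"
    by eventually_elim (use sf e in \<open>simp add: U_def emeasure_eq_measure2 ennreal_less_iff\<close>)
qed

lemma measure_vim:
  assumes "f \<in> measurable N N" "distr N N f = N" "A \<in> sets N"
  shows "measure N (vim N f A) = measure N A"
  using emeasure_vimage_mp[OF assms] by (simp add: measure_def)

text \<open>Complements leave the symmetric difference of preimages unchanged. In a countable union
  the tail beyond \<open>N\<close> has small probability, and since all \<open>S g\<close> preserve
  the measure its preimages are small uniformly in \<open>g\<close>; finitely many terms
  remain.\<close>

lemma (in prob_space) tendsto_sym_diff_sigma_sets:
  assumes S: "\<And>g. S g \<in> measurable M M" "\<And>g. distr M M (S g) = M" and E: "E \<subseteq> events"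
    and lim: "\<And>F. F \<in> E \<Longrightarrow> ((\<lambda>g. prob (sym_diff (vim M (S g) F) (vim M (S g0) F))) \<longlongrightarrow> 0) net"
    and F: "F \<in> sigma_sets (space M) E"
  shows "((\<lambda>g. prob (sym_diff (vim M (S g) F) (vim M (S g0) F))) \<longlongrightarrow> 0) net"
  using F
proof induction
  case (Basic F)
  then show ?case by (rule lim)
next
  case Empty
  then show ?case by simp
next
  case (Compl F)
  have "sym_diff (vim M (S g) (space M - F)) (vim M (S g0) (space M - F)) = sym_diff (vim M (S g) F) (vim M (S g0) F)" for g
    using measurable_space[OF S(1)] by auto
  then show ?case using Compl.IH by simp
next
  case (Union F)
  have F: "F n \<in> events" for n using Union.hyps sets.sigma_sets_subset[OF E] by blast
  define R where "R N = (\<Union>n. F n) - (\<Union>n<N. F n)" for N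
  have R: "R N \<in> events" for N unfolding R_def using F by auto
  have vm: "vim M (S g) A \<in> events" if "A \<in> events" for g A using S(1) that by auto
  show ?case
  proof (rule tendstoI)
    fix e :: real assume e: "0 < e"
    have "(\<lambda>N. prob (R N)) \<longlonglongrightarrow> prob (\<Inter>N. R N)"
      by (rule finite_Lim_measure_decseq) (use R in \<open>auto simp: R_def decseq_def\<close>)
    moreover have "(\<Inter>N. R N) = {}" unfolding R_def by auto
    ultimately have "(\<lambda>N. prob (R N)) \<longlonglongrightarrow> 0" by simp
    then have "eventually (\<lambda>N. prob (R N) < e/4) sequentially" using e by (intro order_tendstoD) auto
    \<comment> \<open>The tail is counted twice, through \<open>S g\<close> and through
      \<open>S g0\<close>, which leaves \<open>e/2\<close> for the finite sum.\<close>
    then obtain N where N: "prob (R N) < e/4" by (auto simp: eventually_sequentially)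
    have "((\<lambda>g. \<Sum>n<N. prob (sym_diff (vim M (S g) (F n)) (vim M (S g0) (F n)))) \<longlongrightarrow> (\<Sum>n<N. 0)) net"
      by (intro tendsto_sum Union.IH)
    then have "eventually (\<lambda>g. (\<Sum>n<N. prob (sym_diff (vim M (S g) (F n)) (vim M (S g0) (F n)))) < e/2) net"
      using e by (intro order_tendstoD) auto
    then show "eventually (\<lambda>g. dist (prob (sym_diff (vim M (S g) (\<Union>n. F n)) (vim M (S g0) (\<Union>n. F n)))) 0 < e) net"
    proof eventually_elim
      case (elim g)
      let ?D = "\<lambda>n. sym_diff (vim M (S g) (F n)) (vim M (S g0) (F n))"
      have D: "?D n \<in> events" for n using vm[OF F] by auto
      have "prob (sym_diff (vim M (S g) (\<Union>n. F n)) (vim M (S g0) (\<Union>n. F n)))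
          \<le> prob ((\<Union>n<N. ?D n) \<union> (vim M (S g) (R N) \<union> vim M (S g0) (R N)))"
      proof (rule finite_measure_mono)
        show "sym_diff (vim M (S g) (\<Union>n. F n)) (vim M (S g0) (\<Union>n. F n))
            \<subseteq> (\<Union>n<N. ?D n) \<union> (vim M (S g) (R N) \<union> vim M (S g0) (R N))"
        proof
          fix x assume "x \<in> sym_diff (vim M (S g) (\<Union>n. F n)) (vim M (S g0) (\<Union>n. F n))"
          then have x: "x \<in> space M" "S g x \<in> (\<Union>n. F n) \<longleftrightarrow> S g0 x \<notin> (\<Union>n. F n)" by auto
          show "x \<in> (\<Union>n<N. ?D n) \<union> (vim M (S g) (R N) \<union> vim M (S g0) (R N))"
          proof (cases "\<exists>n<N. x \<in> ?D n")
            case True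
            then show ?thesis by blast
          next
            case False
            then have "\<forall>n<N. S g x \<in> F n \<longleftrightarrow> S g0 x \<in> F n" using x(1) by auto
            then have "S g x \<in> R N \<or> S g0 x \<in> R N" using x(2) unfolding R_def by (cases "S g x \<in> (\<Union>n. F n)") auto
            then show ?thesis using x(1) by auto
          qed
        qed
        show "(\<Union>n<N. ?D n) \<union> (vim M (S g) (R N) \<union> vim M (S g0) (R N)) \<in> events"
          using vm[OF F] vm[OF R] by (intro sets.Un sets.finite_UN) auto
      qed
      also have "\<dots> \<le> prob (\<Union>n<N. ?D n) + prob (vim M (S g) (R N) \<union> vim M (S g0) (R N))"
        by (rule measure_Un_le) (use vm[OF F] vm[OF R] in auto)
      also have "\<dots> \<le> prob (\<Union>n<N. ?D n) + (prob (vim M (S g) (R N)) + prob (vim M (S g0) (R N)))"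
        by (rule add_left_mono, rule measure_Un_le) (rule vm[OF R])+
      also have "prob (\<Union>n<N. ?D n) \<le> (\<Sum>n<N. prob (?D n))"
        by (rule finite_measure_subadditive_finite) (use vm[OF F] in auto)
      finally show ?case using elim N measure_vim[OF S R] by simp
    qed
  qed
qed

context ppp
begin

text \<open>Sets of equal measure have differences of equal measure, so the union has the measure of
  \<open>B\<close> plus half that of the symmetric difference. Inserted into inclusion-exclusion
  this gives a formula that can be solved for the measure of the symmetric difference.\<close>

lemma prob_sym_diff_void:
  assumes A: "A \<in> fin" and B: "B \<in> fin" and eq: "measure M A = measure M B"
  shows "prob (sym_diff {w \<in> space \<Omega>. P A w = 0} {w \<in> space \<Omega>. P B w = 0})
    = 2 * exp (- measure M B) * (1 - exp (- measure M (sym_diff A B) / 2))"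
proof -
  let ?v = "\<lambda>A. {w \<in> space \<Omega>. P A w = 0}"
  have [measurable]: "A \<in> sets M" "B \<in> sets M" using A B by auto
  have U: "A \<union> B \<in> fin" using A B by simp
  have int: "prob (?v A \<inter> ?v B) = exp (- measure M (A \<union> B))"
  proof -
    have "?v A \<inter> ?v B = {w \<in> space \<Omega>. \<forall>A\<in>{A, B}. P A w = 0}" by auto
    then show ?thesis using prob_all_void[of "{A, B}"] A B by simp
  qed
  have "prob (sym_diff (?v A) (?v B)) = prob (?v A - ?v B) + prob (?v B - ?v A)"
    by (rule finite_measure_Union) auto
  also have "prob (?v A - ?v B) = prob (?v A) - prob (?v A \<inter> ?v B)"
    by (rule finite_measure_Diff') auto
  also have "prob (?v B - ?v A) = prob (?v B) - prob (?v B \<inter> ?v A)"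
    by (rule finite_measure_Diff') auto
  finally have 1: "prob (sym_diff (?v A) (?v B)) = 2 * exp (- measure M B) - 2 * exp (- measure M (A \<union> B))"
    using prob_void[OF A] prob_void[OF B] eq int by (simp add: Int_commute)
  note fA = fmeasurable_fin[OF A] and fB = fmeasurable_fin[OF B]
  have "measure M (A \<union> B) = measure M A + measure M (B - A)"
    "measure M (B \<union> A) = measure M B + measure M (A - B)"
    using fA fB by (auto simp: measure_Un2)
  moreover have "measure M (sym_diff A B) = measure M (A - B) + measure M (B - A)"
    using fA fB A B by (intro measure_Union) (auto simp: less_top[symmetric] dest: emeasure_fin_less_top[OF fin_Diff])
  ultimately have 2: "measure M (A \<union> B) = measure M B + measure M (sym_diff A B) / 2"
    using eq by (simp add: Un_commute)
  have "exp (- measure M (A \<union> B)) = exp (- measure M B) * exp (- measure M (sym_diff A B) / 2)"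
    unfolding 2 by (simp add: exp_add[symmetric])
  then show ?thesis unfolding 1 by (simp add: algebra_simps)
qed

end

section \<open>The Poissonian action over a base action\<close>

text \<open>\<open>T 0\<close> is idempotent and has a left inverse, both almost everywhere.\<close>

lemma mp_action_zero:
  assumes T: "mp_action M T" and ne: "space M \<noteq> {}"
  shows "AE x in M. T 0 x = x"
proof -
  have T0: "T 0 \<in> mp_iso M M" using T unfolding mp_action_def Aut_def by auto
  obtain h where h: "AE x in M. h (T 0 x) = x" using mp_iso_inverse[OF T0 ne] by metis
  have "AE x in M. T (0 + 0) x = T 0 (T 0 x)" using T unfolding mp_action_def by blast
  then show ?thesis using h distr_AE_iff[OF mp_isoD[OF T0] h] by eventually_elim simp
qed

lemma (in prob_space) prob_sym_diff_cong:
  assumes "A \<in> events" "B \<in> events" "A' \<in> events" "B' \<in> events"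
    and "AE w in M. w \<in> A \<longleftrightarrow> w \<in> A'" "AE w in M. w \<in> B \<longleftrightarrow> w \<in> B'"
  shows "prob (sym_diff A B) = prob (sym_diff A' B')"
proof (rule measure_eq_AE)
  show "AE w in M. w \<in> sym_diff A B \<longleftrightarrow> w \<in> sym_diff A' B'" using assms(5,6) by eventually_elim auto
qed (use assms in auto)

section \<open>The first chaos and its behaviour under composition\<close>

context ppp
begin

lemma poisson_H_gen_eq: "{(\<lambda>\<omega>. enn2real (P A \<omega>)) | A. A \<in> sets M \<and> emeasure M A < \<infinity>} = p ` fin"
  unfolding p_def[abs_def] fin_def image_def by blast

text \<open>The closed span is indexed by functions, and different sets may give the same function
  \<open>p A\<close>; choosing one set for each function turns the sum into one over sets.\<close>

lemma poisson_HE: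
  assumes "f \<in> poisson_H M \<Omega> P" "0 < e"
  obtains I c where "finite I" "I \<subseteq> fin" "L2_norm \<Omega> (\<lambda>w. f w - (\<Sum>A\<in>I. c A * p A w)) < e"
proof -
  obtain I c where I: "finite I" "I \<subseteq> p ` fin" "L2_norm \<Omega> (\<lambda>w. f w - (\<Sum>h\<in>I. c h * h w)) < e"
    using assms unfolding poisson_H_def L2_closed_span_def poisson_H_gen_eq by blast
  obtain J where J: "J \<subseteq> fin" "inj_on p J" "I = p ` J" using subset_image_inj[of I p fin] I(2) by auto
  have "finite J" using I(1) J(2,3) finite_imageD by blast
  moreover have "(\<Sum>h\<in>I. c h * h w) = (\<Sum>A\<in>J. c (p A) * p A w)" for w
    unfolding J(3) using J(2) by (simp add: sum.reindex)
  ultimately show ?thesis using that[of J "\<lambda>A. c (p A)"] I(3) J(1) by simp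
qed

lemma poisson_HI:
  assumes f: "f \<in> L2_functions \<Omega>"
    and "\<And>e. 0 < e \<Longrightarrow> \<exists>I A c. finite (I :: 'a set set) \<and> A ` I \<subseteq> fin \<and>
      L2_norm \<Omega> (\<lambda>w. f w - (\<Sum>i\<in>I. c i * p (A i) w)) < e"
  shows "f \<in> poisson_H M \<Omega> P"
  unfolding poisson_H_def L2_closed_span_def poisson_H_gen_eq
proof (intro CollectI conjI f allI impI)
  fix e :: real assume "0 < e"
  from assms(2)[OF this] obtain I A c where I: "finite (I :: 'a set set)" "A ` I \<subseteq> fin"
    "L2_norm \<Omega> (\<lambda>w. f w - (\<Sum>i\<in>I. c i * p (A i) w)) < e"
    by (elim exE conjE)
  \<comment> \<open>The reverse passage: coefficients of indices with the same function are added
    up.\<close>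
  define d where "d h = (\<Sum>i | i \<in> I \<and> p (A i) = h. c i)" for h
  have "(\<Sum>i\<in>I. c i * p (A i) w) = (\<Sum>h\<in>(\<lambda>i. p (A i)) ` I. d h * h w)" for w
  proof -
    have "(\<Sum>i\<in>I. c i * p (A i) w) = (\<Sum>h\<in>(\<lambda>i. p (A i)) ` I. \<Sum>i | i \<in> I \<and> p (A i) = h. c i * p (A i) w)"
      by (rule sum.image_gen[OF I(1)])
    also have "\<dots> = (\<Sum>h\<in>(\<lambda>i. p (A i)) ` I. d h * h w)"
    proof (rule sum.cong[OF refl])
      fix h show "(\<Sum>i | i \<in> I \<and> p (A i) = h. c i * p (A i) w) = d h * h w"
        unfolding d_def sum_distrib_right by (rule sum.cong[OF refl]) simp
    qed
    finally show ?thesis .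
  qed
  then have "L2_norm \<Omega> (\<lambda>w. f w - (\<Sum>h\<in>(\<lambda>i. p (A i)) ` I. d h * h w)) < e" using I(3) by simp
  moreover have "(\<lambda>i. p (A i)) ` I \<subseteq> p ` fin" using I(2) by blast
  ultimately show "\<exists>I c. finite I \<and> I \<subseteq> p ` fin \<and> L2_norm \<Omega> (\<lambda>w. f w - (\<Sum>h\<in>I. c h * h w)) < e"
    using I(1) by blast
qed

text \<open>Composition with a measure preserving map keeps the L2 distance, so it is enough that
  generators go to generators.\<close>

lemma poisson_H_comp:
  assumes s: "s \<in> measurable \<Omega> \<Omega>" "distr \<Omega> \<Omega> s = \<Omega>"
    and P: "\<And>A. A \<in> fin \<Longrightarrow> \<exists>B\<in>fin. AE w in \<Omega>. P A (s w) = P B w"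
    and f: "f \<in> poisson_H M \<Omega> P"
  shows "f \<circ> s \<in> poisson_H M \<Omega> P"
proof (rule poisson_HI)
  have fL: "f \<in> borel_measurable \<Omega>" "integrable \<Omega> (\<lambda>w. (f w)\<^sup>2)"
    using f unfolding poisson_H_def L2_closed_span_def L2_functions_def by auto
  have "integrable (distr \<Omega> \<Omega> s) (\<lambda>w. (f w)\<^sup>2)" using fL(2) s(2) by simp
  then have "integrable \<Omega> (\<lambda>w. (f (s w))\<^sup>2)" by (rule integrable_distr[OF s(1)])
  then show "f \<circ> s \<in> L2_functions \<Omega>"
    using fL(1) s(1) unfolding L2_functions_def by (auto simp: o_def intro: measurable_compose)
  fix e :: real assume "0 < e"
  then obtain I c where I: "finite I" "I \<subseteq> fin" "L2_norm \<Omega> (\<lambda>w. f w - (\<Sum>A\<in>I. c A * p A w)) < e"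
    using poisson_HE[OF f] by metis
  have "\<forall>A\<in>fin. \<exists>B. B \<in> fin \<and> (AE w in \<Omega>. P A (s w) = P B w)" using P by blast
  from bchoice[OF this] obtain B where B: "\<And>A. A \<in> fin \<Longrightarrow> B A \<in> fin" "\<And>A. A \<in> fin \<Longrightarrow> AE w in \<Omega>. P A (s w) = P (B A) w"
    by blast
  have [measurable]: "p A \<in> borel_measurable \<Omega>" "p (B A) \<in> borel_measurable \<Omega>" if "A \<in> I" for A using that I(2) B(1) by auto
  note [measurable] = fL(1) s(1)
  have "(\<integral>w. (f w - (\<Sum>A\<in>I. c A * p A w))\<^sup>2 \<partial>\<Omega>) = (\<integral>w. (f w - (\<Sum>A\<in>I. c A * p A w))\<^sup>2 \<partial>distr \<Omega> \<Omega> s)"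
    by (simp add: s(2))
  also have "\<dots> = (\<integral>w. (f (s w) - (\<Sum>A\<in>I. c A * p A (s w)))\<^sup>2 \<partial>\<Omega>)"
    by (rule integral_distr) measurable
  also have "\<dots> = (\<integral>w. ((f \<circ> s) w - (\<Sum>A\<in>I. c A * p (B A) w))\<^sup>2 \<partial>\<Omega>)"
  proof (rule integral_cong_AE)
    have "AE w in \<Omega>. \<forall>A\<in>I. P A (s w) = P (B A) w"
      using I(1,2) B(2) by (intro AE_finite_allI) auto
    then show "AE w in \<Omega>. (f (s w) - (\<Sum>A\<in>I. c A * p A (s w)))\<^sup>2 = ((f \<circ> s) w - (\<Sum>A\<in>I. c A * p (B A) w))\<^sup>2"
      by eventually_elim (auto simp: p_def intro!: sum.cong)
  qed measurable
  finally have "L2_norm \<Omega> (\<lambda>w. (f \<circ> s) w - (\<Sum>A\<in>I. c A * p (B A) w)) < e"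
    using I(3) unfolding L2_norm_def by simp
  then show "\<exists>I A c. finite (I :: 'a set set) \<and> A ` I \<subseteq> fin \<and> L2_norm \<Omega> (\<lambda>w. (f \<circ> s) w - (\<Sum>i\<in>I. c i * p (A i) w)) < e"
    using I(1,2) B(1) by (intro exI[of _ I] exI[of _ B] exI[of _ c]) auto
qed

lemma fin_vim: assumes "f \<in> Aut M" "A \<in> fin" shows "vim M f A \<in> fin"
  using AutD(3,4)[OF assms(1)] assms(2) by (intro finI) (auto simp del: vimage_Int)

lemma measure_vim_Aut: assumes "f \<in> Aut M" "A \<in> sets M" shows "measure M (vim M f A) = measure M A"
  using AutD(4)[OF assms] by (simp add: measure_def)

end

lemma base_action_lift:
  fixes T :: "'g::{topological_group_add, polish_space} \<Rightarrow> 'a \<Rightarrow> 'a"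
  assumes g: "generative_ppp M \<Omega> P" and T: "mp_action M T"
  shows "\<exists>S. poissonian_action M \<Omega> P S \<and> base_action M \<Omega> P S T"
proof -
  have gen: "generative M \<Omega> P" using g by (auto simp: generative_ppp_def)
  interpret ppp M \<Omega> P using g by unfold_locales (auto simp: generative_ppp_def)
  have TA: "T g \<in> Aut M" for g using T unfolding mp_action_def by auto
  have "\<exists>f. f \<in> mp_iso \<Omega> \<Omega> \<and> (\<forall>A\<in>sets M. AE w in \<Omega>. P A (f w) = P (vim M (T g) A) w)" for g
    using lift_iso[OF g g TA[of g, unfolded Aut_def]] by metis
  then obtain S where S: "\<And>g. S g \<in> mp_iso \<Omega> \<Omega>"
    and PS: "\<And>g A. A \<in> sets M \<Longrightarrow> AE w in \<Omega>. P A (S g w) = P (vim M (T g) A) w"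
    by metis
  note Sm = mp_isoD[OF S]
  have SA: "S g \<in> Aut \<Omega>" for g using S unfolding Aut_def .
  \<comment> \<open>The lifts were chosen for each \<open>g\<close> separately. They fit together
    because \<open>S (g + h)\<close> and \<open>S g \<circ> S h\<close> act on the process in the
    same way.\<close>
  have hom: "AE w in \<Omega>. S (g + h) w = S g (S h w)" for g h
  proof (rule AE_eq_if_AE_P_eq[OF gen Sm])
    show "(\<lambda>w. S g (S h w)) \<in> measurable \<Omega> \<Omega>" using Sm(1) by measurable
    have "distr \<Omega> \<Omega> (S g \<circ> S h) = distr (distr \<Omega> \<Omega> (S h)) \<Omega> (S g)"
      using Sm(1) Sm(1) by (rule distr_distr[symmetric])
    then show "distr \<Omega> \<Omega> (\<lambda>w. S g (S h w)) = \<Omega>" by (simp add: Sm o_def)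
    fix A assume A: "A \<in> sets M"
    have A1: "vim M (T g) A \<in> sets M" by (rule AutD(3)[OF TA A])
    have "AE w in \<Omega>. P (vim M (T (g + h)) A) w = P (vim M (T h) (vim M (T g) A)) w"
    proof (rule AE_P_eq_of_AE[OF AutD(3)[OF TA A] AutD(3)[OF TA A1]])
      have "AE x in M. T (g + h) x = T g (T h x)" using T unfolding mp_action_def by blast
      then show "AE x in M. x \<in> vim M (T (g + h)) A \<longleftrightarrow> x \<in> vim M (T h) (vim M (T g) A)"
        using AE_space by eventually_elim (use measurable_space[OF AutD(1)[OF TA[of h]]] in auto)
    qed
    with PS[OF A, of "g + h"] PS[OF A1, of h] distr_AE_iff[OF Sm PS[OF A, of g], of h]
    show "AE w in \<Omega>. P A (S (g + h) w) = P A (S g (S h w))" by eventually_elim simp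
  qed
  have cont: "continuous_map euclidean (weak_topology \<Omega>) S"
  proof (rule continuous_weak_topologyI[OF SA])
    fix F g0 assume F: "F \<in> sets \<Omega>"
    obtain B where B: "B \<in> sets (void_space fin)" "AE w in \<Omega>. w \<in> F \<longleftrightarrow> void w \<in> B"
      using generative_void[OF gen F] by auto
    \<comment> \<open>Up to null sets, events are generated by finite intersections of void events,
      and each of these is almost surely the void event of a single set, the union \<open>C\<close>.
      For such an event \<open>prob_sym_diff_void\<close> reduces continuity to that of
      \<open>T\<close> at \<open>C\<close>.\<close>
    let ?E = "{vim \<Omega> void C | C. C \<in> {{z. J \<subseteq> z} | J. finite J \<and> J \<subseteq> fin}}"
    have "vim \<Omega> void B \<in> {vim \<Omega> void C | C. C \<in> sigma_sets UNIV {{z. J \<subseteq> z} | J. finite J \<and> J \<subseteq> fin}}"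
      using B(1) unfolding sets_void_space by blast
    also have "\<dots> = sigma_sets (space \<Omega>) ?E" by (rule sigma_sets_vimage_commute) auto
    finally have BE: "vim \<Omega> void B \<in> sigma_sets (space \<Omega>) ?E" .
    have E: "?E \<subseteq> events"
    proof
      fix X assume "X \<in> ?E"
      then obtain C where C: "X = vim \<Omega> void C" "C \<in> {{z. J \<subseteq> z} | J. finite J \<and> J \<subseteq> fin}" by blast
      have "C \<in> sets (void_space fin)" using C(2) unfolding sets_void_space by (rule sigma_sets.Basic)
      then show "X \<in> events" unfolding C(1) by (rule measurable_sets[OF measurable_void])
    qed
    have lim: "((\<lambda>g. prob (sym_diff (vim \<Omega> (S g) X) (vim \<Omega> (S g0) X))) \<longlongrightarrow> 0) (nhds g0)" if X: "X \<in> ?E" for X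
    proof -
      obtain J where J: "finite J" "J \<subseteq> fin" "X = vim \<Omega> void {z. J \<subseteq> z}" using X by auto
      define C where "C = \<Union>J"
      have C: "C \<in> fin" unfolding C_def using fin_UN[of J "\<lambda>A. A"] J by auto
      have "AE w in \<Omega>. P (\<Union>J) w = 0 \<longleftrightarrow> (\<forall>A\<in>J. P A w = 0)"
        by (rule AE_void_UN_iff) (use J in auto)
      then have XC: "AE w in \<Omega>. w \<in> X \<longleftrightarrow> P C w = 0"
        using AE_space by eventually_elim (use J in \<open>auto simp: C_def void_def\<close>)
      have Sv: "AE w in \<Omega>. w \<in> vim \<Omega> (S g) X \<longleftrightarrow> w \<in> {w \<in> space \<Omega>. P (vim M (T g) C) w = 0}" for g
        using distr_AE_iff[OF Sm XC, of g] PS[OF finD(1)[OF C], of g] AE_space by eventually_elim auto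
      note Cf = fin_vim[OF TA C]
      have "prob (sym_diff (vim \<Omega> (S g) X) (vim \<Omega> (S g0) X))
          = 2 * exp (- measure M C) * (1 - exp (- measure M (sym_diff (vim M (T g) C) (vim M (T g0) C)) / 2))" for g
      proof -
        have [measurable]: "vim M (T g) C \<in> sets M" "vim M (T g0) C \<in> sets M" using Cf by auto
        have "prob (sym_diff (vim \<Omega> (S g) X) (vim \<Omega> (S g0) X))
          = prob (sym_diff {w \<in> space \<Omega>. P (vim M (T g) C) w = 0} {w \<in> space \<Omega>. P (vim M (T g0) C) w = 0})"
        proof (rule prob_sym_diff_cong[OF _ _ _ _ Sv Sv])
          show "vim \<Omega> (S g) X \<in> events" "vim \<Omega> (S g0) X \<in> events" using X E AutD(3)[OF SA] by auto
        qed measurable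
        then show ?thesis using prob_sym_diff_void[OF Cf Cf, of g g0] measure_vim_Aut[OF TA finD(1)[OF C]] by simp
      qed
      moreover have "((\<lambda>g. measure M (sym_diff (vim M (T g) C) (vim M (T g0) C))) \<longlongrightarrow> 0) (nhds g0)"
        using T C unfolding mp_action_def by (intro continuous_weak_topologyD[OF TA]) auto
      then have "((\<lambda>g. 2 * exp (- measure M C) * (1 - exp (- measure M (sym_diff (vim M (T g) C) (vim M (T g0) C)) / 2)))
          \<longlongrightarrow> 2 * exp (- measure M C) * (1 - exp (- 0 / 2))) (nhds g0)"
        by (intro tendsto_intros) auto
      ultimately show ?thesis by simp
    qed
    have "((\<lambda>g. prob (sym_diff (vim \<Omega> (S g) (vim \<Omega> void B)) (vim \<Omega> (S g0) (vim \<Omega> void B)))) \<longlongrightarrow> 0) (nhds g0)"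
      by (rule tendsto_sym_diff_sigma_sets[OF Sm E lim BE])
    moreover have "prob (sym_diff (vim \<Omega> (S g) (vim \<Omega> void B)) (vim \<Omega> (S g0) (vim \<Omega> void B)))
        = prob (sym_diff (vim \<Omega> (S g) F) (vim \<Omega> (S g0) F))" for g
    proof (rule prob_sym_diff_cong)
      have vB: "vim \<Omega> void B \<in> events" by (rule measurable_sets[OF measurable_void B(1)])
      show "vim \<Omega> (S g) (vim \<Omega> void B) \<in> events" "vim \<Omega> (S g0) (vim \<Omega> void B) \<in> events"
        "vim \<Omega> (S g) F \<in> events" "vim \<Omega> (S g0) F \<in> events"
        using AutD(3)[OF SA] vB F by blast+
      have *: "AE w in \<Omega>. w \<in> vim \<Omega> (S g) (vim \<Omega> void B) \<longleftrightarrow> w \<in> vim \<Omega> (S g) F" for g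
        using distr_AE_iff[OF Sm B(2), of g] AE_space
        by eventually_elim (use measurable_space[OF Sm(1), of _ g] in auto)
      show "AE w in \<Omega>. w \<in> vim \<Omega> (S g) (vim \<Omega> void B) \<longleftrightarrow> w \<in> vim \<Omega> (S g) F"
        "AE w in \<Omega>. w \<in> vim \<Omega> (S g0) (vim \<Omega> void B) \<longleftrightarrow> w \<in> vim \<Omega> (S g0) F" by (rule *)+
    qed
    ultimately show "((\<lambda>g. prob (sym_diff (vim \<Omega> (S g) F) (vim \<Omega> (S g0) F))) \<longlongrightarrow> 0) (nhds g0)" by simp
  qed
  have act: "mp_action \<Omega> S" unfolding mp_action_def using SA hom cont by blast
  have "koopman S g f \<in> poisson_H M \<Omega> P" if f: "f \<in> poisson_H M \<Omega> P" for g f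
    unfolding koopman_def
  proof (rule poisson_H_comp[OF Sm _ f])
    fix A assume A: "A \<in> fin"
    show "\<exists>B\<in>fin. AE w in \<Omega>. P A (S (- g) w) = P B w"
      using PS[OF finD(1)[OF A], of "- g"] fin_vim[OF TA A] by blast
  qed
  then have "poissonian_action M \<Omega> P S" unfolding poissonian_action_def using act by blast
  moreover have "base_action M \<Omega> P S T" unfolding base_action_def using T PS by blast
  ultimately show ?thesis by blast
qed

section \<open>Variances and characteristic functions of linear statistics\<close>

text \<open>The nearest point of \<open>{-1, 0, 1}\<close>: it turns the coefficient function of a
  linear statistic into a difference of two indicators.\<close>

definition clamp1 :: "real \<Rightarrow> real" where "clamp1 d = max (-1) (min 1 (real_of_int (round d)))"

lemma clamp1_cases: "clamp1 d \<in> {-1, 0, 1}"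
proof -
  have "max (-1) (min 1 (round d)) \<in> {-1, 0, 1}" by auto
  moreover have "clamp1 d = real_of_int (max (-1) (min 1 (round d)))"
    unfolding clamp1_def by simp
  ultimately show ?thesis by auto
qed

text \<open>The right-hand side is \<open>2 * (sin (pi * r))\<^sup>2\<close>, so
  \<open>sin x \<ge> x / 2\<close> on \<open>[0, pi / 2]\<close> suffices. The latter follows from
  the mean value theorem at \<open>x / 2\<close> and the double angle formula, where each cosine is
  at least \<open>sqrt 2 / 2\<close>.\<close>

lemma square_le_one_minus_cos:
  assumes "\<bar>r\<bar> \<le> 1/2"
  shows "r\<^sup>2 \<le> 1 - cos (2 * pi * r)"
proof -
  have sin_half: "x / 2 \<le> sin x" if x: "0 \<le> x" "x \<le> pi / 2" for x :: real
  proof (cases "x = 0")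
    case False
    then have "0 < x / 2" using x by simp
    then obtain z where z: "0 < z" "z < x / 2" "sin (x / 2) - sin 0 = (x / 2 - 0) * cos z"
      using MVT2[of 0 "x / 2" sin cos] DERIV_sin by blast
    have c: "sqrt 2 / 2 \<le> cos y" if "0 \<le> y" "y \<le> pi / 4" for y
      using cos_monotone_0_pi_le[of y "pi / 4"] that by (simp add: cos_45)
    have "x / 2 * (sqrt 2 / 2) \<le> x / 2 * cos z"
      using z(1,2) c[of z] x by (intro mult_left_mono) auto
    also have "\<dots> = sin (x / 2)" using z(3) by simp
    finally have "2 * (x / 2 * (sqrt 2 / 2)) * (sqrt 2 / 2) \<le> 2 * sin (x / 2) * cos (x / 2)"
      using c[of "x / 2"] sin_ge_zero[of "x / 2"] x by (intro mult_mono) auto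
    also have "\<dots> = sin x" using sin_double[of "x / 2"] by simp
    finally show ?thesis by (simp add: mult.assoc)
  qed simp
  have "\<bar>r\<bar> \<le> pi * \<bar>r\<bar> / 2" using mult_right_mono[OF pi_ge_two abs_ge_zero[of r]] by simp
  also have "\<dots> \<le> sin (pi * \<bar>r\<bar>)" using assms by (intro sin_half) (auto simp: mult_left_mono)
  finally have "\<bar>r\<bar>\<^sup>2 \<le> (sin (pi * \<bar>r\<bar>))\<^sup>2" by (intro power_mono) auto
  moreover have "(sin (pi * \<bar>r\<bar>))\<^sup>2 = (sin (pi * r))\<^sup>2" by (simp add: abs_if)
  moreover have "1 - cos (2 * pi * r) = 2 * (sin (pi * r))\<^sup>2"
    using cos_double_sin[of "pi * r"] by (simp add: mult.assoc)
  moreover have "0 \<le> (sin (pi * r))\<^sup>2" by simp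
  ultimately show ?thesis unfolding power2_abs by argo
qed

lemma one_minus_cos_le: "1 - cos x \<le> x\<^sup>2 / 2" for x :: real
proof -
  have "(sin (x / 2))\<^sup>2 \<le> (x / 2)\<^sup>2" 
    unfolding abs_le_square_iff[symmetric] by (rule abs_sin_x_le_abs_x)
  moreover have "1 - cos x = 2 * (sin (x / 2))\<^sup>2" using cos_double_sin[of "x / 2"] by simp
  ultimately show ?thesis by (simp add: power_divide)
qed

text \<open>Young's inequality with a weight close to 1 on the main term. In
  \<open>poisson_H_approx\<close> the main terms cancel exactly at \<open>t = 0\<close>, so a fixed
  factor such as 2 there would spoil the estimate.\<close>

lemma square_add_le:
  fixes a b t :: real
  assumes "0 < t"
  shows "(a + b)\<^sup>2 \<le> (1 + t) * a\<^sup>2 + (1 + 1 / t) * b\<^sup>2"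
proof -
  have "0 \<le> (t * a - b)\<^sup>2 / t" using assms by simp
  also have "\<dots> = t * a\<^sup>2 - 2 * a * b + b\<^sup>2 / t"
    using assms by (simp add: power2_eq_square field_simps)
  finally show ?thesis by (simp add: power2_eq_square algebra_simps)
qed

text \<open>The quantities on the right-hand side are those controlled by the variance and by the
  characteristic function at \<open>\<pi>\<close> and \<open>2\<pi>\<close>: the last one vanishes exactly at the integers, and on
  the integers the first one is \<open>d\<^sup>2 - [d odd]\<close> up to \<open>t\<close>, which vanishes exactly at \<open>-1, 0, 1\<close>.\<close>

lemma clamp1_bound:
  assumes t: "0 < t"
  obtains C where "0 \<le> C"
    "\<And>d. (d - clamp1 d)\<^sup>2 \<le> 2 * ((1 + t) * d\<^sup>2 - (1 - cos (pi * d)) / 2) + C * (1 - cos (2 * pi * d))"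
proof
  \<comment> \<open>The three summands collect the multiples of \<open>r\<^sup>2\<close> that arise
    when \<open>r\<close> is split off from \<open>d - clamp1 d\<close>, in \<open>k2\<close>, and
    in \<open>odd\<close>.\<close>
  define C where "C = 2 + 2 * (1 + 1 / t) + pi\<^sup>2 / 2"
  show "0 \<le> C" using t unfolding C_def by (intro add_nonneg_nonneg) auto
  fix d :: real
  define k where "k = round d"
  define r where "r = d - k"
  have r: "\<bar>r\<bar> \<le> 1/2" using of_int_round_abs_le[of d] unfolding r_def k_def by linarith
  have d: "d = k + r" by (simp add: r_def)
  define o' :: real where "o' = (if even k then 0 else 1)"
  have cosd: "cos (pi * d) = cos (pi * k) * cos (pi * r)"
    unfolding d by (simp add: distrib_left cos_add)
  have "cos (2 * pi * d) = cos (2 * pi * r + 2 * pi * k)" unfolding d by (simp add: algebra_simps)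
  also have "\<dots> = cos (2 * pi * r)" using cos.plus_of_int[of "2 * pi * r" k] by (simp add: mult_ac)
  finally have r2: "r\<^sup>2 \<le> 1 - cos (2 * pi * d)" using square_le_one_minus_cos[OF r] by simp
  \<comment> \<open>At an integer the left-hand side is its parity; moving to distance
    \<open>r\<close> raises it by at most a multiple of \<open>r\<^sup>2\<close>.\<close>
  have "(1 - cos (pi * d)) / 2 \<le> o' + (1 - cos (pi * r)) / 2"
  proof (cases "even k")
    case True
    then show ?thesis unfolding cosd by (simp add: o'_def)
  next
    case False
    then have "cos (pi * k) = -1" "o' = 1" by (simp_all add: o'_def)
    with cos_le_one[of "pi * r"] show ?thesis unfolding cosd by (simp only:) argo
  qed
  also have "\<dots> \<le> o' + pi\<^sup>2 / 4 * r\<^sup>2" using one_minus_cos_le[of "pi * r"] by (simp add: power_mult_distrib)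
  finally have odd: "(1 - cos (pi * d)) / 2 - pi\<^sup>2 / 4 * r\<^sup>2 \<le> o'" by argo
  have k2: "(real_of_int k)\<^sup>2 \<le> (1 + t) * d\<^sup>2 + (1 + 1 / t) * r\<^sup>2"
    using square_add_le[OF t, of d "- r"] by (simp add: d)
  \<comment> \<open>Equality at 0 and at 1, -1; for \<open>\<bar>k\<bar> \<ge> 2\<close> this is
    \<open>(\<bar>k\<bar> - 1)\<^sup>2 \<le> k\<^sup>2 - 1\<close>, which is good for both
    parities.\<close>
  have ke: "(k - clamp1 d)\<^sup>2 \<le> (real_of_int k)\<^sup>2 - o'"
  proof -
    consider "k = 0" | "\<bar>k\<bar> = 1" | "2 \<le> k" | "k \<le> -2" by linarith
    then show ?thesis
    proof cases
      case 3
      then have c: "clamp1 d = 1" and "2 \<le> real_of_int k" unfolding clamp1_def k_def[symmetric] by auto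
      then have "(real_of_int k - clamp1 d)\<^sup>2 \<le> (real_of_int k)\<^sup>2 - 1"
        unfolding c by (simp add: power2_eq_square algebra_simps)
      moreover have "o' \<le> 1" by (simp add: o'_def)
      ultimately show ?thesis by linarith
    next
      case 4
      then have c: "clamp1 d = -1" and "real_of_int k \<le> -2" unfolding clamp1_def k_def[symmetric] by auto
      then have "(real_of_int k - clamp1 d)\<^sup>2 \<le> (real_of_int k)\<^sup>2 - 1"
        unfolding c by (simp add: power2_eq_square algebra_simps)
      moreover have "o' \<le> 1" by (simp add: o'_def)
      ultimately show ?thesis by linarith
    next
      case 2
      then have "k = 1 \<or> k = -1" by linarith
      then show ?thesis by (auto simp: clamp1_def k_def[symmetric] o'_def)
    qed (simp add: clamp1_def k_def[symmetric] o'_def)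
  qed
  have "(d - clamp1 d)\<^sup>2 \<le> 2 * (k - clamp1 d)\<^sup>2 + 2 * r\<^sup>2"
    using square_add_le[of 1 "k - clamp1 d" r] by (simp add: d algebra_simps)
  also have "\<dots> \<le> 2 * ((1 + t) * d\<^sup>2 - (1 - cos (pi * d)) / 2) + C * r\<^sup>2"
  proof -
    have lin: "2 * u + 2 * v \<le> 2 * (a - z) + (2 * v + 2 * b + 2 * q)"
      if "u \<le> m - w" "m \<le> a + b" "z - q \<le> w" for a b m q u v w z :: real
      using that by argo
    have "C * r\<^sup>2 = 2 * r\<^sup>2 + 2 * ((1 + 1 / t) * r\<^sup>2) + 2 * (pi\<^sup>2 / 4 * r\<^sup>2)"
      unfolding C_def by (simp add: distrib_right)
    then show ?thesis using lin[OF ke k2 odd] by (simp only:)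
  qed
  also have "C * r\<^sup>2 \<le> C * (1 - cos (2 * pi * d))" using r2 \<open>0 \<le> C\<close> by (rule mult_left_mono)
  finally show "(d - clamp1 d)\<^sup>2 \<le> 2 * ((1 + t) * d\<^sup>2 - (1 - cos (pi * d)) / 2) + C * (1 - cos (2 * pi * d))"
    by simp
qed

section \<open>Square integrable functions and variances\<close>

context prob_space
begin

lemma L2D:
  assumes "f \<in> L2_functions M"
  shows "f \<in> borel_measurable M" "integrable M (\<lambda>x. (f x)\<^sup>2)" "integrable M f"
proof -
  show m: "f \<in> borel_measurable M" and i: "integrable M (\<lambda>x. (f x)\<^sup>2)"
    using assms unfolding L2_functions_def by blast+
  show "integrable M f" by (rule square_integrable_imp_integrable[OF m i])
qed

lemma L2_mult:
  assumes "f \<in> L2_functions M" "g \<in> L2_functions M"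
  shows "integrable M (\<lambda>x. f x * g x)"
proof (rule Bochner_Integration.integrable_bound)
  show "integrable M (\<lambda>x. (f x)\<^sup>2 + (g x)\<^sup>2)" using assms L2D by (intro Bochner_Integration.integrable_add) auto
  have "\<bar>a * b\<bar> \<le> \<bar>a\<^sup>2 + b\<^sup>2\<bar>" for a b :: real
  proof -
    have "2 * \<bar>a\<bar> * \<bar>b\<bar> \<le> a\<^sup>2 + b\<^sup>2" using sum_squares_bound[of "\<bar>a\<bar>" "\<bar>b\<bar>"] by simp
    moreover have "0 \<le> \<bar>a\<bar> * \<bar>b\<bar>" by simp
    ultimately show ?thesis unfolding abs_mult by linarith
  qed
  then show "AE x in M. norm (f x * g x) \<le> norm ((f x)\<^sup>2 + (g x)\<^sup>2)" by simp
qed (use assms L2D in auto)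

lemma L2_add:
  assumes "f \<in> L2_functions M" "g \<in> L2_functions M"
  shows "(\<lambda>x. f x + g x) \<in> L2_functions M"
proof -
  have "integrable M (\<lambda>x. (f x)\<^sup>2 + (g x)\<^sup>2 + 2 * (f x * g x))"
    using L2D(2)[OF assms(1)] L2D(2)[OF assms(2)] L2_mult[OF assms] by simp
  then show ?thesis
    using L2D(1)[OF assms(1)] L2D(1)[OF assms(2)] by (simp add: L2_functions_def power2_sum mult.assoc)
qed

lemma L2_const [simp]: "(\<lambda>x. c) \<in> L2_functions M"
  by (simp add: L2_functions_def)

lemma L2_cmult: "f \<in> L2_functions M \<Longrightarrow> (\<lambda>x. c * f x) \<in> L2_functions M"
  by (auto simp: L2_functions_def power_mult_distrib)

lemma L2_diff:
  assumes "f \<in> L2_functions M" "g \<in> L2_functions M"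
  shows "(\<lambda>x. f x - g x) \<in> L2_functions M"
  using L2_add[OF assms(1) L2_cmult[OF assms(2), of "-1"]] by simp

lemma L2_sum:
  assumes "\<And>i. i \<in> I \<Longrightarrow> f i \<in> L2_functions M"
  shows "(\<lambda>x. \<Sum>i\<in>I. f i x) \<in> L2_functions M"
  using assms by (induction I rule: infinite_finite_induct) (simp_all add: L2_add)

lemma variance_le_square:
  assumes "f \<in> L2_functions M"
  shows "variance f \<le> expectation (\<lambda>x. (f x)\<^sup>2)"
  using variance_eq[of f] L2D[OF assms] by simp

lemma variance_add_le:
  assumes f: "f \<in> L2_functions M" and g: "g \<in> L2_functions M" and t: "0 < t"
  shows "variance (\<lambda>x. f x + g x) \<le> (1 + t) * variance f + (1 + 1 / t) * variance g"
proof -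
  have c: "(\<lambda>x. h x - expectation h) \<in> L2_functions M" if "h \<in> L2_functions M" for h
    using that by (intro L2_diff) auto
  note i = L2D(2)[OF c[OF f]] L2D(2)[OF c[OF g]] L2D(2)[OF c[OF L2_add[OF f g]]]
  have "variance (\<lambda>x. f x + g x)
      \<le> expectation (\<lambda>x. (1 + t) * (f x - expectation f)\<^sup>2 + (1 + 1 / t) * (g x - expectation g)\<^sup>2)"
  proof (rule integral_mono)
    fix x
    show "(f x + g x - expectation (\<lambda>x. f x + g x))\<^sup>2
        \<le> (1 + t) * (f x - expectation f)\<^sup>2 + (1 + 1 / t) * (g x - expectation g)\<^sup>2"
      using square_add_le[OF t, of "f x - expectation f" "g x - expectation g"] L2D(3)[OF f] L2D(3)[OF g]
      by (simp add: algebra_simps)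
  qed (use i in auto)
  also have "\<dots> = (1 + t) * variance f + (1 + 1 / t) * variance g"
    using i by simp
  finally show ?thesis .
qed

lemma variance_diff_le:
  assumes f: "f \<in> L2_functions M" and g: "g \<in> L2_functions M"
  shows "variance (\<lambda>x. f x - g x) \<le> 2 * variance f + 2 * variance g"
proof -
  have "variance (\<lambda>x. - g x) = variance g"
    by (simp add: power2_commute)
  then show ?thesis using variance_add_le[OF f L2_cmult[OF g, of "-1"], of 1] by simp
qed

lemma AE_const_if_variance_zero:
  assumes f: "f \<in> L2_functions M" and "variance f = 0"
  shows "AE x in M. f x = expectation f"
proof -
  have "(\<lambda>x. f x - expectation f) \<in> L2_functions M" using f by (intro L2_diff) auto
  from L2D(2)[OF this] have "AE x in M. (f x - expectation f)\<^sup>2 = 0"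
    using assms(2) by (subst integral_nonneg_eq_0_iff_AE[symmetric]) auto
  then show ?thesis by eventually_elim simp
qed

lemma norm_cis_diff_le: "norm (cis a - cis b) \<le> \<bar>a - b\<bar>"
proof -
  have "cis a - cis b = cis b * (cis (a - b) - 1)" by (simp add: algebra_simps cis_mult)
  then have "norm (cis a - cis b) = norm (cis (a - b) - 1)" by (simp add: norm_mult)
  then show ?thesis using iexp_approx1[of "a - b" 0] by (simp add: cis_conv_exp)
qed

text \<open>\<open>cis\<close> is Lipschitz with constant 1, and the L1 norm is at most the L2 norm
  because the variance of \<open>\<bar>f - g\<bar>\<close> is nonnegative.\<close>

lemma norm_expectation_cis_diff_le:
  assumes f: "f \<in> L2_functions M" and g: "g \<in> L2_functions M" and e: "L2_norm M (\<lambda>x. f x - g x) \<le> e"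
  shows "norm ((CLINT x|M. cis (c * f x)) - (CLINT x|M. cis (c * g x))) \<le> \<bar>c\<bar> * e"
proof -
  note [measurable] = L2D(1)[OF f] L2D(1)[OF g]
  note fg = L2_diff[OF f g]
  have i: "integrable M (\<lambda>x. cis (c * h x))" if [measurable]: "h \<in> borel_measurable M" for h
    by (rule integrable_const_bound[where B=1]) auto
  have "norm ((CLINT x|M. cis (c * f x)) - (CLINT x|M. cis (c * g x))) = norm (CLINT x|M. cis (c * f x) - cis (c * g x))"
    by (subst Bochner_Integration.integral_diff) (auto intro!: i)
  also have "\<dots> \<le> expectation (\<lambda>x. norm (cis (c * f x) - cis (c * g x)))"
    by (rule integral_norm_bound)
  also have "\<dots> \<le> expectation (\<lambda>x. \<bar>c\<bar> * \<bar>f x - g x\<bar>)"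
  proof (rule integral_mono)
    show "integrable M (\<lambda>x. norm (cis (c * f x) - cis (c * g x)))"
      by (intro integrable_norm Bochner_Integration.integrable_diff i) measurable
    show "integrable M (\<lambda>x. \<bar>c\<bar> * \<bar>f x - g x\<bar>)" using L2D(3)[OF fg] by auto
    show "norm (cis (c * f x) - cis (c * g x)) \<le> \<bar>c\<bar> * \<bar>f x - g x\<bar>" for x
      using norm_cis_diff_le[of "c * f x" "c * g x"] by (simp add: abs_mult[symmetric] algebra_simps)
  qed
  also have "\<dots> = \<bar>c\<bar> * expectation (\<lambda>x. \<bar>f x - g x\<bar>)" by simp
  also have "expectation (\<lambda>x. \<bar>f x - g x\<bar>) \<le> L2_norm M (\<lambda>x. f x - g x)"
  proof -
    have "0 \<le> expectation (\<lambda>x. \<bar>f x - g x\<bar>\<^sup>2) - (expectation (\<lambda>x. \<bar>f x - g x\<bar>))\<^sup>2"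
      using variance_eq[of "\<lambda>x. \<bar>f x - g x\<bar>"] variance_positive[of "\<lambda>x. \<bar>f x - g x\<bar>"] L2D(2,3)[OF fg] by simp
    then show ?thesis unfolding L2_norm_def by (intro real_le_rsqrt) simp
  qed
  finally show ?thesis using e by (meson abs_ge_zero mult_left_mono order_trans)
qed

end

section \<open>Linear statistics of the process\<close>

context ppp
begin

lemma emeasure_fin_neq_top [simp]: "A \<in> fin \<Longrightarrow> emeasure M A \<noteq> \<top>"
  by (simp only: less_top emeasure_fin_less_top)

lemma p_L2 [simp]: "A \<in> fin \<Longrightarrow> p A \<in> L2_functions \<Omega>"
  using integrable_p2 by (simp add: L2_functions_def)

lemma p_lin_L2: "(\<And>i. i \<in> I \<Longrightarrow> A i \<in> fin) \<Longrightarrow> (\<lambda>w. \<Sum>i\<in>I. c i * p (A i) w) \<in> L2_functions \<Omega>"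
  by (intro L2_sum L2_cmult p_L2)

lemma AE_p_UN:
  assumes I: "finite I" "\<And>i. i \<in> I \<Longrightarrow> A i \<in> fin" "disjoint_family_on A I"
  shows "AE w in \<Omega>. p (\<Union>i\<in>I. A i) w = (\<Sum>i\<in>I. p (A i) w)"
proof -
  have "AE w in \<Omega>. P (\<Union>i\<in>I. A i) w = (\<Sum>i\<in>I. P (A i) w)"
    using I by (intro AE_P_UN) auto
  moreover have "AE w in \<Omega>. \<forall>i\<in>I. P (A i) w = ennreal (p (A i) w)"
    using I AE_P_eq_p by (intro AE_finite_allI) auto
  ultimately show ?thesis
  proof eventually_elim
    case (elim w)
    then have "P (\<Union>i\<in>I. A i) w = (\<Sum>i\<in>I. ennreal (p (A i) w))" by (simp cong: sum.cong)
    also have "\<dots> = ennreal (\<Sum>i\<in>I. p (A i) w)" by (intro sum_ennreal) simp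
    finally show ?case unfolding p_def[of "\<Union>i\<in>I. A i"] by (simp add: sum_nonneg)
  qed
qed

lemma AE_p_Un:
  assumes "A \<in> fin" "B \<in> fin" "A \<inter> B = {}"
  shows "AE w in \<Omega>. p (A \<union> B) w = p A w + p B w"
proof -
  have "AE w in \<Omega>. p (\<Union>b\<in>UNIV. if b then A else B) w = (\<Sum>b\<in>UNIV. p (if b then A else B) w)"
    using assms by (intro AE_p_UN) (auto simp: disjoint_family_on_def)
  moreover have "(\<Union>b\<in>UNIV. if b then A else B) = A \<union> B" by (auto simp: UNIV_bool)
  ultimately show ?thesis by (simp add: UNIV_bool add.commute)
qed

lemma AE_p_split:
  assumes A: "A \<in> fin" and B: "B \<in> sets M"
  shows "AE w in \<Omega>. p A w = p (A \<inter> B) w + p (A - B) w"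
proof -
  have "A \<inter> B \<inter> (A - B) = {}" by auto
  from AE_p_Un[OF _ _ this] show ?thesis using A B unfolding Int_Diff_Un by simp
qed

lemma measure_split:
  assumes A: "A \<in> fin" and B: "B \<in> sets M"
  shows "measure M A = measure M (A \<inter> B) + measure M (A - B)"
  using measure_Union[of M "A \<inter> B" "A - B"] A B unfolding Int_Diff_Un by auto

text \<open>For disjoint sets the mixed moment is read off from the Poisson second moments of
  \<open>p A\<close>, \<open>p B\<close> and \<open>p (A \<union> B)\<close>. In general both sets
  are split along \<open>A \<inter> B\<close>.\<close>

lemma expectation_p_mult:
  assumes A: "A \<in> fin" and B: "B \<in> fin"
  shows "expectation (\<lambda>w. p A w * p B w) = measure M A * measure M B + measure M (A \<inter> B)"
proof -
  have disj: "expectation (\<lambda>w. p A w * p B w) = measure M A * measure M B"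
    if A: "A \<in> fin" and B: "B \<in> fin" and AB: "A \<inter> B = {}" for A B
  proof -
    have m: "measure M (A \<union> B) = measure M A + measure M B"
      using A B AB by (intro measure_Union) auto
    have "expectation (\<lambda>w. (p (A \<union> B) w)\<^sup>2) = expectation (\<lambda>w. (p A w + p B w)\<^sup>2)"
      using AE_p_Un[OF A B AB] A B by (intro integral_cong_AE) auto
    also have "\<dots> = expectation (\<lambda>w. (p A w)\<^sup>2 + (p B w)\<^sup>2 + 2 * (p A w * p B w))"
      by (simp add: power2_sum mult.assoc)
    also have "\<dots> = expectation (\<lambda>w. (p A w)\<^sup>2) + expectation (\<lambda>w. (p B w)\<^sup>2) + 2 * expectation (\<lambda>w. p A w * p B w)"
      using integrable_p2 A B L2_mult[of "p A" "p B"] by simp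
    finally show ?thesis using expectation_p2 A B m by (simp add: power2_sum)
  qed
  let ?C = "A \<inter> B"
  have f: "?C \<in> fin" "A - B \<in> fin" "B - A \<in> fin" using A B by auto
  have "AE w in \<Omega>. p A w = p ?C w + p (A - B) w" using AE_p_split[OF A finD(1)[OF B]] .
  moreover have "AE w in \<Omega>. p B w = p ?C w + p (B - A) w"
    using AE_p_split[OF B finD(1)[OF A]] unfolding Int_commute[of B A] .
  ultimately have "expectation (\<lambda>w. p A w * p B w)
      = expectation (\<lambda>w. (p ?C w)\<^sup>2 + p ?C w * p (B - A) w + p (A - B) w * p ?C w + p (A - B) w * p (B - A) w)"
    using A B f by (intro integral_cong_AE) (auto simp: power2_eq_square algebra_simps elim!: eventually_elim2)
  also have "\<dots> = expectation (\<lambda>w. (p ?C w)\<^sup>2) + expectation (\<lambda>w. p ?C w * p (B - A) w)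
      + expectation (\<lambda>w. p (A - B) w * p ?C w) + expectation (\<lambda>w. p (A - B) w * p (B - A) w)"
    using f integrable_p2[OF f(1)] L2_mult by simp
  also have "\<dots> = (measure M ?C)\<^sup>2 + measure M ?C + measure M ?C * measure M (B - A)
      + measure M (A - B) * measure M ?C + measure M (A - B) * measure M (B - A)"
  proof -
    have "?C \<inter> (B - A) = {}" "(A - B) \<inter> ?C = {}" "(A - B) \<inter> (B - A) = {}" by auto
    then show ?thesis using expectation_p2[OF f(1)] disj f by simp
  qed
  also have "\<dots> = (measure M ?C + measure M (A - B)) * (measure M ?C + measure M (B - A)) + measure M ?C"
    by (simp add: power2_eq_square algebra_simps)
  also have "measure M ?C + measure M (A - B) = measure M A"
    by (rule measure_split[OF A finD(1)[OF B], symmetric])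
  also have "measure M ?C + measure M (B - A) = measure M B"
    using measure_split[OF B finD(1)[OF A]] unfolding Int_commute[of B A] by (rule sym)
  finally show ?thesis .
qed

lemma expectation_p_lin:
  assumes "\<And>i. i \<in> I \<Longrightarrow> A i \<in> fin"
  shows "expectation (\<lambda>w. \<Sum>i\<in>I. c i * p (A i) w) = (\<Sum>i\<in>I. c i * measure M (A i))"
  using assms by (subst Bochner_Integration.integral_sum) (auto simp: expectation_p)

text \<open>The isometry between the centred first chaos and the L2 space of the base, for simple
  functions: the covariance of \<open>p (A i)\<close> and \<open>p (A j)\<close> is the measure of
  \<open>A i \<inter> A j\<close>.\<close>

lemma variance_p_lin:
  assumes A: "\<And>i. i \<in> I \<Longrightarrow> A i \<in> fin"
  shows "variance (\<lambda>w. \<Sum>i\<in>I. c i * p (A i) w) = (\<integral>x. (\<Sum>i\<in>I. c i * indicator (A i) x)\<^sup>2 \<partial>M)"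
proof -
  have L: "(\<lambda>w. \<Sum>i\<in>I. c i * p (A i) w) \<in> L2_functions \<Omega>" by (rule p_lin_L2[OF A])
  have E: "expectation (\<lambda>w. \<Sum>i\<in>I. c i * p (A i) w) = (\<Sum>i\<in>I. c i * measure M (A i))"
    by (rule expectation_p_lin[OF A])
  have "expectation (\<lambda>w. (\<Sum>i\<in>I. c i * p (A i) w)\<^sup>2)
      = expectation (\<lambda>w. \<Sum>i\<in>I. \<Sum>j\<in>I. c i * c j * (p (A i) w * p (A j) w))"
    by (simp add: power2_eq_square sum_product mult_ac)
  also have "\<dots> = (\<Sum>i\<in>I. \<Sum>j\<in>I. c i * c j * (measure M (A i) * measure M (A j) + measure M (A i \<inter> A j)))"
    using A L2_mult by (subst Bochner_Integration.integral_sum Bochner_Integration.integral_sum)+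
      (auto simp: expectation_p_mult intro!: sum.cong)
  finally have "variance (\<lambda>w. \<Sum>i\<in>I. c i * p (A i) w)
      = (\<Sum>i\<in>I. \<Sum>j\<in>I. c i * c j * (measure M (A i) * measure M (A j) + measure M (A i \<inter> A j)))
        - (\<Sum>i\<in>I. c i * measure M (A i))\<^sup>2"
    using variance_eq[OF L2D(3)[OF L] L2D(2)[OF L]] unfolding E by simp
  also have "\<dots> = (\<Sum>i\<in>I. \<Sum>j\<in>I. c i * c j * measure M (A i \<inter> A j))"
    by (simp add: power2_eq_square sum_product sum_subtractf[symmetric] algebra_simps)
  also have "\<dots> = (\<integral>x. (\<Sum>i\<in>I. \<Sum>j\<in>I. c i * c j * indicator (A i \<inter> A j) x) \<partial>M)"
    using A by (subst Bochner_Integration.integral_sum Bochner_Integration.integral_sum)+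
      (auto intro!: sum.cong Bochner_Integration.integrable_sum simp: fmeasurable_fin[THEN fmeasurableD2] less_top)
  also have "\<dots> = (\<integral>x. (\<Sum>i\<in>I. c i * indicator (A i) x)\<^sup>2 \<partial>M)"
    by (simp add: power2_eq_square sum_product indicator_inter_arith mult_ac)
  finally show ?thesis .
qed

text \<open>The random variables \<open>p (A i)\<close> are modified on null sets because their distinguishing
  property, being measurable with respect to the void events inside \<open>A i\<close>, only holds up to these.\<close>

lemma indep_p:
  assumes A: "\<And>i. i \<in> I \<Longrightarrow> A i \<in> fin" and disj: "disjoint_family_on A I"
  obtains Q where "indep_vars (\<lambda>_. borel) Q I" "\<And>i. i \<in> I \<Longrightarrow> AE w in \<Omega>. Q i w = p (A i) w"
proof -
  define F where "F i = {B \<in> fin. B \<subseteq> A i}" for i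
  define G where "G i = {{w \<in> space \<Omega>. J \<subseteq> void w} | J. finite J \<and> J \<subseteq> F i}" for i
  have Ff: "F i \<subseteq> fin" for i unfolding F_def by auto
  have G: "G i \<subseteq> events" for i
  proof
    fix X assume "X \<in> G i"
    then obtain J where J: "X = {w \<in> space \<Omega>. J \<subseteq> void w}" "finite J" "J \<subseteq> F i" unfolding G_def by auto
    have "X = {w \<in> space \<Omega>. \<forall>A\<in>J. P A w = 0}" using J(3) unfolding J(1) F_def void_def by auto
    also have "\<dots> \<in> events" using J(2,3) by (intro sets.sets_Collect_finite_All) (auto simp: F_def)
    finally show "X \<in> events" .
  qed
  have "indep_sets G I"
  proof (rule indep_setsI)
    show "G i \<subseteq> events" for i by (rule G)
    fix X K assume K: "K \<noteq> {}" "K \<subseteq> I" "finite K" and X: "\<forall>i\<in>K. X i \<in> G i"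
    then have "\<forall>i\<in>K. \<exists>J. X i = {w \<in> space \<Omega>. J \<subseteq> void w} \<and> finite J \<and> J \<subseteq> F i" unfolding G_def by blast
    from bchoice[OF this] obtain J where J: "\<And>i. i \<in> K \<Longrightarrow> X i = {w \<in> space \<Omega>. J i \<subseteq> void w}"
      "\<And>i. i \<in> K \<Longrightarrow> finite (J i)" "\<And>i. i \<in> K \<Longrightarrow> J i \<subseteq> F i" by blast
    have UJ: "\<Union>(J i) \<in> fin" if "i \<in> K" for i
      using fin_UN[of "J i" "\<lambda>A. A"] J(2,3)[OF that] Ff by auto
    have UA: "\<Union>(J i) \<subseteq> A i" if "i \<in> K" for i using J(3)[OF that] unfolding F_def by auto
    have pX: "prob (X i) = exp (- measure M (\<Union>(J i)))" if "i \<in> K" for i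
      unfolding J(1)[OF that] using J(2,3)[OF that] Ff by (intro prob_void_superset) auto
    have "(\<Inter>i\<in>K. X i) = {w \<in> space \<Omega>. (\<Union>i\<in>K. J i) \<subseteq> void w}" using J(1) K(1) by auto
    also have "prob \<dots> = exp (- measure M (\<Union>(\<Union>i\<in>K. J i)))"
      using J(2,3) K(3) Ff by (intro prob_void_superset) blast+
    also have "\<Union>(\<Union>i\<in>K. J i) = (\<Union>i\<in>K. \<Union>(J i))" by auto
    \<comment> \<open>The unions for different \<open>i\<close> lie in disjoint sets
      \<open>A i\<close>; their measures add, and the exponential turns the sum into the product
      that independence requires.\<close>
    also have "measure M \<dots> = (\<Sum>i\<in>K. measure M (\<Union>(J i)))"
    proof (rule measure_finite_Union)
      show "disjoint_family_on (\<lambda>i. \<Union>(J i)) K"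
        unfolding disjoint_family_on_def
      proof (intro ballI impI)
        fix i j assume "i \<in> K" "j \<in> K" "i \<noteq> j"
        moreover from this have "A i \<inter> A j = {}" using disj K(2) unfolding disjoint_family_on_def by auto
        ultimately show "\<Union>(J i) \<inter> \<Union>(J j) = {}" using UA[of i] UA[of j] by blast
      qed
      show "emeasure M (\<Union>(J i)) \<noteq> \<infinity>" if "i \<in> K" for i using UJ[OF that] by simp
    qed (use K(3) UJ in auto)
    also have "exp (- (\<Sum>i\<in>K. measure M (\<Union>(J i)))) = (\<Prod>i\<in>K. prob (X i))"
      using K(3) by (simp add: pX sum_negf[symmetric] exp_sum)
    finally show "prob (\<Inter>i\<in>K. X i) = (\<Prod>i\<in>K. prob (X i))" .
  qed
  moreover have "Int_stable (G i)" for i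
  proof (rule Int_stableI)
    fix a b assume "a \<in> G i" "b \<in> G i"
    then obtain J K where "a = {w \<in> space \<Omega>. J \<subseteq> void w}" "b = {w \<in> space \<Omega>. K \<subseteq> void w}" "finite J" "finite K" "J \<subseteq> F i" "K \<subseteq> F i"
      unfolding G_def by blast
    then show "a \<inter> b \<in> G i" unfolding G_def by (intro CollectI exI[of _ "J \<union> K"]) auto
  qed
  ultimately have ind: "indep_sets (\<lambda>i. sigma_sets (space \<Omega>) (G i)) I" by (rule indep_sets_sigma)
  have "\<forall>i\<in>I. \<exists>L. L \<in> borel_measurable (void_space (F i)) \<and> (AE w in \<Omega>. P (A i) w = L (void w))"
  proof
    fix i assume "i \<in> I"
    then show "\<exists>L. L \<in> borel_measurable (void_space (F i)) \<and> (AE w in \<Omega>. P (A i) w = L (void w))"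
      using AE_P_factor_void[OF finD(1)[OF A]] unfolding F_def by metis
  qed
  from bchoice[OF this] obtain L where L: "\<And>i. i \<in> I \<Longrightarrow> L i \<in> borel_measurable (void_space (F i))"
    "\<And>i. i \<in> I \<Longrightarrow> AE w in \<Omega>. P (A i) w = L i (void w)" by blast
  define Q where "Q i w = enn2real (L i (void w))" for i w
  have Lm: "(\<lambda>z. enn2real (L i z)) \<in> borel_measurable (void_space (F i))" if "i \<in> I" for i
    using L(1)[OF that] by measurable
  have Qm: "Q i \<in> borel_measurable \<Omega>" if "i \<in> I" for i
    unfolding Q_def[abs_def] by (rule measurable_compose[OF measurable_void_subset[OF Ff] Lm[OF that]])
  have "indep_vars (\<lambda>_. borel) Q I"
    unfolding indep_vars_def2
  proof (intro conjI ballI Qm)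
    show "indep_sets (\<lambda>i. {Q i -` B \<inter> space \<Omega> | B. B \<in> sets borel}) I"
    proof (rule indep_sets_mono_sets[OF ind])
      fix i assume i: "i \<in> I"
      show "{Q i -` B \<inter> space \<Omega> | B. B \<in> sets borel} \<subseteq> sigma_sets (space \<Omega>) (G i)"
      proof
        fix X assume "X \<in> {Q i -` B \<inter> space \<Omega> | B. B \<in> sets borel}"
        then obtain B :: "real set" where B: "X = Q i -` B \<inter> space \<Omega>" "B \<in> sets borel" by auto
        define C where "C = (\<lambda>z. enn2real (L i z)) -` B"
        have "C \<in> sets (void_space (F i))" using measurable_sets[OF Lm[OF i] B(2)] by (simp add: C_def)
        moreover have "X = void -` C \<inter> space \<Omega>" unfolding B(1) C_def Q_def by auto
        ultimately have "X \<in> {void -` C \<inter> space \<Omega> | C. C \<in> sigma_sets UNIV {{z. J \<subseteq> z} | J. finite J \<and> J \<subseteq> F i}}"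
          unfolding sets_void_space by blast
        also have "\<dots> = sigma_sets (space \<Omega>) {void -` C \<inter> space \<Omega> | C. C \<in> {{z. J \<subseteq> z} | J. finite J \<and> J \<subseteq> F i}}"
          by (rule sigma_sets_vimage_commute) auto
        also have "{void -` C \<inter> space \<Omega> | C. C \<in> {{z. J \<subseteq> z} | J. finite J \<and> J \<subseteq> F i}} \<subseteq> G i"
        proof
          fix Y assume "Y \<in> {void -` C \<inter> space \<Omega> | C. C \<in> {{z. J \<subseteq> z} | J. finite J \<and> J \<subseteq> F i}}"
          then obtain J where J: "Y = void -` {z. J \<subseteq> z} \<inter> space \<Omega>" "finite J" "J \<subseteq> F i" by blast
          have "Y = {w \<in> space \<Omega>. J \<subseteq> void w}" unfolding J(1) by auto
          then show "Y \<in> G i" unfolding G_def using J(2,3) by blast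
        qed
        then have "sigma_sets (space \<Omega>) {void -` C \<inter> space \<Omega> | C. C \<in> {{z. J \<subseteq> z} | J. finite J \<and> J \<subseteq> F i}}
            \<subseteq> sigma_sets (space \<Omega>) (G i)" by (rule sigma_sets_mono')
        finally show "X \<in> sigma_sets (space \<Omega>) (G i)" .
      qed
    qed
  qed
  moreover have "AE w in \<Omega>. Q i w = p (A i) w" if "i \<in> I" for i
    using L(2)[OF that] by eventually_elim (simp add: Q_def p_def)
  ultimately show ?thesis by (rule that)
qed

lemma norm_char_disjoint:
  assumes I: "finite I" and A: "\<And>i. i \<in> I \<Longrightarrow> A i \<in> fin" and disj: "disjoint_family_on A I"
  shows "norm (CLINT w|\<Omega>. cis (\<Sum>i\<in>I. d i * p (A i) w)) = exp (- (\<Sum>i\<in>I. measure M (A i) * (1 - cos (d i))))"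
proof -
  obtain Q where Q: "indep_vars (\<lambda>_. borel) Q I" "\<And>i. i \<in> I \<Longrightarrow> AE w in \<Omega>. Q i w = p (A i) w"
    using indep_p[OF A disj] by metis
  have Qm: "Q i \<in> borel_measurable \<Omega>" if "i \<in> I" for i using Q(1) that unfolding indep_vars_def by auto
  have ind: "indep_vars (\<lambda>_. borel) (\<lambda>i w. d i * Q i w) I"
    by (rule indep_vars_compose2[OF Q(1), where Y="\<lambda>i x. d i * x"]) auto
  have ch: "char (distr \<Omega> borel f) 1 = (CLINT w|\<Omega>. cis (f w))" if "f \<in> borel_measurable \<Omega>" for f
    using that unfolding char_def by (subst integral_distr) (auto simp: cis_conv_exp)
  have "(CLINT w|\<Omega>. cis (\<Sum>i\<in>I. d i * p (A i) w)) = (CLINT w|\<Omega>. cis (\<Sum>i\<in>I. d i * Q i w))"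
  proof (rule integral_cong_AE)
    have "AE w in \<Omega>. \<forall>i\<in>I. Q i w = p (A i) w" using I Q(2) by (intro AE_finite_allI)
    then show "AE w in \<Omega>. cis (\<Sum>i\<in>I. d i * p (A i) w) = cis (\<Sum>i\<in>I. d i * Q i w)"
      by eventually_elim (simp cong: sum.cong)
  qed (use A Qm in \<open>auto intro!: measurable_compose[OF _ borel_measurable_cis]\<close>)
  also have "\<dots> = char (distr \<Omega> borel (\<lambda>w. \<Sum>i\<in>I. d i * Q i w)) 1"
    by (rule ch[symmetric]) (use Qm in auto)
  also have "\<dots> = (\<Prod>i\<in>I. char (distr \<Omega> borel (\<lambda>w. d i * Q i w)) 1)"
    by (rule char_distr_sum[OF ind])
  also have "norm \<dots> = (\<Prod>i\<in>I. exp (- (measure M (A i) * (1 - cos (d i)))))"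
    unfolding prod_norm[symmetric]
  proof (rule prod.cong[OF refl])
    fix i assume i: "i \<in> I"
    have "char (distr \<Omega> borel (\<lambda>w. d i * Q i w)) 1 = (CLINT w|\<Omega>. cis (d i * Q i w))"
      by (rule ch) (use Qm[OF i] in auto)
    also have "\<dots> = (CLINT w|\<Omega>. cis (d i * p (A i) w))"
      by (rule integral_cong_AE)
         (use Q(2)[OF i] Qm[OF i] A[OF i] in \<open>auto intro!: measurable_compose[OF _ borel_measurable_cis]\<close>)
    finally show "norm (char (distr \<Omega> borel (\<lambda>w. d i * Q i w)) 1) = exp (- (measure M (A i) * (1 - cos (d i))))"
      using norm_char_p[OF A[OF i]] by simp
  qed
  finally show ?thesis using I by (simp add: exp_sum sum_negf[symmetric])
qed

lemma norm_char_p_lin: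
  assumes I: "finite I" and A: "\<And>i. i \<in> I \<Longrightarrow> A i \<in> fin"
  shows "norm (CLINT w|\<Omega>. cis (\<Sum>i\<in>I. c i * p (A i) w))
    = exp (- (\<integral>x. (1 - cos (\<Sum>i\<in>I. c i * indicator (A i) x)) \<partial>M))"
proof -
  \<comment> \<open>The \<open>a J\<close> are the atoms of the algebra generated by the
    \<open>A i\<close>. The atom of \<open>{}\<close> is left out: it may have infinite measure, and
    the coefficient function vanishes on it.\<close>
  define K where "K = Pow I - {{}}"
  define a where "a J = {x \<in> space M. {i \<in> I. x \<in> A i} = J}" for J
  define d where "d J = (\<Sum>i\<in>J. c i)" for J
  have K: "finite K" unfolding K_def using I by simp
  have a: "a J \<in> fin" if J: "J \<in> K" for J
  proof -
    obtain i where i: "i \<in> J" "i \<in> I" using J unfolding K_def by auto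
    have "a J = {x \<in> space M. \<forall>i\<in>I. x \<in> A i \<longleftrightarrow> i \<in> J}" using J unfolding a_def K_def by auto
    also have "\<dots> \<in> sets M"
    proof (rule sets.sets_Collect_finite_All[OF _ I])
      fix i assume "i \<in> I"
      then have [measurable]: "A i \<in> sets M" using A by simp
      show "{x \<in> space M. x \<in> A i \<longleftrightarrow> i \<in> J} \<in> sets M" by measurable
    qed
    finally have "a J \<in> sets M" .
    moreover have "a J \<subseteq> A i" using i unfolding a_def by auto
    ultimately show ?thesis using fin_subset[OF A[OF i(2)]] by blast
  qed
  have disj: "disjoint_family_on a L" for L unfolding disjoint_family_on_def a_def by auto
  have Au: "A i = (\<Union>J\<in>{J \<in> K. i \<in> J}. a J)" if "i \<in> I" for i
    using that sets.sets_into_space[OF finD(1)[OF A[OF that]]] unfolding a_def K_def by auto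
  have "AE w in \<Omega>. \<forall>i\<in>I. p (A i) w = (\<Sum>J\<in>{J \<in> K. i \<in> J}. p (a J) w)"
  proof (rule AE_finite_allI[OF I])
    fix i assume i: "i \<in> I"
    show "AE w in \<Omega>. p (A i) w = (\<Sum>J\<in>{J \<in> K. i \<in> J}. p (a J) w)"
      unfolding Au[OF i] by (rule AE_p_UN) (use K a disj in auto)
  qed
  then have X: "AE w in \<Omega>. (\<Sum>i\<in>I. c i * p (A i) w) = (\<Sum>J\<in>K. d J * p (a J) w)"
  proof eventually_elim
    case (elim w)
    have "(\<Sum>i\<in>I. c i * p (A i) w) = (\<Sum>i\<in>I. \<Sum>J\<in>K. if i \<in> J then c i * p (a J) w else 0)"
      using elim K by (intro sum.cong) (auto simp: sum_distrib_left sum.inter_filter intro!: sum.cong)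
    also have "\<dots> = (\<Sum>J\<in>K. \<Sum>i\<in>I. if i \<in> J then c i * p (a J) w else 0)" by (rule sum.swap)
    also have "\<dots> = (\<Sum>J\<in>K. d J * p (a J) w)"
    proof (rule sum.cong[OF refl])
      fix J assume "J \<in> K"
      then have "{i \<in> I. i \<in> J} = J" unfolding K_def by auto
      then show "(\<Sum>i\<in>I. if i \<in> J then c i * p (a J) w else 0) = d J * p (a J) w"
        using I by (simp add: sum.inter_filter[symmetric] d_def sum_distrib_right)
    qed
    finally show ?case .
  qed
  have "(CLINT w|\<Omega>. cis (\<Sum>i\<in>I. c i * p (A i) w)) = (CLINT w|\<Omega>. cis (\<Sum>J\<in>K. d J * p (a J) w))"
    by (rule integral_cong_AE)
       (use X A a in \<open>auto intro!: measurable_compose[OF _ borel_measurable_cis] elim!: eventually_mono\<close>)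
  also have "norm \<dots> = exp (- (\<Sum>J\<in>K. measure M (a J) * (1 - cos (d J))))"
    by (rule norm_char_disjoint[OF K a disj])
  also have "(\<Sum>J\<in>K. measure M (a J) * (1 - cos (d J))) = (\<integral>x. (\<Sum>J\<in>K. (1 - cos (d J)) * indicator (a J) x) \<partial>M)"
  proof (subst Bochner_Integration.integral_sum)
    show "integrable M (\<lambda>x. (1 - cos (d J)) * indicator (a J) x :: real)" if "J \<in> K" for J
      using a[OF that] emeasure_fin_less_top[OF a[OF that]] by (intro integrable_mult_right integrable_real_indicator) auto
  qed (use a in \<open>auto intro!: sum.cong\<close>)
  also have "\<dots> = (\<integral>x. (1 - cos (\<Sum>i\<in>I. c i * indicator (A i) x)) \<partial>M)"
  proof (rule Bochner_Integration.integral_cong[OF refl])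
    fix x assume x: "x \<in> space M"
    define J where "J = {i \<in> I. x \<in> A i}"
    have "(\<Sum>i\<in>I. c i * indicator (A i) x) = (\<Sum>i\<in>I. if x \<in> A i then c i else 0)"
      by (intro sum.cong) (auto simp: indicator_def)
    also have "\<dots> = d J" unfolding d_def J_def using I by (simp add: sum.inter_filter)
    finally have F: "(\<Sum>i\<in>I. c i * indicator (A i) x) = d J" .
    have "(\<Sum>J'\<in>K. (1 - cos (d J')) * indicator (a J') x) = (\<Sum>J'\<in>K. if J' = J then 1 - cos (d J) else 0)"
      using x by (intro sum.cong) (auto simp: indicator_def a_def J_def)
    also have "\<dots> = 1 - cos (d J)"
    proof (cases "J = {}")
      case True
      then show ?thesis using K by (simp add: d_def)
    next
      case False
      then have "J \<in> K" unfolding K_def J_def by auto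
      then show ?thesis using K by simp
    qed
    finally show "(\<Sum>J'\<in>K. (1 - cos (d J')) * indicator (a J') x) = 1 - cos (\<Sum>i\<in>I. c i * indicator (A i) x)"
      unfolding F .
  qed
  finally show ?thesis .
qed

end

section \<open>Poisson elements of the first chaos\<close>

lemma borel_measurable_clamp1 [measurable]: "clamp1 \<in> borel_measurable borel"
  unfolding clamp1_def[abs_def] round_def by measurable

context ppp
begin

text \<open>The simple function takes its values among finitely many subsums of the coefficients,
  which bounds the composite; \<open>g 0 = 0\<close> confines it to a set of finite measure.\<close>

lemma integrable_fun_lin:
  fixes c :: "'i \<Rightarrow> real" and g :: "real \<Rightarrow> real"
  assumes I: "finite I" and A: "\<And>i. i \<in> I \<Longrightarrow> A i \<in> fin"
    and g[measurable]: "g \<in> borel_measurable borel" and g0: "g 0 = 0"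
  shows "integrable M (\<lambda>x. g (\<Sum>i\<in>I. c i * indicator (A i) x))"
proof (rule Bochner_Integration.integrable_bound)
  define K where "K = (\<Sum>S\<in>Pow I. \<bar>g (\<Sum>i\<in>S. c i)\<bar>)"
  have U: "(\<Union>i\<in>I. A i) \<in> fin" using I A by (rule fin_UN)
  show "integrable M (\<lambda>x. K * indicator (\<Union>i\<in>I. A i) x)"
    using U emeasure_fin_less_top[OF U] by (intro integrable_mult_right integrable_real_indicator) auto
  have [measurable]: "A i \<in> sets M" if "i \<in> I" for i using A[OF that] by simp
  show "(\<lambda>x. g (\<Sum>i\<in>I. c i * indicator (A i) x)) \<in> borel_measurable M" by measurable
  have "\<bar>g (\<Sum>i\<in>I. c i * indicator (A i) x)\<bar> \<le> K * indicator (\<Union>i\<in>I. A i) x" for x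
  proof (cases "x \<in> (\<Union>i\<in>I. A i)")
    case True
    have "(\<Sum>i\<in>I. c i * indicator (A i) x) = (\<Sum>i\<in>I. if x \<in> A i then c i else 0)"
      by (intro sum.cong) (auto simp: indicator_def)
    also have "\<dots> = (\<Sum>i\<in>{i \<in> I. x \<in> A i}. c i)" using I by (simp add: sum.inter_filter)
    finally have "\<bar>g (\<Sum>i\<in>I. c i * indicator (A i) x)\<bar> = \<bar>g (\<Sum>i\<in>{i \<in> I. x \<in> A i}. c i)\<bar>" by simp
    also have "\<dots> \<le> K" unfolding K_def using I by (intro member_le_sum) auto
    finally show ?thesis using True by simp
  next
    case False
    then have "(\<Sum>i\<in>I. c i * indicator (A i) x) = 0" by (intro sum.neutral) (auto simp: indicator_def)
    with False g0 show ?thesis by simp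
  qed
  then show "AE x in M. norm (g (\<Sum>i\<in>I. c i * indicator (A i) x)) \<le> norm (K * indicator (\<Union>i\<in>I. A i) x)"
    by (intro AE_I2) (simp only: real_norm_def, rule order_trans[OF _ abs_ge_self])
qed

text \<open>\<open>B\<close> and \<open>C\<close> are the sets where the clamped coefficient
  function is 1 and -1, so the statistic on the left has coefficient function
  \<open>F - clamp1 F\<close>. The sum type appends the two new terms to the index set.\<close>

lemma clamp_p_lin:
  assumes I: "finite I" and A: "\<And>i. i \<in> I \<Longrightarrow> A i \<in> fin"
  obtains B C where "B \<in> fin" "C \<in> fin" "B \<inter> C = {}"
    "variance (\<lambda>w. (\<Sum>i\<in>I. c i * p (A i) w) - p B w + p C w)
      = (\<integral>x. ((\<Sum>i\<in>I. c i * indicator (A i) x) - clamp1 (\<Sum>i\<in>I. c i * indicator (A i) x))\<^sup>2 \<partial>M)"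
proof -
  define F where "F x = (\<Sum>i\<in>I. c i * indicator (A i) x)" for x
  have [measurable]: "A i \<in> sets M" if "i \<in> I" for i using A[OF that] by simp
  have F[measurable]: "F \<in> borel_measurable M" unfolding F_def by measurable
  define B where "B = {x \<in> space M. clamp1 (F x) = 1}"
  define C where "C = {x \<in> space M. clamp1 (F x) = -1}"
  have U: "(\<Union>i\<in>I. A i) \<in> fin" using I A by (rule fin_UN)
  have F0: "clamp1 (F x) = 0" if "x \<notin> (\<Union>i\<in>I. A i)" for x
  proof -
    have "F x = 0" unfolding F_def by (intro sum.neutral) (use that in \<open>auto simp: indicator_def\<close>)
    then show ?thesis by (simp add: clamp1_def)
  qed
  have "B \<in> sets M" "C \<in> sets M" unfolding B_def C_def by measurable
  moreover have "B \<subseteq> (\<Union>i\<in>I. A i)" "C \<subseteq> (\<Union>i\<in>I. A i)" using F0 unfolding B_def C_def by force+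
  ultimately have BC: "B \<in> fin" "C \<in> fin" using fin_subset[OF U] by blast+
  let ?A = "case_sum A (\<lambda>b. if b then B else C)"
  let ?c = "case_sum c (\<lambda>b. if b then -1 else 1)"
  have fin: "?A j \<in> fin" if "j \<in> I <+> UNIV" for j using that A BC by auto
  have plus: "(\<Sum>j\<in>I <+> UNIV. h j) = (\<Sum>i\<in>I. h (Inl i)) + (h (Inr False) + h (Inr True))" for h :: "_ \<Rightarrow> real"
    using I by (simp add: sum.Plus UNIV_bool)
  have "variance (\<lambda>w. \<Sum>j\<in>I <+> UNIV. ?c j * p (?A j) w)
      = (\<integral>x. (\<Sum>j\<in>I <+> UNIV. ?c j * indicator (?A j) x)\<^sup>2 \<partial>M)"
    by (rule variance_p_lin[OF fin])
  moreover have "(\<Sum>j\<in>I <+> UNIV. ?c j * p (?A j) w) = (\<Sum>i\<in>I. c i * p (A i) w) - p B w + p C w" for w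
    unfolding plus by simp
  moreover have "(\<integral>x. (\<Sum>j\<in>I <+> UNIV. ?c j * indicator (?A j) x)\<^sup>2 \<partial>M) = (\<integral>x. (F x - clamp1 (F x))\<^sup>2 \<partial>M)"
  proof (rule Bochner_Integration.integral_cong[OF refl])
    fix x assume x: "x \<in> space M"
    have "(\<Sum>j\<in>I <+> UNIV. ?c j * indicator (?A j) x) = F x - indicator B x + indicator C x"
      unfolding plus F_def by simp
    moreover have "indicator B x - indicator C x = clamp1 (F x)"
      using clamp1_cases[of "F x"] x unfolding B_def C_def by (auto simp: indicator_def)
    ultimately have "(\<Sum>j\<in>I <+> UNIV. ?c j * indicator (?A j) x) = F x - clamp1 (F x)" by linarith
    then show "(\<Sum>j\<in>I <+> UNIV. ?c j * indicator (?A j) x)\<^sup>2 = (F x - clamp1 (F x))\<^sup>2"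
      by (rule arg_cong)
  qed
  moreover have "B \<inter> C = {}" unfolding B_def C_def by auto
  ultimately show ?thesis using that[OF BC] unfolding F_def by simp
qed

text \<open>The variance is the integral of the square of an integer-valued function that is nonzero
  wherever \<open>B, B'\<close> or \<open>C, C'\<close> differ, and has square 4 only where both
  pairs differ. So distance of signed statistics and distance of sets control each other.\<close>

lemma variance_signed_bounds:
  assumes f: "B \<in> fin" "C \<in> fin" "B' \<in> fin" "C' \<in> fin" and d: "B \<inter> C = {}" "B' \<inter> C' = {}"
  defines "V \<equiv> variance (\<lambda>w. (p B w - p C w) - (p B' w - p C' w))"
  shows "measure M (sym_diff B B') \<le> V" "measure M (sym_diff C C') \<le> V"
    "V \<le> 2 * measure M (sym_diff B B') + 2 * measure M (sym_diff C C')"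
proof -
  let ?A = "\<lambda>i. [B, C, B', C'] ! i" and ?c = "\<lambda>i. [1, -1, -1, 1 :: real] ! i"
  have four: "(\<Sum>i<4. h i) = h 0 + h 1 + h 2 + h 3" for h :: "nat \<Rightarrow> real"
    by (simp add: eval_nat_numeral)
  have fin: "?A i \<in> fin" if "i \<in> {..<4}" for i
    using that f by (auto simp: eval_nat_numeral less_Suc_eq)
  define G where "G x = (indicator B x - indicator C x - (indicator B' x - indicator C' x) :: real)" for x
  have e1: "(\<Sum>i<4. ?c i * p (?A i) w) = (p B w - p C w) - (p B' w - p C' w)" for w
    unfolding four by simp
  have e2: "(\<Sum>i<4. ?c i * indicator (?A i) x) = G x" for x
    unfolding four G_def by simp
  have V: "V = (\<integral>x. (G x)\<^sup>2 \<partial>M)"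
    using variance_p_lin[where I="{..<4}" and A="?A" and c="?c", OF fin] unfolding e1 e2 V_def .
  have "integrable M (\<lambda>x. (\<Sum>i<4. ?c i * indicator (?A i) x)\<^sup>2)"
    by (rule integrable_fun_lin[where I="{..<4}" and A="?A" and c="?c" and g="\<lambda>y. y\<^sup>2", OF _ fin]) auto
  then have iG: "integrable M (\<lambda>x. (G x)\<^sup>2)" unfolding e2 .
  have D: "sym_diff B B' \<in> fin" "sym_diff C C' \<in> fin" using f by auto
  have iD: "integrable M (indicator D :: 'a \<Rightarrow> real)" if "D \<in> fin" for D
    using that emeasure_fin_less_top[OF that] by (intro integrable_real_indicator) auto
  have mD: "measure M D = (\<integral>x. indicator D x \<partial>M)" if "D \<in> fin" for D using that by simp
  show "measure M (sym_diff B B') \<le> V" unfolding mD[OF D(1)] V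
    by (rule integral_mono[OF iD[OF D(1)] iG]) (use d in \<open>auto simp: G_def indicator_def split: if_splits\<close>)
  show "measure M (sym_diff C C') \<le> V" unfolding mD[OF D(2)] V
    by (rule integral_mono[OF iD[OF D(2)] iG]) (use d in \<open>auto simp: G_def indicator_def split: if_splits\<close>)
  have "V \<le> (\<integral>x. 2 * indicator (sym_diff B B') x + 2 * indicator (sym_diff C C') x \<partial>M)" unfolding V
  proof (rule integral_mono[OF iG])
    show "integrable M (\<lambda>x. 2 * indicator (sym_diff B B') x + 2 * indicator (sym_diff C C') x :: real)"
      using iD[OF D(1)] iD[OF D(2)] by simp
    show "(G x)\<^sup>2 \<le> 2 * indicator (sym_diff B B') x + 2 * indicator (sym_diff C C') x" for x
      using d by (auto simp: G_def indicator_def split: if_splits)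
  qed
  also have "\<dots> = 2 * measure M (sym_diff B B') + 2 * measure M (sym_diff C C')"
    using iD[OF D(1)] iD[OF D(2)] D by simp
  finally show "V \<le> 2 * measure M (sym_diff B B') + 2 * measure M (sym_diff C C')" .
qed

text \<open>A point on which \<open>B N\<close> and the lower limit \<open>L\<close> disagree must
  change its membership at some step from \<open>N\<close> on; the measures of these changes sum to
  at most \<open>2 * (1/2)^N\<close>.\<close>

lemma fin_limit:
  fixes B :: "nat \<Rightarrow> 'a set"
  assumes B: "\<And>n. B n \<in> fin" and d: "\<And>n. measure M (sym_diff (B n) (B (Suc n))) \<le> (1/2)^n"
  defines "L \<equiv> {x \<in> space M. \<exists>N. \<forall>n\<ge>N. x \<in> B n}"
  shows "L \<in> fin" "measure M (sym_diff (B N) L) \<le> 2 * (1/2)^N"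
proof -
  let ?D = "\<lambda>n. sym_diff (B n) (B (Suc n))"
  have [measurable]: "B n \<in> sets M" for n using B by simp
  have L[measurable]: "L \<in> sets M" unfolding L_def by measurable
  have D: "?D n \<in> fin" for n using B by auto
  have sub: "sym_diff (B N) L \<subseteq> (\<Union>n. ?D (N + n))" for N
  proof (rule ccontr)
    assume "\<not> sym_diff (B N) L \<subseteq> (\<Union>n. ?D (N + n))"
    then obtain x where x: "x \<in> sym_diff (B N) L" "\<And>n. x \<notin> ?D (N + n)" by blast
    have "x \<in> B (N + n) \<longleftrightarrow> x \<in> B N" for n
    proof (induction n)
      case (Suc n)
      then show ?case using x(2)[of n] by auto
    qed simp
    then have const: "x \<in> B n \<longleftrightarrow> x \<in> B N" if "N \<le> n" for n using that by (metis le_add_diff_inverse)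
    have "x \<in> space M" using x(1) sets.sets_into_space[of "B N" M] L_def by auto
    moreover have "x \<in> B N" if "\<forall>n\<ge>N'. x \<in> B n" for N'
      using that const[of "max N N'"] by auto
    ultimately have "x \<in> L \<longleftrightarrow> x \<in> B N" unfolding L_def using const by blast
    with x(1) show False by auto
  qed
  have em: "emeasure M (sym_diff (B N) L) \<le> ennreal (2 * (1/2)^N)" for N
  proof -
    have g: "(\<lambda>n. (1/2)^(N + n) :: real) sums ((1/2)^N * 2)"
      using sums_mult[OF geometric_sums[of "1/2::real"], of "(1/2)^N"] by (simp add: power_add)
    have "emeasure M (sym_diff (B N) L) \<le> emeasure M (\<Union>n. ?D (N + n))"
      using sub D by (intro emeasure_mono) auto
    also have "\<dots> \<le> (\<Sum>n. emeasure M (?D (N + n)))"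
      by (rule emeasure_subadditive_countably) auto
    also have "\<dots> \<le> (\<Sum>n. ennreal ((1/2)^(N + n)))"
      using d by (intro suminf_le) (auto simp: emeasure_fin[OF D] intro!: ennreal_leI)
    also have "\<dots> = ennreal (2 * (1/2)^N)"
      using g by (subst suminf_ennreal2) (auto simp: sums_iff mult.commute)
    finally show ?thesis .
  qed
  have S: "sym_diff (B N) L \<in> fin" for N
    using em[of N] by (intro finI) (auto intro: le_less_trans)
  have "L \<subseteq> B 0 \<union> sym_diff (B 0) L" by auto
  then show "L \<in> fin" using fin_subset[OF fin_Un[OF B S] L] by blast
  show "measure M (sym_diff (B N) L) \<le> 2 * (1/2)^N"
    using em[of N] unfolding emeasure_fin[OF S] by (simp add: ennreal_le_iff del: ennreal_le_iff2)
qed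

lemma expectation_p_comp:
  fixes g :: "real \<Rightarrow> 'b::{banach, second_countable_topology}"
  assumes "A \<in> fin" "s \<in> measurable \<Omega> \<Omega>" "distr \<Omega> \<Omega> s = \<Omega>" "g \<in> borel_measurable borel"
  shows "(\<integral>w. g (p A (s w)) \<partial>\<Omega>) = (\<integral>w. g (p A w) \<partial>\<Omega>)"
  using integral_distr[of s \<Omega> \<Omega> "\<lambda>w. g (p A w)"] assms by simp

lemma variance_p: "A \<in> fin \<Longrightarrow> variance (p A) = measure M A"
  using variance_eq[of "p A"] integrable_p2[of A] by (simp add: expectation_p expectation_p2)

text \<open>An element of the first chaos with the law of \<open>p A\<close> is close to an integer-valued linear
  statistic since its characteristic function has modulus one at \<open>2\<pi>\<close>, and its value at \<open>\<pi>\<close>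
  together with the variance forces the coefficients to be \<open>-1, 0, 1\<close>.\<close>

lemma poisson_H_approx:
  assumes f: "(\<lambda>w. p A (s w)) \<in> poisson_H M \<Omega> P"
    and A: "A \<in> fin" and s: "s \<in> measurable \<Omega> \<Omega>" "distr \<Omega> \<Omega> s = \<Omega>" and e: "0 < e"
  obtains B C where "B \<in> fin" "C \<in> fin" "B \<inter> C = {}" "variance (\<lambda>w. p A (s w) - (p B w - p C w)) < e"
proof -
  let ?f = "\<lambda>w. p A (s w)"
  define al where "al = measure M A"
  have al: "0 \<le> al" by (simp add: al_def)
  have fL: "?f \<in> L2_functions \<Omega>" using f unfolding poisson_H_def L2_closed_span_def by auto
  have Ef: "expectation ?f = al" using expectation_p_comp[OF A s, of "\<lambda>x. x"] expectation_p[OF A] by (simp add: al_def)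
  have vf: "variance ?f = al"
    unfolding Ef using expectation_p_comp[OF A s, of "\<lambda>x. (x - al)\<^sup>2"] variance_p[OF A] expectation_p[OF A]
    by (simp add: al_def)
  have cf: "norm (CLINT w|\<Omega>. cis (c * ?f w)) = exp (- (al * (1 - cos c)))" for c
  proof -
    have "(CLINT w|\<Omega>. cis (c * ?f w)) = (CLINT w|\<Omega>. cis (c * p A w))"
      by (rule expectation_p_comp[OF A s]) measurable
    then show ?thesis using norm_char_p[OF A] by (simp add: al_def)
  qed
  \<comment> \<open>Chosen to make the limiting error \<open>4 * al * (2 * t + t * t)\<close>, at
    most \<open>12 * al * t\<close>, smaller than \<open>e\<close>; 13 gives the strict inequality
    and \<open>al + 1\<close> allows \<open>al = 0\<close>.\<close>
  define t where "t = min 1 (e / (13 * (al + 1)))"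
  have t: "0 < t" "t \<le> 1" using e al unfolding t_def by auto
  obtain K where K: "0 \<le> K"
    "\<And>d. (d - clamp1 d)\<^sup>2 \<le> 2 * ((1 + t) * d\<^sup>2 - (1 - cos (pi * d)) / 2) + K * (1 - cos (2 * pi * d))"
    using clamp1_bound[OF t(1)] by metis
  \<comment> \<open>If the linear statistic is within \<open>\<delta>\<close> of
    \<open>p A \<circ> s\<close>, then \<open>V \<delta>\<close> bounds its variance, the logarithms
    bound the exponents at \<open>pi\<close> and \<open>2 * pi\<close>, and
    \<open>R \<delta>\<close> is the resulting total error. At \<open>\<delta> = 0\<close> half of
    the first logarithm is \<open>- al\<close> and cancels the variance, leaving only terms with a
    factor \<open>t\<close>.\<close>
  define V where "V \<delta> = (1 + t) * al + (1 + 1 / t) * \<delta>\<^sup>2" for \<delta> :: real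
  define R where "R \<delta> = 2 * \<delta>\<^sup>2 + 2 * (2 * ((1 + t) * V \<delta> + ln (exp (- 2 * al) + pi * \<delta>) / 2) + K * (- ln (1 - 2 * pi * \<delta>)))"
    for \<delta> :: real
  have "(R \<longlongrightarrow> R 0) (at_right 0)"
    unfolding R_def V_def by (intro tendsto_intros) auto
  moreover have "R 0 < e"
  proof -
    have "R 0 = 4 * al * (2 * t + t * t)" unfolding R_def V_def by (simp add: algebra_simps)
    also have "\<dots> \<le> 4 * al * (3 * t)" using t al by (intro mult_left_mono) auto
    also have "\<dots> \<le> 12 * (al * (e / (13 * (al + 1))))"
      using mult_left_mono[OF min.cobounded2[of 1 "e / (13 * (al + 1))"] al] unfolding t_def by linarith
    also have "\<dots> < e" using al e by (simp add: field_simps add_nonneg_pos)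
    finally show ?thesis .
  qed
  ultimately have "eventually (\<lambda>\<delta>. R \<delta> < e) (at_right 0)" by (rule order_tendstoD(2))
  moreover have "eventually (\<lambda>\<delta>. \<delta> < 1 / (2 * pi)) (at_right (0::real))"
    by (rule order_tendstoD(2)[OF tendsto_ident_at]) simp
  moreover have "eventually (\<lambda>\<delta>. 0 < \<delta>) (at_right (0::real))" by (rule eventually_at_right_less)
  ultimately have "eventually (\<lambda>\<delta>. R \<delta> < e \<and> \<delta> < 1 / (2 * pi) \<and> 0 < \<delta>) (at_right 0)"
    by eventually_elim blast
  from eventually_happens'[OF trivial_limit_at_right_real this]
  obtain \<delta> where \<delta>: "R \<delta> < e" "\<delta> < 1 / (2 * pi)" "0 < \<delta>" by (elim exE conjE)
  obtain I c where I: "finite I" "I \<subseteq> fin" "L2_norm \<Omega> (\<lambda>w. ?f w - (\<Sum>D\<in>I. c D * p D w)) < \<delta>"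
    by (rule poisson_HE[OF f \<delta>(3)])
  have If: "D \<in> fin" if "D \<in> I" for D using I(2) that by auto
  define X where "X w = (\<Sum>D\<in>I. c D * p D w)" for w
  define F where "F x = (\<Sum>D\<in>I. c D * indicator D x)" for x
  have XL: "X \<in> L2_functions \<Omega>" unfolding X_def by (rule p_lin_L2) (rule If)
  have fX: "L2_norm \<Omega> (\<lambda>w. ?f w - X w) \<le> \<delta>" using I(3) unfolding X_def by simp
  have vfX: "variance (\<lambda>w. ?f w - X w) \<le> \<delta>\<^sup>2"
  proof -
    have "variance (\<lambda>w. ?f w - X w) \<le> expectation (\<lambda>w. (?f w - X w)\<^sup>2)"
      by (rule variance_le_square[OF L2_diff[OF fL XL]])
    also have "\<dots> = (L2_norm \<Omega> (\<lambda>w. ?f w - X w))\<^sup>2" unfolding L2_norm_def by simp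
    also have "\<dots> \<le> \<delta>\<^sup>2" using fX by (intro power_mono) (auto simp: L2_norm_def)
    finally show ?thesis .
  qed
  have iF: "integrable M (\<lambda>x. g (F x))" if "g \<in> borel_measurable borel" "g 0 = 0" for g :: "real \<Rightarrow> real"
    unfolding F_def by (rule integrable_fun_lin[OF I(1) If that])
  define v where "v = (\<integral>x. (F x)\<^sup>2 \<partial>M)"
  define w1 where "w1 = (\<integral>x. (1 - cos (2 * pi * F x)) \<partial>M)"
  define w2 where "w2 = (\<integral>x. (1 - cos (pi * F x)) \<partial>M)"
  have "v = variance X" unfolding v_def F_def X_def by (rule variance_p_lin[symmetric]) (rule If)
  also have "\<dots> = variance (\<lambda>w. ?f w + (- 1) * (?f w - X w))" by simp
  also have "\<dots> \<le> (1 + t) * variance ?f + (1 + 1 / t) * variance (\<lambda>w. (- 1) * (?f w - X w))"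
    by (rule variance_add_le[OF fL L2_cmult[OF L2_diff[OF fL XL]] t(1)])
  also have "variance (\<lambda>w. (- 1) * (?f w - X w)) = variance (\<lambda>w. ?f w - X w)"
    unfolding integral_mult_right_zero right_diff_distrib[symmetric] power_mult_distrib by simp
  also have "(1 + t) * variance ?f + (1 + 1 / t) * variance (\<lambda>w. ?f w - X w) \<le> V \<delta>"
    unfolding V_def vf using vfX t by (intro add_left_mono mult_left_mono) auto
  finally have v: "v \<le> V \<delta>" .
  have cX: "norm (CLINT w|\<Omega>. cis (b * X w)) = exp (- (\<integral>x. (1 - cos (b * F x)) \<partial>M))" for b
    using norm_char_p_lin[OF I(1) If, where c="\<lambda>D. b * c D"]
    by (simp add: X_def F_def sum_distrib_left mult.assoc)
  have cd: "\<bar>norm (CLINT w|\<Omega>. cis (b * ?f w)) - norm (CLINT w|\<Omega>. cis (b * X w))\<bar> \<le> b * \<delta>" if "0 \<le> b" for b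
    using norm_expectation_cis_diff_le[OF fL XL fX, of b] norm_triangle_ineq3 that
    by (metis abs_of_nonneg order_trans)
  \<comment> \<open>At \<open>pi\<close> the Poisson law has modulus \<open>exp (- 2 * al)\<close>;
    at \<open>2 * pi\<close> below it has modulus 1, the mark of an integer-valued variable.\<close>
  have "exp (- w2) \<le> exp (- 2 * al) + pi * \<delta>"
    using cd[of pi] unfolding cf cX w2_def[symmetric] by (simp add: mult.commute)
  then have "ln (exp (- w2)) \<le> ln (exp (- 2 * al) + pi * \<delta>)"
    using \<delta> by (subst ln_le_cancel_iff) (auto intro: add_pos_nonneg)
  then have w2: "- w2 \<le> ln (exp (- 2 * al) + pi * \<delta>)" by simp
  have pos: "0 < 1 - 2 * pi * \<delta>" using \<delta>(2) by (simp add: field_simps)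
  have "1 - 2 * pi * \<delta> \<le> exp (- w1)"
    using cd[of "2 * pi"] unfolding cf cX w1_def[symmetric] by simp
  then have "ln (1 - 2 * pi * \<delta>) \<le> ln (exp (- w1))"
    using pos by (subst ln_le_cancel_iff) auto
  then have w1: "w1 \<le> - ln (1 - 2 * pi * \<delta>)" by simp
  have "(\<integral>x. (F x - clamp1 (F x))\<^sup>2 \<partial>M)
      \<le> (\<integral>x. 2 * ((1 + t) * (F x)\<^sup>2 - (1 - cos (pi * F x)) / 2) + K * (1 - cos (2 * pi * F x)) \<partial>M)"
  proof (rule integral_mono)
    show "integrable M (\<lambda>x. (F x - clamp1 (F x))\<^sup>2)"
      by (rule iF[of "\<lambda>d. (d - clamp1 d)\<^sup>2"]) (measurable, simp add: clamp1_def)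
    show "integrable M (\<lambda>x. 2 * ((1 + t) * (F x)\<^sup>2 - (1 - cos (pi * F x)) / 2) + K * (1 - cos (2 * pi * F x)))"
      by (rule iF[of "\<lambda>d. 2 * ((1 + t) * d\<^sup>2 - (1 - cos (pi * d)) / 2) + K * (1 - cos (2 * pi * d))"]) auto
  qed (rule K(2))
  also have "\<dots> = 2 * ((1 + t) * v - w2 / 2) + K * w1"
  proof -
    have lin: "(\<integral>x. 2 * ((1 + t) * a x - b x / 2) + K * d x \<partial>M)
        = 2 * ((1 + t) * (\<integral>x. a x \<partial>M) - (\<integral>x. b x \<partial>M) / 2) + K * (\<integral>x. d x \<partial>M)"
      if "integrable M a" "integrable M b" "integrable M d" for a b d :: "'a \<Rightarrow> real"
      using that by simp
    show ?thesis unfolding v_def w1_def w2_def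
      by (rule lin; rule iF[of "\<lambda>d. d\<^sup>2"] iF[of "\<lambda>d. 1 - cos (pi * d)"] iF[of "\<lambda>d. 1 - cos (2 * pi * d)"]; simp)
  qed
  also have "\<dots> \<le> 2 * ((1 + t) * V \<delta> + ln (exp (- 2 * al) + pi * \<delta>) / 2) + K * (- ln (1 - 2 * pi * \<delta>))"
  proof -
    have "(1 + t) * v \<le> (1 + t) * V \<delta>" using v t by (intro mult_left_mono) auto
    moreover have "K * w1 \<le> K * (- ln (1 - 2 * pi * \<delta>))" using w1 K(1) by (rule mult_left_mono)
    ultimately show ?thesis using w2 by argo
  qed
  finally have small: "(\<integral>x. (F x - clamp1 (F x))\<^sup>2 \<partial>M)
      \<le> 2 * ((1 + t) * V \<delta> + ln (exp (- 2 * al) + pi * \<delta>) / 2) + K * (- ln (1 - 2 * pi * \<delta>))" .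
  obtain B C where BC: "B \<in> fin" "C \<in> fin" "B \<inter> C = {}"
    "variance (\<lambda>w. X w - p B w + p C w) = (\<integral>x. (F x - clamp1 (F x))\<^sup>2 \<partial>M)"
    unfolding X_def F_def by (rule clamp_p_lin[OF I(1) If, where c=c])
  have XBC: "(\<lambda>w. X w - p B w + p C w) \<in> L2_functions \<Omega>"
    using XL BC by (intro L2_add L2_diff) auto
  have "variance (\<lambda>w. ?f w - (p B w - p C w)) = variance (\<lambda>w. (?f w - X w) + (X w - p B w + p C w))"
    by (simp add: algebra_simps)
  also have "\<dots> \<le> (1 + 1) * variance (\<lambda>w. ?f w - X w) + (1 + 1 / 1) * variance (\<lambda>w. X w - p B w + p C w)"
    by (rule variance_add_le[OF L2_diff[OF fL XL] XBC]) simp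
  also have "\<dots> \<le> R \<delta>" using vfX small unfolding R_def BC(4) by argo
  also have "\<dots> < e" by (rule \<delta>(1))
  finally show ?thesis using that[OF BC(1-3)] by blast
qed

text \<open>With \<open>measure M C > 0\<close> the product is positive for every \<open>k\<close>,
  so \<open>p B - p C\<close> is unbounded below; this is used to exclude a negative part.\<close>

lemma prob_p_zero_and_eq:
  assumes f: "B \<in> fin" "C \<in> fin" "B \<inter> C = {}"
  shows "prob {w \<in> space \<Omega>. p B w = 0 \<and> p C w = real k} =
    prob {w \<in> space \<Omega>. p B w = 0} * prob {w \<in> space \<Omega>. p C w = real k}"
proof -
  let ?A = "\<lambda>b. if b then B else C" and ?E = "\<lambda>b. if b then {0} else {real k}"
  obtain Q where Q: "indep_vars (\<lambda>_. borel) Q UNIV" "\<And>b. AE w in \<Omega>. Q b w = p (?A b) w"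
  proof (rule indep_p[of UNIV ?A])
    show "?A b \<in> fin" for b using f by simp
    show "disjoint_family_on ?A UNIV" using f(3) unfolding disjoint_family_on_def by auto
  qed blast
  have Qm[measurable]: "Q b \<in> borel_measurable \<Omega>" for b using Q(1) unfolding indep_vars_def by auto
  have pm[measurable]: "p B \<in> borel_measurable \<Omega>" "p C \<in> borel_measurable \<Omega>" using f by auto
  have "prob (\<Inter>b\<in>UNIV. Q b -` ?E b \<inter> space \<Omega>) = (\<Prod>b\<in>UNIV. prob (Q b -` ?E b \<inter> space \<Omega>))"
    by (rule indep_varsD[OF Q(1)]) auto
  moreover have "prob (\<Inter>b\<in>UNIV. Q b -` ?E b \<inter> space \<Omega>) = prob {w \<in> space \<Omega>. p B w = 0 \<and> p C w = real k}"
  proof (rule measure_eq_AE)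
    show "AE w in \<Omega>. w \<in> (\<Inter>b\<in>UNIV. Q b -` ?E b \<inter> space \<Omega>) \<longleftrightarrow> w \<in> {w \<in> space \<Omega>. p B w = 0 \<and> p C w = real k}"
      using Q(2)[of True] Q(2)[of False] by eventually_elim (auto simp: UNIV_bool)
  qed measurable
  moreover have "prob (Q True -` ?E True \<inter> space \<Omega>) = prob {w \<in> space \<Omega>. p B w = 0}"
  proof (rule measure_eq_AE)
    show "AE w in \<Omega>. w \<in> Q True -` ?E True \<inter> space \<Omega> \<longleftrightarrow> w \<in> {w \<in> space \<Omega>. p B w = 0}"
      using Q(2)[of True] AE_space by eventually_elim auto
  qed measurable
  moreover have "prob (Q False -` ?E False \<inter> space \<Omega>) = prob {w \<in> space \<Omega>. p C w = real k}"
  proof (rule measure_eq_AE)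
    show "AE w in \<Omega>. w \<in> Q False -` ?E False \<inter> space \<Omega> \<longleftrightarrow> w \<in> {w \<in> space \<Omega>. p C w = real k}"
      using Q(2)[of False] AE_space by eventually_elim auto
  qed measurable
  ultimately show ?thesis by (simp add: UNIV_bool mult.commute)
qed

lemma poisson_H_eq_p:
  assumes f: "(\<lambda>w. p A (s w)) \<in> poisson_H M \<Omega> P"
    and A: "A \<in> fin" and s: "s \<in> measurable \<Omega> \<Omega>" "distr \<Omega> \<Omega> s = \<Omega>"
  obtains B where "B \<in> fin" "AE w in \<Omega>. p A (s w) = p B w"
proof -
  let ?f = "\<lambda>w. p A (s w)"
  have fL: "?f \<in> L2_functions \<Omega>" using f unfolding poisson_H_def L2_closed_span_def by auto
  have Ef: "expectation ?f = measure M A" using expectation_p_comp[OF A s, of "\<lambda>x. x"] expectation_p[OF A] by simp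
  have vf: "variance ?f = measure M A"
    unfolding Ef using expectation_p_comp[OF A s, of "\<lambda>x. (x - measure M A)\<^sup>2"] variance_p[OF A] expectation_p[OF A] by simp
  \<comment> \<open>The quarter absorbs the factors 2 of \<open>variance_diff_le\<close>, so that
    consecutive approximants differ by at most \<open>(1/2)^n\<close>, as \<open>fin_limit\<close>
    demands.\<close>
  define good where "good n D \<longleftrightarrow> fst D \<in> fin \<and> snd D \<in> fin \<and> fst D \<inter> snd D = {} \<and>
      variance (\<lambda>w. ?f w - (p (fst D) w - p (snd D) w)) < (1/2)^n / 4" for n :: nat and D
  have "\<exists>D. good n D" for n
  proof (rule poisson_H_approx[OF f A s, of "(1/2)^n / 4"])
    fix B C assume "B \<in> fin" "C \<in> fin" "B \<inter> C = {}" "variance (\<lambda>w. ?f w - (p B w - p C w)) < (1/2)^n / 4"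
    then show ?thesis by (intro exI[of _ "(B, C)"]) (simp add: good_def)
  qed simp
  then obtain D where D: "\<And>n. good n (D n)" by metis
  define B where "B n = fst (D n)" for n
  define C where "C n = snd (D n)" for n
  have BC: "B n \<in> fin" "C n \<in> fin" "B n \<inter> C n = {}"
    and V: "variance (\<lambda>w. ?f w - (p (B n) w - p (C n) w)) < (1/2)^n / 4" for n
    using D[of n] unfolding B_def C_def good_def by blast+
  have BCL: "(\<lambda>w. p (B n) w - p (C n) w) \<in> L2_functions \<Omega>" for n using BC by (intro L2_diff) auto
  note fBC = L2_diff[OF fL BCL]
  have step: "variance (\<lambda>w. (p (B n) w - p (C n) w) - (p (B (Suc n)) w - p (C (Suc n)) w)) \<le> (1/2)^n" for n
  proof -
    have "variance (\<lambda>w. (?f w - (p (B (Suc n)) w - p (C (Suc n)) w)) - (?f w - (p (B n) w - p (C n) w)))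
        \<le> 2 * variance (\<lambda>w. ?f w - (p (B (Suc n)) w - p (C (Suc n)) w)) + 2 * variance (\<lambda>w. ?f w - (p (B n) w - p (C n) w))"
      by (rule variance_diff_le[OF fBC fBC])
    also have "\<dots> \<le> 2 * ((1/2)^Suc n / 4) + 2 * ((1/2)^n / 4)" using V[of n] V[of "Suc n"] by linarith
    also have "\<dots> \<le> (1/2)^n" by simp
    finally show ?thesis by (simp add: algebra_simps)
  qed
  define B' where "B' = {x \<in> space M. \<exists>N. \<forall>n\<ge>N. x \<in> B n}"
  define C' where "C' = {x \<in> space M. \<exists>N. \<forall>n\<ge>N. x \<in> C n}"
  have dB: "measure M (sym_diff (B n) (B (Suc n))) \<le> (1/2)^n" and dC: "measure M (sym_diff (C n) (C (Suc n))) \<le> (1/2)^n" for n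
    using variance_signed_bounds(1,2)[OF BC(1) BC(2) BC(1) BC(2) BC(3) BC(3), of n "Suc n"] step[of n] by linarith+
  have B': "B' \<in> fin" "\<And>n. measure M (sym_diff (B n) B') \<le> 2 * (1/2)^n"
    unfolding B'_def by (rule fin_limit[OF BC(1) dB])+
  have C': "C' \<in> fin" "\<And>n. measure M (sym_diff (C n) C') \<le> 2 * (1/2)^n"
    unfolding C'_def by (rule fin_limit[OF BC(2) dC])+
  have disj: "B' \<inter> C' = {}"
  proof (rule ccontr)
    assume "B' \<inter> C' \<noteq> {}"
    then obtain x N N' where "\<forall>n\<ge>N. x \<in> B n" "\<forall>n\<ge>N'. x \<in> C n" unfolding B'_def C'_def by blast
    then have "x \<in> B (max N N') \<inter> C (max N N')" by simp
    then show False using BC(3) by blast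
  qed
  have L': "(\<lambda>w. p B' w - p C' w) \<in> L2_functions \<Omega>" using B' C' by (intro L2_diff) auto
  note fL' = L2_diff[OF fL L']
  \<comment> \<open>17 exceeds 2 times 1/4 plus 2 times 8; the 8 comes from the limit error
    \<open>2 * (1/2)^n\<close> of each of the two set sequences.\<close>
  have "variance (\<lambda>w. ?f w - (p B' w - p C' w)) \<le> 17 * (1/2)^n" for n
  proof -
    have "variance (\<lambda>w. (?f w - (p (B n) w - p (C n) w)) + ((p (B n) w - p (C n) w) - (p B' w - p C' w)))
      \<le> (1 + 1) * variance (\<lambda>w. ?f w - (p (B n) w - p (C n) w))
        + (1 + 1 / 1) * variance (\<lambda>w. (p (B n) w - p (C n) w) - (p B' w - p C' w))"
      by (rule variance_add_le[OF fBC L2_diff[OF BCL L']]) simp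
    also have "variance (\<lambda>w. (p (B n) w - p (C n) w) - (p B' w - p C' w)) \<le> 8 * (1/2)^n"
      using variance_signed_bounds(3)[OF BC(1) BC(2) B'(1) C'(1) BC(3) disj, of n] B'(2)[of n] C'(2)[of n] by linarith
    also have "(1 + 1) * variance (\<lambda>w. ?f w - (p (B n) w - p (C n) w)) + (1 + 1 / 1) * (8 * (1/2)^n) \<le> 17 * (1/2)^n"
    proof -
      have num: "(1 + 1) * a + (1 + 1 / 1) * (8 * q) \<le> 17 * q" if "a < q / 4" "0 \<le> q" for a q :: real using that by argo
      show ?thesis by (rule num[OF V]) simp
    qed
    finally have "variance (\<lambda>w. (?f w - (p (B n) w - p (C n) w)) + ((p (B n) w - p (C n) w) - (p B' w - p C' w))) \<le> 17 * (1/2)^n"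
      by simp
    then show ?thesis by (simp add: algebra_simps)
  qed
  moreover have "(\<lambda>n. 17 * (1/2)^n :: real) \<longlonglongrightarrow> 0" using tendsto_mult_left[OF LIMSEQ_power_zero[of "1/2::real"], of 17] by simp
  ultimately have "variance (\<lambda>w. ?f w - (p B' w - p C' w)) \<le> 0"
    by (intro LIMSEQ_le_const[of "\<lambda>n. 17 * (1/2)^n :: real"]) auto
  then have "variance (\<lambda>w. ?f w - (p B' w - p C' w)) = 0"
    using variance_positive[of "\<lambda>w. ?f w - (p B' w - p C' w)"] by linarith
  from AE_const_if_variance_zero[OF fL' this] obtain c where c: "AE w in \<Omega>. ?f w - (p B' w - p C' w) = c" by blast
  have "measure M C' = 0"
  proof (rule ccontr)
    assume "measure M C' \<noteq> 0"
    then have pos: "0 < measure M C'" by (simp add: zero_less_measure_iff)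
    \<comment> \<open>With \<open>k\<close> above \<open>c\<close>, on the event \<open>?X\<close>
      the nonnegative value \<open>p A (s w)\<close> would equal \<open>c - k < 0\<close>.\<close>
    obtain k :: nat where k: "c < real k" using reals_Archimedean2 by blast
    let ?X = "{w \<in> space \<Omega>. p B' w = 0 \<and> p C' w = real k}"
    have [measurable]: "p B' \<in> borel_measurable \<Omega>" "p C' \<in> borel_measurable \<Omega>" using B' C' by auto
    have "0 < prob ?X"
      unfolding prob_p_zero_and_eq[OF B'(1) C'(1) disj]
      using prob_p_eq[OF B'(1), of 0] prob_p_eq[OF C'(1), of k] pos by simp
    moreover have "AE w in \<Omega>. w \<notin> ?X"
      using c
    proof eventually_elim
      case (elim w)
      show ?case
      proof
        assume "w \<in> ?X"
        then have "p A (s w) = c - real k" using elim by simp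
        moreover have "0 \<le> p A (s w)" by simp
        ultimately show False using k by linarith
      qed
    qed
    then have "prob ?X = 0" by (intro prob_eq_0[THEN iffD2]) auto
    ultimately show False by simp
  qed
  then have "C' \<in> null_sets M" using C'(1) by (simp add: null_sets_def emeasure_fin)
  from AE_P_null[OF this] c have fB: "AE w in \<Omega>. ?f w = p B' w + c"
    by eventually_elim (simp add: p_def algebra_simps)
  have [measurable]: "?f \<in> borel_measurable \<Omega>" using L2D(1)[OF fL] .
  have [measurable]: "p B' \<in> borel_measurable \<Omega>" using B' by simp
  have mean: "measure M A = measure M B' + c"
  proof -
    have "expectation ?f = expectation (\<lambda>w. p B' w + c)" by (rule integral_cong_AE) (use fB in auto)
    then show ?thesis unfolding Ef using B'(1) by (simp add: expectation_p prob_space)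
  qed
  \<comment> \<open>The constant does not affect the variance, and for a Poisson law the variance is
    again the measure; together with the means this forces \<open>c = 0\<close>.\<close>
  have "measure M A = measure M B'"
  proof -
    have "expectation (\<lambda>w. (?f w - measure M A)\<^sup>2) = expectation (\<lambda>w. (p B' w - measure M B')\<^sup>2)"
      by (rule integral_cong_AE) (use fB mean in auto)
    then show ?thesis using vf variance_p[OF B'(1)] unfolding Ef expectation_p[OF B'(1)] by simp
  qed
  with mean have "c = 0" by simp
  with fB show ?thesis using that[OF B'(1)] by simp
qed

section \<open>The base action of a Poissonian action\<close>

lemma AE_imp_if_measure_Int:
  assumes A: "A \<in> fin" and B: "B \<in> sets M" and eq: "measure M (A \<inter> B) = measure M A"
  shows "AE x in M. x \<in> A \<longrightarrow> x \<in> B"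
proof -
  have "measure M (A - B) = 0" using measure_split[OF A B] eq by simp
  then have "A - B \<in> null_sets M" using emeasure_fin[OF fin_Diff[OF A B]] A B by (simp add: null_sets_def)
  from AE_not_in[OF this] show ?thesis by eventually_elim auto
qed

lemma AE_disjoint_if_measure_Int:
  assumes A: "A \<in> fin" and B: "B \<in> sets M" and eq: "measure M (A \<inter> B) = 0"
  shows "AE x in M. \<not> (x \<in> A \<and> x \<in> B)"
proof -
  have "A \<inter> B \<in> null_sets M" using emeasure_fin[OF fin_Int[OF A B]] A B eq by (simp add: null_sets_def)
  from AE_not_in[OF this] show ?thesis by eventually_elim auto
qed

text \<open>The mixed moment determines the measure of \<open>A \<inter> B\<close>; if the two
  variables coincide it equals the measures of both sets.\<close>

lemma AE_iff_if_AE_P_eq: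
  assumes A: "A \<in> fin" and B: "B \<in> fin" and eq: "AE w in \<Omega>. P A w = P B w"
  shows "AE x in M. x \<in> A \<longleftrightarrow> x \<in> B"
proof -
  have p: "AE w in \<Omega>. p A w = p B w" using eq by eventually_elim (simp add: p_def)
  have a: "measure M A = measure M B"
    unfolding expectation_p[OF A, symmetric] expectation_p[OF B, symmetric]
    by (rule integral_cong_AE) (use A B p in auto)
  have "expectation (\<lambda>w. p A w * p B w) = expectation (\<lambda>w. p A w * p A w)"
    by (rule integral_cong_AE) (use A B p in auto)
  then have "measure M (A \<inter> B) = measure M A" "measure M (B \<inter> A) = measure M B"
    unfolding expectation_p_mult[OF A B] expectation_p_mult[OF A A] using a by (simp_all add: Int_commute)
  from AE_imp_if_measure_Int[OF A finD(1)[OF B] this(1)] AE_imp_if_measure_Int[OF B finD(1)[OF A] this(2)]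
  show ?thesis by eventually_elim blast
qed

lemma fin_cover:
  obtains X :: "nat \<Rightarrow> 'a set" where "\<And>n. X n \<in> fin" "(\<Union>n. X n) = space M" "disjoint_family X"
proof -
  obtain X :: "nat \<Rightarrow> 'a set" where "range X \<subseteq> sets M" "(\<Union>i. X i) = space M" "\<And>i. emeasure M (X i) \<noteq> \<infinity>" "disjoint_family X"
    using base.sigma_finite_disjoint by metis
  then show ?thesis by (intro that[of X]) (auto intro!: finI simp: less_top[symmetric])
qed

lemma AE_eq_if_AE_mem_fin:
  assumes "f \<in> measurable M M" "g \<in> measurable M M"
    and *: "\<And>A. A \<in> fin \<Longrightarrow> AE x in M. f x \<in> A \<longleftrightarrow> g x \<in> A"
  shows "AE x in M. f x = g x"
proof (rule AE_eq_if_AE_mem_iff[OF standard_borel_base assms(1,2)])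
  fix A assume A: "A \<in> sets M"
  obtain X :: "nat \<Rightarrow> 'a set" where X: "\<And>n. X n \<in> fin" "(\<Union>n. X n) = space M"
    using fin_cover by metis
  have "AE x in M. \<forall>n. f x \<in> X n \<inter> A \<longleftrightarrow> g x \<in> X n \<inter> A"
    unfolding AE_all_countable using *[OF fin_Int[OF X(1) A]] by blast
  then show "AE x in M. f x \<in> A \<longleftrightarrow> g x \<in> A"
    using AE_space
  proof eventually_elim
    case (elim x)
    have "f x \<in> (\<Union>n. X n)" "g x \<in> (\<Union>n. X n)"
      unfolding X(2) using elim(2) measurable_space[OF assms(1)] measurable_space[OF assms(2)] by auto
    then show ?case using elim(1) by blast
  qed
qed

text \<open>The hypotheses make \<open>\<Phi>\<close> an isometry that is onto modulo null sets;
  countable additivity is not among them and has to be extracted. As \<open>\<Phi>\<close> acts on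
  sets of finite measure only, it must also be extended before it can be realized by a point
  map.\<close>

lemma point_map_of_fin_map:
  assumes \<Phi>: "\<And>A. A \<in> fin \<Longrightarrow> \<Phi> A \<in> fin"
    and int: "\<And>A B. A \<in> fin \<Longrightarrow> B \<in> fin \<Longrightarrow> measure M (\<Phi> A \<inter> \<Phi> B) = measure M (A \<inter> B)"
    and surj: "\<And>B. B \<in> fin \<Longrightarrow> \<exists>C\<in>fin. AE x in M. x \<in> \<Phi> C \<longleftrightarrow> x \<in> B"
  obtains f where "f \<in> measurable M M" "distr M M f = M" "\<And>A. A \<in> fin \<Longrightarrow> AE x in M. f x \<in> A \<longleftrightarrow> x \<in> \<Phi> A"
proof -
  have meas: "measure M (\<Phi> A) = measure M A" if "A \<in> fin" for A using int[OF that that] by simp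
  have sub: "AE x in M. x \<in> \<Phi> A \<longrightarrow> x \<in> \<Phi> B" if "A \<in> fin" "B \<in> fin" "A \<subseteq> B" for A B
    using AE_imp_if_measure_Int[OF \<Phi>[OF that(1)], of "\<Phi> B"] int[OF that(1,2)] meas[OF that(1)] \<Phi>[OF that(2)] that(3)
    by (simp add: Int_absorb2)
  have disj: "AE x in M. \<not> (x \<in> \<Phi> A \<and> x \<in> \<Phi> B)" if "A \<in> fin" "B \<in> fin" "A \<inter> B = {}" for A B
    using AE_disjoint_if_measure_Int[OF \<Phi>[OF that(1)], of "\<Phi> B"] int[OF that(1,2)] \<Phi>[OF that(2)] that(3) by simp
  \<comment> \<open>Surjectivity gives an adjoint: intersections of \<open>D\<close> with images are
    measured by intersections of \<open>C\<close> with the originals.\<close>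
  have key: "\<exists>C\<in>fin. (AE x in M. x \<in> \<Phi> C \<longleftrightarrow> x \<in> D) \<and> (\<forall>A\<in>fin. measure M (C \<inter> A) = measure M (D \<inter> \<Phi> A))"
    if D: "D \<in> fin" for D
  proof -
    obtain C where C: "C \<in> fin" "AE x in M. x \<in> \<Phi> C \<longleftrightarrow> x \<in> D" using surj[OF D] by auto
    have "measure M (C \<inter> A) = measure M (D \<inter> \<Phi> A)" if A: "A \<in> fin" for A
    proof -
      have "measure M (\<Phi> C \<inter> \<Phi> A) = measure M (D \<inter> \<Phi> A)"
        by (rule measure_eq_AE) (use C A D \<Phi> in auto)
      then show ?thesis using int[OF C(1) A] by simp
    qed
    with C show ?thesis by blast
  qed
  \<comment> \<open>The pullback \<open>C\<close> of \<open>D\<close> misses every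
    \<open>A n\<close>, hence \<open>U\<close>; so \<open>D\<close> misses \<open>\<Phi> U\<close>,
    in which it is contained. Applied to the part of \<open>\<Phi> (\<Union>n. A n)\<close> outside
    all \<open>\<Phi> (A n)\<close>, this is countable additivity.\<close>
  have small: "D \<in> null_sets M"
    if D: "D \<in> fin" and A: "\<And>n::nat. A n \<in> fin" "\<And>n. D \<inter> \<Phi> (A n) = {}"
      and U: "U \<in> fin" "U \<subseteq> (\<Union>n. A n)" and DU: "D \<subseteq> \<Phi> U" for D A U
  proof -
    obtain C where C: "C \<in> fin" "\<And>A. A \<in> fin \<Longrightarrow> measure M (C \<inter> A) = measure M (D \<inter> \<Phi> A)"
      using key[OF D] by auto
    have "AE x in M. \<forall>n. \<not> (x \<in> C \<and> x \<in> A n)"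
      unfolding AE_all_countable
    proof
      fix n
      have "measure M (C \<inter> A n) = 0" using C(2)[OF A(1)] A(2) by simp
      then show "AE x in M. \<not> (x \<in> C \<and> x \<in> A n)"
        by (rule AE_disjoint_if_measure_Int[OF C(1) finD(1)[OF A(1)]])
    qed
    then have "measure M (C \<inter> U) = measure M {}"
      by (intro measure_eq_AE) (use U C(1) in \<open>auto elim!: eventually_mono\<close>)
    then have "measure M D = 0" using C(2)[OF U(1)] DU by (simp add: Int_absorb2)
    then show ?thesis using D emeasure_fin[OF D] by (simp add: null_sets_def)
  qed
  have union: "AE x in M. x \<in> \<Phi> (\<Union>n. A n) \<longleftrightarrow> (\<exists>n. x \<in> \<Phi> (A n))"
    if A: "\<And>n::nat. A n \<in> sets M" and U: "(\<Union>n. A n) \<in> fin" for A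
  proof -
    have Af: "A n \<in> fin" for n using fin_subset[OF U A] by blast
    have "AE x in M. \<forall>n. x \<in> \<Phi> (A n) \<longrightarrow> x \<in> \<Phi> (\<Union>n. A n)"
      unfolding AE_all_countable using sub[OF Af U] by blast
    moreover have "\<Phi> (\<Union>n. A n) - (\<Union>n. \<Phi> (A n)) \<in> null_sets M"
    proof (rule small[OF _ Af _ U order_refl])
      show "\<Phi> (\<Union>n. A n) - (\<Union>n. \<Phi> (A n)) \<in> fin"
        using \<Phi>[OF Af] by (intro fin_Diff \<Phi>[OF U]) auto
    qed auto
    note AE_not_in[OF this]
    ultimately show ?thesis by eventually_elim blast
  qed
  obtain X :: "nat \<Rightarrow> 'a set" where X: "\<And>n. X n \<in> fin" "(\<Union>n. X n) = space M" "disjoint_family X"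
    using fin_cover by metis
  have AX: "A \<inter> X n \<in> fin" if "A \<in> sets M" for A n using fin_Int[OF X(1) that] by (simp add: Int_commute)
  define \<Psi> where "\<Psi> A = (\<Union>n. \<Phi> (A \<inter> X n))" for A
  have \<Psi>: "\<Psi> A \<in> sets M" if "A \<in> sets M" for A
    unfolding \<Psi>_def using \<Phi>[OF AX[OF that]] by auto
  have \<Psi>\<Phi>: "AE x in M. x \<in> \<Psi> A \<longleftrightarrow> x \<in> \<Phi> A" if A: "A \<in> fin" for A
  proof -
    have e: "(\<Union>n. A \<inter> X n) = A" using X(2) sets.sets_into_space[OF finD(1)[OF A]] by blast
    have "AE x in M. x \<in> \<Phi> (\<Union>n. A \<inter> X n) \<longleftrightarrow> (\<exists>n. x \<in> \<Phi> (A \<inter> X n))"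
      by (rule union) (use A AX e in auto)
    then show ?thesis unfolding e \<Psi>_def by eventually_elim auto
  qed
  obtain f where f: "f \<in> measurable M M" and f\<Psi>: "\<And>A. A \<in> sets M \<Longrightarrow> AE x in M. f x \<in> A \<longleftrightarrow> x \<in> \<Psi> A"
  proof (rule point_realization[OF standard_borel_base space_base_nonempty, of \<Psi> M])
    show "\<Psi> A \<in> sets M" if "A \<in> sets M" for A by (rule \<Psi>[OF that])
    show "AE x in M. x \<in> \<Psi> (\<Union>n. A n) \<longleftrightarrow> (\<exists>n. x \<in> \<Psi> (A n))" if A: "range A \<subseteq> sets M" for A :: "nat \<Rightarrow> 'a set"
    proof -
      have An: "A n \<in> sets M" for n using A by auto
      have "AE x in M. x \<in> \<Phi> ((\<Union>n. A n) \<inter> X j) \<longleftrightarrow> (\<exists>n. x \<in> \<Phi> (A n \<inter> X j))" for j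
      proof -
        have e: "(\<Union>n. A n) \<inter> X j = (\<Union>n. A n \<inter> X j)" by auto
        have "(\<Union>n. A n) \<in> sets M" using An by auto
        from AX[OF this] show ?thesis unfolding e by (intro union) (use AX[OF An] in auto)
      qed
      then have "AE x in M. \<forall>j. x \<in> \<Phi> ((\<Union>n. A n) \<inter> X j) \<longleftrightarrow> (\<exists>n. x \<in> \<Phi> (A n \<inter> X j))"
        unfolding AE_all_countable by blast
      then show ?thesis by eventually_elim (auto simp: \<Psi>_def)
    qed
    show "AE x in M. x \<in> \<Psi> (space M - A) \<longleftrightarrow> x \<notin> \<Psi> A" if A: "A \<in> sets M" for A
    proof -
      have A': "space M - A \<in> sets M" using A by auto
      have "AE x in M. \<not> (x \<in> \<Phi> ((space M - A) \<inter> X i) \<and> x \<in> \<Phi> (A \<inter> X j))" for i j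
        by (rule disj[OF AX[OF A'] AX[OF A]]) auto
      then have d: "AE x in M. \<forall>i j. \<not> (x \<in> \<Phi> ((space M - A) \<inter> X i) \<and> x \<in> \<Phi> (A \<inter> X j))"
        unfolding AE_all_countable by blast
      \<comment> \<open>The whole space may have infinite measure, so covering is checked on each
        \<open>X k\<close>. As \<open>\<Phi>\<close> need not fix \<open>X k\<close>, a set
        \<open>C\<close> with image \<open>X k\<close> is cut by \<open>A\<close> instead.\<close>
      have "AE x in M. x \<in> X k \<longrightarrow> x \<in> \<Psi> A \<or> x \<in> \<Psi> (space M - A)" for k
      proof -
        obtain C where C: "C \<in> fin" "AE x in M. x \<in> \<Phi> C \<longleftrightarrow> x \<in> X k" using surj[OF X(1)] by auto
        have "AE x in M. x \<in> \<Phi> C \<longleftrightarrow> (\<exists>n::nat. x \<in> \<Phi> ((if n = 0 then A else space M - A) \<inter> C))"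
        proof -
          have e: "(\<Union>n::nat. (if n = 0 then A else space M - A) \<inter> C) = C"
            using sets.sets_into_space[OF finD(1)[OF C(1)]] by (auto split: if_splits intro: exI[of _ "Suc 0"])
          have s: "(if n = 0 then A else space M - A) \<inter> C \<in> sets M" for n :: nat using A C(1) by auto
          show ?thesis
            using union[of "\<lambda>n. (if n = 0 then A else space M - A) \<inter> C", unfolded e, OF s C(1)] .
        qed
        moreover have "AE x in M. x \<in> \<Phi> (B \<inter> C) \<longrightarrow> x \<in> \<Psi> B" if B: "B \<in> sets M" for B
        proof -
          have BC: "B \<inter> C \<in> fin" using fin_Int[OF C(1) B] by (simp add: Int_commute)
          have "AE x in M. \<forall>n. x \<in> \<Phi> (B \<inter> C \<inter> X n) \<longrightarrow> x \<in> \<Phi> (B \<inter> X n)"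
            unfolding AE_all_countable using sub[OF AX[OF finD(1)[OF BC]] AX[OF B]] by blast
          with \<Psi>\<Phi>[OF BC] show ?thesis by eventually_elim (auto simp: \<Psi>_def)
        qed
        note this[OF A] this[OF A']
        ultimately show ?thesis using C(2) by eventually_elim (metis (full_types))
      qed
      then have "AE x in M. \<forall>k. x \<in> X k \<longrightarrow> x \<in> \<Psi> A \<or> x \<in> \<Psi> (space M - A)"
        unfolding AE_all_countable by blast
      with d show ?thesis using AE_space
        by eventually_elim (use X(2) in \<open>auto simp: \<Psi>_def\<close>)
    qed
  qed blast
  have ff: "AE x in M. f x \<in> A \<longleftrightarrow> x \<in> \<Phi> A" if "A \<in> fin" for A
    using f\<Psi>[OF finD(1)[OF that]] \<Psi>\<Phi>[OF that] by eventually_elim simp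
  have emf: "emeasure M (vim M f A) = emeasure M A" if A: "A \<in> fin" for A
  proof -
    have "emeasure M (vim M f A) = emeasure M (\<Phi> A)"
      using A \<Phi>[OF A] measurable_sets[OF f finD(1)[OF A]]
      by (intro emeasure_eq_AE) (use ff[OF A] AE_space in \<open>auto elim!: eventually_elim2\<close>)
    then show ?thesis using meas[OF A] emeasure_fin[OF A] emeasure_fin[OF \<Phi>[OF A]] by simp
  qed
  have "distr M M f = M"
  proof (rule measure_eqI)
    fix A assume "A \<in> sets (distr M M f)"
    then have A: "A \<in> sets M" by simp
    have dX: "disjoint_family (\<lambda>n. A \<inter> X n)" using X(3) by (auto simp: disjoint_family_on_def)
    have "f x \<in> (\<Union>n. X n)" if "x \<in> space M" for x unfolding X(2) by (rule measurable_space[OF f that])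
    then have "vim M f A = (\<Union>n. vim M f (A \<inter> X n))" by blast
    then have "emeasure M (vim M f A) = (\<Sum>n. emeasure M (vim M f (A \<inter> X n)))"
      using dX measurable_sets[OF f finD(1)[OF AX[OF A]]]
      by (subst suminf_emeasure) (auto simp: disjoint_family_on_def)
    also have "\<dots> = (\<Sum>n. emeasure M (A \<inter> X n))" using emf[OF AX[OF A]] by simp
    also have "\<dots> = emeasure M (\<Union>n. A \<inter> X n)"
      using dX AX[OF A] by (intro suminf_emeasure) auto
    also have "(\<Union>n. A \<inter> X n) = A" using X(2) sets.sets_into_space[OF A] by blast
    finally show "emeasure (distr M M f) A = emeasure M A" using emeasure_distr[OF f A] by simp
  qed simp
  with f show ?thesis using ff by (rule that)
qed

lemma p_in_poisson_H: assumes A: "A \<in> fin" shows "p A \<in> poisson_H M \<Omega> P"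
proof (rule poisson_HI[OF p_L2[OF A]])
  fix e :: real assume "0 < e"
  then have "L2_norm \<Omega> (\<lambda>w. p A w - (\<Sum>i\<in>{A}. 1 * p i w)) < e" by (simp add: L2_norm_def)
  then show "\<exists>I D c. finite (I :: 'a set set) \<and> D ` I \<subseteq> fin \<and> L2_norm \<Omega> (\<lambda>w. p A w - (\<Sum>i\<in>I. c i * p (D i) w)) < e"
    using A by (intro exI[of _ "{A}"] exI[of _ "\<lambda>D. D"] exI[of _ "\<lambda>_. 1"]) simp
qed

lemma base_action_vim:
  assumes "base_action M \<Omega> P S T"
  shows "T g \<in> Aut M" "A \<in> sets M \<Longrightarrow> AE w in \<Omega>. P A (S g w) = P (vim M (T g) A) w"
  using assms unfolding base_action_def mp_action_def by blast+

lemma base_action_unique: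
  assumes T: "base_action M \<Omega> P S T" and T': "base_action M \<Omega> P S T'"
  shows "AE x in M. T g x = T' g x"
proof (rule AE_eq_if_AE_mem_fin)
  note A1 = base_action_vim[OF T] and A2 = base_action_vim[OF T']
  show "T g \<in> measurable M M" "T' g \<in> measurable M M" using AutD(1) A1(1) A2(1) by blast+
  fix A assume A: "A \<in> fin"
  have "AE w in \<Omega>. P (vim M (T g) A) w = P (vim M (T' g) A) w"
    using A1(2)[OF finD(1)[OF A], of g] A2(2)[OF finD(1)[OF A], of g] by eventually_elim simp
  from AE_iff_if_AE_P_eq[OF fin_vim[OF A1(1) A] fin_vim[OF A2(1) A] this]
  show "AE x in M. T g x \<in> A \<longleftrightarrow> T' g x \<in> A" using AE_space by eventually_elim simp
qed

lemma base_action_exists: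
  fixes S :: "'g::{topological_group_add, polish_space} \<Rightarrow> 'w \<Rightarrow> 'w"
  assumes S: "poissonian_action M \<Omega> P S"
  shows "\<exists>T. base_action M \<Omega> P S T"
proof -
  have act: "mp_action \<Omega> S" and H: "\<And>g f. f \<in> poisson_H M \<Omega> P \<Longrightarrow> koopman S g f \<in> poisson_H M \<Omega> P"
    using S unfolding poissonian_action_def by auto
  have SA: "S g \<in> Aut \<Omega>" for g using act unfolding mp_action_def by auto
  note Sm = AutD(1,2)[OF SA]
  have Sadd: "AE w in \<Omega>. S (g + h) w = S g (S h w)" for g h using act unfolding mp_action_def by blast
  have S0: "AE w in \<Omega>. S 0 w = w" by (rule mp_action_zero[OF act not_empty])
  have ex: "\<exists>B. B \<in> fin \<and> (AE w in \<Omega>. P A (S g w) = P B w)" if A: "A \<in> fin" for g A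
  proof -
    have "(\<lambda>w. p A (S g w)) \<in> poisson_H M \<Omega> P"
      using H[OF p_in_poisson_H[OF A], of "- g"] by (simp add: koopman_def o_def)
    then obtain B where B: "B \<in> fin" "AE w in \<Omega>. p A (S g w) = p B w"
      by (rule poisson_H_eq_p[OF _ A Sm])
    have "AE w in \<Omega>. P A (S g w) = P B w"
      using B(2) AE_P_eq_p[OF B(1)] distr_AE_iff[OF Sm AE_P_eq_p[OF A], of g] by eventually_elim simp
    with B(1) show ?thesis by blast
  qed
  define \<Phi> where "\<Phi> g A = (SOME B. B \<in> fin \<and> (AE w in \<Omega>. P A (S g w) = P B w))" for g A
  have \<Phi>: "\<Phi> g A \<in> fin" and P\<Phi>: "AE w in \<Omega>. P A (S g w) = P (\<Phi> g A) w" if "A \<in> fin" for g A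
    using someI_ex[OF ex[OF that, of g]] unfolding \<Phi>_def by blast+
  \<comment> \<open>\<open>\<Phi> g\<close> is going to be the preimage under \<open>T g\<close>,
    hence the reversed order.\<close>
  have comp: "AE x in M. x \<in> \<Phi> (g + h) A \<longleftrightarrow> x \<in> \<Phi> h (\<Phi> g A)" if A: "A \<in> fin" for g h A
  proof (rule AE_iff_if_AE_P_eq[OF \<Phi>[OF A] \<Phi>[OF \<Phi>[OF A]]])
    show "AE w in \<Omega>. P (\<Phi> (g + h) A) w = P (\<Phi> h (\<Phi> g A)) w"
      using P\<Phi>[OF A, of "g + h"] Sadd[of g h] distr_AE_iff[OF Sm P\<Phi>[OF A, of g], of h] P\<Phi>[OF \<Phi>[OF A, of g], of h]
      by eventually_elim simp
  qed
  have id: "AE x in M. x \<in> \<Phi> 0 A \<longleftrightarrow> x \<in> A" if A: "A \<in> fin" for A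
  proof (rule AE_iff_if_AE_P_eq[OF \<Phi>[OF A] A])
    show "AE w in \<Omega>. P (\<Phi> 0 A) w = P A w" using P\<Phi>[OF A, of 0] S0 by eventually_elim simp
  qed
  \<comment> \<open>\<open>S g\<close> preserves the means and the mixed moment, hence also the
    remaining term of \<open>expectation_p_mult\<close>, the measure of the intersection.\<close>
  have cov: "measure M (\<Phi> g A \<inter> \<Phi> g B) = measure M (A \<inter> B)" if A: "A \<in> fin" and B: "B \<in> fin" for g A B
  proof -
    have p: "AE w in \<Omega>. p (\<Phi> g A) w = p A (S g w)" if A: "A \<in> fin" for A
      using P\<Phi>[OF A, of g] by eventually_elim (simp add: p_def)
    have [measurable]: "(\<lambda>w. p A (S g w)) \<in> borel_measurable \<Omega>" if "A \<in> fin" for A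
      using that Sm(1)[of g] by measurable
    have m: "measure M (\<Phi> g A) = measure M A" if A: "A \<in> fin" for A
    proof -
      have "expectation (p (\<Phi> g A)) = expectation (\<lambda>w. p A (S g w))"
        by (rule integral_cong_AE) (use p[OF A] A \<Phi>[OF A] in auto)
      then show ?thesis
        using expectation_p_comp[OF A Sm, of "\<lambda>x. x"] expectation_p[OF A] expectation_p[OF \<Phi>[OF A]] by simp
    qed
    have "expectation (\<lambda>w. p (\<Phi> g A) w * p (\<Phi> g B) w) = expectation (\<lambda>w. p A (S g w) * p B (S g w))"
      by (rule integral_cong_AE) (use p[OF A] p[OF B] A B \<Phi> in auto)
    also have "\<dots> = (\<integral>w. p A w * p B w \<partial>distr \<Omega> \<Omega> (S g))"
      by (rule integral_distr[symmetric]) (use A B Sm(1) in auto)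
    also have "\<dots> = expectation (\<lambda>w. p A w * p B w)" unfolding Sm(2) ..
    finally show ?thesis
      unfolding expectation_p_mult[OF A B] expectation_p_mult[OF \<Phi>[OF A] \<Phi>[OF B]] m[OF A] m[OF B] by simp
  qed
  have "\<exists>f. f \<in> measurable M M \<and> distr M M f = M \<and> (\<forall>A\<in>fin. AE x in M. f x \<in> A \<longleftrightarrow> x \<in> \<Phi> g A)" for g
  proof (rule point_map_of_fin_map[OF \<Phi> cov])
    fix B assume B: "B \<in> fin"
    \<comment> \<open>The group structure supplies surjectivity.\<close>
    have "AE x in M. x \<in> \<Phi> g (\<Phi> (- g) B) \<longleftrightarrow> x \<in> B"
      using comp[OF B, of "- g" g] id[OF B] by simp (auto elim: eventually_elim2)
    then show "\<exists>C\<in>fin. AE x in M. x \<in> \<Phi> g C \<longleftrightarrow> x \<in> B" using \<Phi>[OF B] by blast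
  next
    fix f assume "f \<in> measurable M M" "distr M M f = M" "\<And>A. A \<in> fin \<Longrightarrow> AE x in M. f x \<in> A \<longleftrightarrow> x \<in> \<Phi> g A"
    then show ?thesis by (intro exI[of _ f]) simp
  qed
  then obtain T where T: "\<And>g. T g \<in> measurable M M" "\<And>g. distr M M (T g) = M"
    and T\<Phi>: "\<And>g A. A \<in> fin \<Longrightarrow> AE x in M. T g x \<in> A \<longleftrightarrow> x \<in> \<Phi> g A" by metis
  have Tadd: "AE x in M. T (g + h) x = T g (T h x)" for g h
  proof (rule AE_eq_if_AE_mem_fin[OF T(1)])
    show "(\<lambda>x. T g (T h x)) \<in> measurable M M" using T(1) by measurable
    fix A assume A: "A \<in> fin"
    show "AE x in M. T (g + h) x \<in> A \<longleftrightarrow> T g (T h x) \<in> A"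
      using T\<Phi>[OF A, of "g + h"] comp[OF A, of g h] distr_AE_iff[OF T T\<Phi>[OF A, of g], of h] T\<Phi>[OF \<Phi>[OF A, of g], of h]
      by eventually_elim simp
  qed
  have T0: "AE x in M. T 0 x = x"
  proof (rule AE_eq_if_AE_mem_fin[OF T(1)])
    fix A assume A: "A \<in> fin"
    show "AE x in M. T 0 x \<in> A \<longleftrightarrow> x \<in> A" using T\<Phi>[OF A, of 0] id[OF A] by eventually_elim simp
  qed simp
  have inv: "AE x in M. T (- g) (T g x) = x" "AE x in M. T g (T (- g) x) = x" for g
  proof -
    show "AE x in M. T (- g) (T g x) = x" using Tadd[of "- g" g] T0 by simp (auto elim: eventually_elim2)
    show "AE x in M. T g (T (- g) x) = x" using Tadd[of g "- g"] T0 by simp (auto elim: eventually_elim2)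
  qed
  have TA: "T g \<in> Aut M" for g
    unfolding Aut_def by (rule mp_isoI[OF standard_borel_base standard_borel_base T(1) T(1) T(2) inv])
  have base: "AE w in \<Omega>. P A (S g w) = P (vim M (T g) A) w" if A: "A \<in> sets M" for g A
  proof (cases "emeasure M A < \<infinity>")
    case True
    with A have Af: "A \<in> fin" by (rule finI)
    have "AE x in M. x \<in> \<Phi> g A \<longleftrightarrow> x \<in> vim M (T g) A" using T\<Phi>[OF Af, of g] AE_space by eventually_elim simp
    from AE_P_eq_of_AE[OF finD(1)[OF \<Phi>[OF Af]] AutD(3)[OF TA A] this] P\<Phi>[OF Af, of g]
    show ?thesis by eventually_elim simp
  next
    case False
    then have inf: "emeasure M A = \<infinity>" by (simp add: less_top[symmetric])
    have "emeasure M (vim M (T g) A) = \<infinity>" using AutD(4)[OF TA A] inf by simp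
    from AE_P_infinite[OF AutD(3)[OF TA A] this] distr_AE_iff[OF Sm AE_P_infinite[OF A inf], of g]
    show ?thesis by eventually_elim simp
  qed
  have "continuous_map euclidean (weak_topology M) T"
  proof (rule continuous_weak_topologyI[OF TA])
    fix A g0 assume A: "A \<in> sets M" "emeasure M A < \<infinity>"
    then have Af: "A \<in> fin" by (rule finI)
    define F where "F = {w \<in> space \<Omega>. P A w = 0}"
    have F: "F \<in> events" unfolding F_def using Af by measurable
    let ?m = "\<lambda>g. measure M (sym_diff (vim M (T g) A) (vim M (T g0) A))"
    let ?q = "\<lambda>g. prob (sym_diff (vim \<Omega> (S g) F) (vim \<Omega> (S g0) F))"
    note Tf = fin_vim[OF TA Af]
    have q: "?q g = 2 * exp (- measure M A) * (1 - exp (- ?m g / 2))" for g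
    proof -
      have v: "AE w in \<Omega>. w \<in> vim \<Omega> (S g) F \<longleftrightarrow> w \<in> {w \<in> space \<Omega>. P (vim M (T g) A) w = 0}" for g
        using base[OF A(1), of g] AE_space
        by eventually_elim (use measurable_space[OF Sm(1), of _ g] in \<open>auto simp: F_def\<close>)
      have [measurable]: "P (vim M (T g) A) \<in> borel_measurable \<Omega>" for g using Tf by simp
      have "?q g = prob (sym_diff {w \<in> space \<Omega>. P (vim M (T g) A) w = 0} {w \<in> space \<Omega>. P (vim M (T g0) A) w = 0})"
        by (rule prob_sym_diff_cong[OF AutD(3)[OF SA F] AutD(3)[OF SA F] _ _ v v]) measurable
      then show ?thesis using prob_sym_diff_void[OF Tf Tf, of g g0] measure_vim_Aut[OF TA A(1)] by simp
    qed
    \<comment> \<open>The formula for \<open>?q\<close> is solved for the distance in the base, so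
      continuity of \<open>S\<close> at the single event \<open>F\<close> gives that of
      \<open>T\<close> at \<open>A\<close>.\<close>
    have m: "?m g = - 2 * ln (1 - ?q g * exp (measure M A) / 2)" for g
    proof -
      have "?q g * exp (measure M A) / 2 = 1 - exp (- ?m g / 2)"
        unfolding q by (simp add: exp_minus field_simps)
      then have "1 - ?q g * exp (measure M A) / 2 = exp (- ?m g / 2)" by linarith
      then have "ln (1 - ?q g * exp (measure M A) / 2) = - ?m g / 2" by (simp only: ln_exp)
      then show ?thesis by linarith
    qed
    have "(?q \<longlongrightarrow> 0) (nhds g0)"
      using act unfolding mp_action_def by (intro continuous_weak_topologyD[OF SA _ F]) (auto simp: emeasure_eq_measure)
    then have "((\<lambda>g. - 2 * ln (1 - ?q g * exp (measure M A) / 2)) \<longlongrightarrow> - 2 * ln (1 - 0 * exp (measure M A) / 2)) (nhds g0)"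
      by (intro tendsto_intros) auto
    then show "(?m \<longlongrightarrow> 0) (nhds g0)" unfolding m by simp
  qed
  with TA Tadd have "mp_action M T" unfolding mp_action_def by blast
  with base show ?thesis unfolding base_action_def by blast
qed

end

theorem theorem1:
  fixes M :: "'a measure" and \<Omega> :: "'w measure" and P :: "'a set \<Rightarrow> 'w \<Rightarrow> ennreal"
  assumes "generative_ppp M \<Omega> P"
  shows
    "(\<forall>T :: 'g::{topological_group_add, polish_space} \<Rightarrow> 'a \<Rightarrow> 'a. mp_action M T \<longrightarrow>
        (\<exists>S. poissonian_action M \<Omega> P S \<and> base_action M \<Omega> P S T))
     \<and>
     (\<forall>(M1 :: 'a1 measure) (\<Omega>1 :: 'w1 measure) P1 (S1 :: 'g \<Rightarrow> 'w1 \<Rightarrow> 'w1) T1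
       (M2 :: 'a2 measure) (\<Omega>2 :: 'w2 measure) P2 (S2 :: 'g \<Rightarrow> 'w2 \<Rightarrow> 'w2) T2.
        generative_ppp M1 \<Omega>1 P1 \<and> poissonian_action M1 \<Omega>1 P1 S1 \<and> base_action M1 \<Omega>1 P1 S1 T1 \<and>
        generative_ppp M2 \<Omega>2 P2 \<and> poissonian_action M2 \<Omega>2 P2 S2 \<and> base_action M2 \<Omega>2 P2 S2 T2 \<and>
        isomorphic_actions M1 T1 M2 T2 \<longrightarrow>
          isomorphic_actions \<Omega>1 S1 \<Omega>2 S2)
     \<and>
     (\<forall>S :: 'g \<Rightarrow> 'w \<Rightarrow> 'w. poissonian_action M \<Omega> P S \<longrightarrow>
        (\<exists>T. base_action M \<Omega> P S T \<and>
           (\<forall>T'. base_action M \<Omega> P S T' \<longrightarrow> (\<forall>g. AE x in M. T g x = T' g x))))"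
proof (intro conjI)
  interpret ppp M \<Omega> P using assms by unfold_locales (simp add: generative_ppp_def)
  show "\<forall>T :: 'g \<Rightarrow> 'a \<Rightarrow> 'a. mp_action M T \<longrightarrow> (\<exists>S. poissonian_action M \<Omega> P S \<and> base_action M \<Omega> P S T)"
    using base_action_lift[OF assms] by blast
  show "\<forall>S :: 'g \<Rightarrow> 'w \<Rightarrow> 'w. poissonian_action M \<Omega> P S \<longrightarrow>
        (\<exists>T. base_action M \<Omega> P S T \<and>
           (\<forall>T'. base_action M \<Omega> P S T' \<longrightarrow> (\<forall>g. AE x in M. T g x = T' g x)))"
    using base_action_exists base_action_unique by blast
  show "\<forall>(M1 :: 'a1 measure) (\<Omega>1 :: 'w1 measure) P1 (S1 :: 'g \<Rightarrow> 'w1 \<Rightarrow> 'w1) T1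
       (M2 :: 'a2 measure) (\<Omega>2 :: 'w2 measure) P2 (S2 :: 'g \<Rightarrow> 'w2 \<Rightarrow> 'w2) T2.
        generative_ppp M1 \<Omega>1 P1 \<and> poissonian_action M1 \<Omega>1 P1 S1 \<and> base_action M1 \<Omega>1 P1 S1 T1 \<and>
        generative_ppp M2 \<Omega>2 P2 \<and> poissonian_action M2 \<Omega>2 P2 S2 \<and> base_action M2 \<Omega>2 P2 S2 T2 \<and>
        isomorphic_actions M1 T1 M2 T2 \<longrightarrow>
          isomorphic_actions \<Omega>1 S1 \<Omega>2 S2"
    unfolding poissonian_action_def by (intro allI impI, elim conjE) (rule isomorphic_actions_lift)
qed

end
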